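(* Let $\chi$ be a subcategory of $A$-mod as in the context and let $\Gamma$ be an infinite connected stable subquiver of the Auslander–Reiten quiver $\Gamma_\chi$. If there is a $\tau_\chi$-periodic module in $\Gamma$, then $\Gamma$ is a stable tube.
   Context: $A$ is an indecomposable Artin algebra over an algebraically closed field; $A$-mod is the category of finitely generated left $A$-modules. A subcategory means a full subcategory closed under isomorphisms, direct sums and direct summands. $\chi$ is functorially finite (every module has a right $\chi$-approximation $X_Y\to Y$, i.e. $X_Y$ in $\chi$ and every morphism from a module of $\chi$ to $Y$ factors through it, and dually a left one) and closed under extensions; moreover $\chi$ contains a functorially finite resolving subcategory $\Omega={}^\bot T$ for a generalized cotilting module $T$ (finite injective dimension; $\operatorname{Ext}^i_A(T,T)=0$ for $i\ge1$; every injective module has a finite resolution by modules in $\operatorname{add}(T)$; ${}^\bot T=\{X:\operatorname{Ext}_A^i(X,T)=0\ \forall i\ge1\}$; resolving means closed under extensions and kernels of epimorphisms and containing ${}_AA$), so $\chi$ contains all projective modules. $P$ in $\chi$ is Ext-projective in $\chi$ if $\operatorname{Ext}_A^i(P,M)=0$ for all $M$ in $\chi$, $i\ge1$; Ext-injective dually. A morphism in $\chi$ is irreducible in $\chi$ if it is neither a split mono nor a split epi and whenever it factors as $gh$ through a module of $\chi$, $h$ is a split mono or $g$ is a split epi. For $Y$ indecomposable in $\chi$ and not Ext-projective, there is a unique almost split sequence $0\to\tau_\chi(Y)\to E\to Y\to 0$ in $\chi$ (left map minimal left almost split in $\chi$, right map minimal right almost split in $\chi$); dually $\tau_\chi^{-1}(Y)$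 exists iff $Y$ is not Ext-injective. The quiver $\Gamma_\chi$ has the indecomposable modules in $\chi$ (up to isomorphism) as vertices, arrows $X\to Y$ (with multiplicity) when there is an irreducible morphism $X\to Y$ in $\chi$, and 2-arrows $Y\dashrightarrow\tau_\chi(Y)$. A subquiver contains all arrows of $\Gamma_\chi$ between its vertices; it is connected if any two of its vertices are joined by a walk in it, and infinite if it contains infinitely many non-isomorphic indecomposable modules. A module $X$ is stable in $\chi$ if $\tau_\chi^n(X)$ exists for all $n\in\mathbb Z$, and $\tau_\chi$-periodic if $\tau_\chi^n(X)=X$ for some $n\ge1$. A subquiver $\Gamma$ is stable if all its modules are stable and $\tau_\chi^n(X)$ is in $\Gamma$ for every $X$ in $\Gamma$ and $n\in\mathbb Z$. The $\tau_\chi$-orbit of $X$ is $\{\tau_\chi^n(X):n\in\mathbb Z\}$. A path is sectional if it contains no consecutive $X_i\to X_{i+1}\to X_{i+2}$ with $X_i=\tau_\chi(X_{i+2})$. A stable subquiver $\Gamma$ of $\Gamma_\chi$ is a stable tube if every module in $\Gamma$ is $\tau_\chi$-periodic and $\Gamma$ contains an infinite sectional path $\cdots\to X_n\to X_{n-1}\to\cdots\to X_1\to X_0$ such that each $\tau_\chi$-orbit in $\Gamma$ is generated by a unique $X_i$. *)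

theory Defs
  imports "HOL-Algebra.Algebra" "HOL-Algebra.Algebraic_Closure"
begin

section \<open>Finite-dimensional algebras\<close>

definition fin_gen :: "('r, 'x) ring_scheme \<Rightarrow> ('r, 'm) module \<Rightarrow> bool" where
  "fin_gen R M \<longleftrightarrow> (\<exists>S. finite S \<and> S \<subseteq> carrier M \<and>
     (\<forall>x\<in>carrier M. \<exists>c\<in>S \<rightarrow> carrier R. x = finsum M (\<lambda>s. c s \<odot>\<^bsub>M\<^esub> s) S))"

text \<open>The library locale \<^locale>\<open>algebra\<close> only covers commutative algebras.  The record
  \<open>A\<close> carries the ring structure together with the scalar action of \<open>k\<close>.  An Artin algebra
  over a field is the same as a finite-dimensional algebra.\<close>

definition artin_algebra :: "('k, 'x) ring_scheme \<Rightarrow> ('k, 'a) module \<Rightarrow> bool" where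
  "artin_algebra k A \<longleftrightarrow> field k \<and> ring A \<and> module k A \<and>
     (\<forall>c\<in>carrier k. \<forall>a\<in>carrier A. \<forall>b\<in>carrier A.
        (c \<odot>\<^bsub>A\<^esub> a) \<otimes>\<^bsub>A\<^esub> b = c \<odot>\<^bsub>A\<^esub> (a \<otimes>\<^bsub>A\<^esub> b) \<and>
        a \<otimes>\<^bsub>A\<^esub> (c \<odot>\<^bsub>A\<^esub> b) = c \<odot>\<^bsub>A\<^esub> (a \<otimes>\<^bsub>A\<^esub> b)) \<and>
     fin_gen k A"

definition indecomposable_algebra :: "('a, 'x) ring_scheme \<Rightarrow> bool" where
  "indecomposable_algebra A \<longleftrightarrow> carrier A \<noteq> {\<zero>\<^bsub>A\<^esub>} \<and>
     (\<forall>I J. ideal I A \<and> ideal J A \<and> I \<inter> J = {\<zero>\<^bsub>A\<^esub>} \<and> I <+>\<^bsub>A\<^esub> J = carrier A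
        \<longrightarrow> I = {\<zero>\<^bsub>A\<^esub>} \<or> J = {\<zero>\<^bsub>A\<^esub>})"

section \<open>Finitely generated left modules\<close>

text \<open>The library locale \<^locale>\<open>module\<close> requires a commutative ring of scalars.  The fields
  \<^const>\<open>monoid.mult\<close> and \<^const>\<open>monoid.one\<close> of a module record play no role, as in the library.\<close>

definition left_module :: "('a, 'x) ring_scheme \<Rightarrow> ('a, 'm) module \<Rightarrow> bool" where
  "left_module A M \<longleftrightarrow> abelian_group M \<and>
     (\<forall>a\<in>carrier A. \<forall>x\<in>carrier M. a \<odot>\<^bsub>M\<^esub> x \<in> carrier M) \<and>
     (\<forall>a\<in>carrier A. \<forall>b\<in>carrier A. \<forall>x\<in>carrier M.
        (a \<oplus>\<^bsub>A\<^esub> b) \<odot>\<^bsub>M\<^esub> x = a \<odot>\<^bsub>M\<^esub> x \<oplus>\<^bsub>M\<^esub> b \<odot>\<^bsub>M\<^esub> x) \<and>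
     (\<forall>a\<in>carrier A. \<forall>x\<in>carrier M. \<forall>y\<in>carrier M.
        a \<odot>\<^bsub>M\<^esub> (x \<oplus>\<^bsub>M\<^esub> y) = a \<odot>\<^bsub>M\<^esub> x \<oplus>\<^bsub>M\<^esub> a \<odot>\<^bsub>M\<^esub> y) \<and>
     (\<forall>a\<in>carrier A. \<forall>b\<in>carrier A. \<forall>x\<in>carrier M.
        (a \<otimes>\<^bsub>A\<^esub> b) \<odot>\<^bsub>M\<^esub> x = a \<odot>\<^bsub>M\<^esub> (b \<odot>\<^bsub>M\<^esub> x)) \<and>
     (\<forall>x\<in>carrier M. \<one>\<^bsub>A\<^esub> \<odot>\<^bsub>M\<^esub> x = x)"

text \<open>\<open>fg_mods A\<close> is the class of objects of \<open>A\<close>-mod with underlying set in the type \<open>'m\<close>; all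
  notions below are relative to this type.  For \<open>'m = nat \<Rightarrow> 'k\<close>, where \<open>'k\<close> is the type of
  scalars, every finitely generated module over a finite-dimensional \<open>k\<close>-algebra is isomorphic
  to one in \<open>fg_mods A\<close> (transport the structure to \<open>k^n\<close>), so this is a category
  equivalent to \<open>A\<close>-mod.\<close>

definition fg_mods :: "('a, 'x) ring_scheme \<Rightarrow> ('a, 'm) module set" where
  "fg_mods A = {M. left_module A M \<and> fin_gen A M}"

definition regular_module :: "('a, 'x) ring_scheme \<Rightarrow> ('a, 'a) module" where
  "regular_module A = \<lparr>carrier = carrier A, monoid.mult = monoid.mult A, monoid.one = \<one>\<^bsub>A\<^esub>,
     ring.zero = \<zero>\<^bsub>A\<^esub>, ring.add = ring.add A, smult = monoid.mult A\<rparr>"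

text \<open>Homomorphisms are extensional functions, so that equality of morphisms is equality in HOL.\<close>

definition mod_hom ::
  "('a, 'x) ring_scheme \<Rightarrow> ('a, 'm) module \<Rightarrow> ('a, 'n) module \<Rightarrow> ('m \<Rightarrow> 'n) set" where
  "mod_hom A M N = {f \<in> carrier M \<rightarrow>\<^sub>E carrier N.
     (\<forall>x\<in>carrier M. \<forall>y\<in>carrier M. f (x \<oplus>\<^bsub>M\<^esub> y) = f x \<oplus>\<^bsub>N\<^esub> f y) \<and>
     (\<forall>a\<in>carrier A. \<forall>x\<in>carrier M. f (a \<odot>\<^bsub>M\<^esub> x) = a \<odot>\<^bsub>N\<^esub> f x)}"

definition mod_id :: "('a, 'm) module \<Rightarrow> 'm \<Rightarrow> 'm" where
  "mod_id M = (\<lambda>x\<in>carrier M. x)"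

definition mod_zero_map :: "('a, 'm) module \<Rightarrow> ('a, 'n) module \<Rightarrow> 'm \<Rightarrow> 'n" where
  "mod_zero_map M N = (\<lambda>x\<in>carrier M. \<zero>\<^bsub>N\<^esub>)"

definition mod_ker :: "('a, 'm) module \<Rightarrow> ('a, 'n) module \<Rightarrow> ('m \<Rightarrow> 'n) \<Rightarrow> 'm set" where
  "mod_ker M N f = {x \<in> carrier M. f x = \<zero>\<^bsub>N\<^esub>}"

definition mod_iso :: "('a, 'x) ring_scheme \<Rightarrow> ('a, 'm) module \<Rightarrow> ('a, 'n) module \<Rightarrow> bool" where
  "mod_iso A M N \<longleftrightarrow> (\<exists>f\<in>mod_hom A M N. bij_betw f (carrier M) (carrier N))"

definition zero_module :: "('a, 'm) module \<Rightarrow> bool" where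
  "zero_module M \<longleftrightarrow> carrier M = {\<zero>\<^bsub>M\<^esub>}"

text \<open>\<open>M\<close> is a direct sum (biproduct) of \<open>W 0, \<dots>, W (n - 1)\<close>; for \<open>n = 0\<close> this says that \<open>M\<close>
  is a zero module.\<close>

definition direct_sum ::
  "('a, 'x) ring_scheme \<Rightarrow> nat \<Rightarrow> (nat \<Rightarrow> ('a, 'm) module) \<Rightarrow> ('a, 'm) module \<Rightarrow> bool" where
  "direct_sum A n W M \<longleftrightarrow> M \<in> fg_mods A \<and> (\<forall>i<n. W i \<in> fg_mods A) \<and>
     (\<exists>u p. (\<forall>i<n. u i \<in> mod_hom A (W i) M \<and> p i \<in> mod_hom A M (W i)) \<and>
        (\<forall>i<n. \<forall>j<n. compose (carrier (W i)) (p j) (u i) =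
            (if i = j then mod_id (W i) else mod_zero_map (W i) (W j))) \<and>
        (\<forall>x\<in>carrier M. finsum M (\<lambda>i. u i (p i x)) {..<n} = x))"

definition direct_summand ::
  "('a, 'x) ring_scheme \<Rightarrow> ('a, 'm) module \<Rightarrow> ('a, 'm) module \<Rightarrow> bool" where
  "direct_summand A W M \<longleftrightarrow> (\<exists>Y. direct_sum A 2 (\<lambda>i. if i = 0 then W else Y) M)"

definition indecomposable :: "('a, 'x) ring_scheme \<Rightarrow> ('a, 'm) module \<Rightarrow> bool" where
  "indecomposable A M \<longleftrightarrow> M \<in> fg_mods A \<and> \<not> zero_module M \<and>
     (\<forall>W Y. direct_sum A 2 (\<lambda>i. if i = 0 then W else Y) M \<longrightarrow> zero_module W \<or> zero_module Y)"

definition split_mono ::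
  "('a, 'x) ring_scheme \<Rightarrow> ('a, 'm) module \<Rightarrow> ('a, 'm) module \<Rightarrow> ('m \<Rightarrow> 'm) \<Rightarrow> bool" where
  "split_mono A M N f \<longleftrightarrow> f \<in> mod_hom A M N \<and>
     (\<exists>g\<in>mod_hom A N M. compose (carrier M) g f = mod_id M)"

definition split_epi ::
  "('a, 'x) ring_scheme \<Rightarrow> ('a, 'm) module \<Rightarrow> ('a, 'm) module \<Rightarrow> ('m \<Rightarrow> 'm) \<Rightarrow> bool" where
  "split_epi A M N f \<longleftrightarrow> f \<in> mod_hom A M N \<and>
     (\<exists>g\<in>mod_hom A N M. compose (carrier N) f g = mod_id N)"

definition short_exact :: "('a, 'x) ring_scheme \<Rightarrow> ('a, 'm) module \<Rightarrow> ('m \<Rightarrow> 'm) \<Rightarrow>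
    ('a, 'm) module \<Rightarrow> ('m \<Rightarrow> 'm) \<Rightarrow> ('a, 'm) module \<Rightarrow> bool" where
  "short_exact A W f E g Y \<longleftrightarrow> W \<in> fg_mods A \<and> E \<in> fg_mods A \<and> Y \<in> fg_mods A \<and>
     f \<in> mod_hom A W E \<and> g \<in> mod_hom A E Y \<and>
     inj_on f (carrier W) \<and> f ` carrier W = mod_ker E Y g \<and> g ` carrier E = carrier Y"

section \<open>Resolutions and Ext\<close>

definition projective_mod :: "('a, 'x) ring_scheme \<Rightarrow> ('a, 'm) module \<Rightarrow> bool" where
  "projective_mod A P \<longleftrightarrow> P \<in> fg_mods A \<and>
     (\<forall>(M :: ('a, 'm) module)\<in>fg_mods A. \<forall>(N :: ('a, 'm) module)\<in>fg_mods A.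
      \<forall>g\<in>mod_hom A M N. \<forall>f\<in>mod_hom A P N.
        g ` carrier M = carrier N \<longrightarrow> (\<exists>h\<in>mod_hom A P M. compose (carrier P) g h = f))"

definition injective_mod :: "('a, 'x) ring_scheme \<Rightarrow> ('a, 'm) module \<Rightarrow> bool" where
  "injective_mod A J \<longleftrightarrow> J \<in> fg_mods A \<and>
     (\<forall>(M :: ('a, 'm) module)\<in>fg_mods A. \<forall>(N :: ('a, 'm) module)\<in>fg_mods A.
      \<forall>g\<in>mod_hom A M N. \<forall>f\<in>mod_hom A M J.
        inj_on g (carrier M) \<longrightarrow> (\<exists>h\<in>mod_hom A N J. compose (carrier M) h g = f))"

text \<open>Exactness of \<open>\<cdots> \<rightarrow> P 1 \<rightarrow> P 0 \<rightarrow> W \<rightarrow> 0\<close> with augmentation \<open>d 0 : P 0 \<rightarrow> W\<close> and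
  differentials \<open>d (n + 1) : P (n + 1) \<rightarrow> P n\<close>.\<close>

definition resolution :: "('a, 'x) ring_scheme \<Rightarrow> ('a, 'm) module set \<Rightarrow> ('a, 'm) module \<Rightarrow>
    (nat \<Rightarrow> ('a, 'm) module) \<Rightarrow> (nat \<Rightarrow> 'm \<Rightarrow> 'm) \<Rightarrow> bool" where
  "resolution A C W P d \<longleftrightarrow> W \<in> fg_mods A \<and> (\<forall>n. P n \<in> fg_mods A \<inter> C) \<and>
     d 0 \<in> mod_hom A (P 0) W \<and> (\<forall>n. d (Suc n) \<in> mod_hom A (P (Suc n)) (P n)) \<and>
     d 0 ` carrier (P 0) = carrier W \<and>
     d 1 ` carrier (P 1) = mod_ker (P 0) W (d 0) \<and>
     (\<forall>n. d (Suc (Suc n)) ` carrier (P (Suc (Suc n))) = mod_ker (P (Suc n)) (P n) (d (Suc n)))"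

text \<open>Exactness of \<open>0 \<rightarrow> W \<rightarrow> J 0 \<rightarrow> J 1 \<rightarrow> \<cdots>\<close> with \<open>d 0 : W \<rightarrow> J 0\<close> and
  \<open>d (n + 1) : J n \<rightarrow> J (n + 1)\<close>.\<close>

definition coresolution :: "('a, 'x) ring_scheme \<Rightarrow> ('a, 'm) module set \<Rightarrow> ('a, 'm) module \<Rightarrow>
    (nat \<Rightarrow> ('a, 'm) module) \<Rightarrow> (nat \<Rightarrow> 'm \<Rightarrow> 'm) \<Rightarrow> bool" where
  "coresolution A C W J d \<longleftrightarrow> W \<in> fg_mods A \<and> (\<forall>n. J n \<in> fg_mods A \<inter> C) \<and>
     d 0 \<in> mod_hom A W (J 0) \<and> (\<forall>n. d (Suc n) \<in> mod_hom A (J n) (J (Suc n))) \<and>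
     inj_on (d 0) (carrier W) \<and>
     d 0 ` carrier W = mod_ker (J 0) (J 1) (d 1) \<and>
     (\<forall>n. d (Suc n) ` carrier (J n) = mod_ker (J (Suc n)) (J (Suc (Suc n))) (d (Suc (Suc n))))"

definition finite_injective_dim :: "('a, 'x) ring_scheme \<Rightarrow> ('a, 'm) module \<Rightarrow> bool" where
  "finite_injective_dim A W \<longleftrightarrow>
     (\<exists>J d n. coresolution A {J. injective_mod A J} W J d \<and> (\<forall>i>n. zero_module (J i)))"

definition ext_cocycles :: "('a, 'x) ring_scheme \<Rightarrow> (nat \<Rightarrow> ('a, 'm) module) \<Rightarrow>
    (nat \<Rightarrow> 'm \<Rightarrow> 'm) \<Rightarrow> nat \<Rightarrow> ('a, 'm) module \<Rightarrow> ('m \<Rightarrow> 'm) set" where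
  "ext_cocycles A P d i Y = {f \<in> mod_hom A (P i) Y.
     compose (carrier (P (Suc i))) f (d (Suc i)) = mod_zero_map (P (Suc i)) Y}"

definition ext_coboundaries :: "('a, 'x) ring_scheme \<Rightarrow> (nat \<Rightarrow> ('a, 'm) module) \<Rightarrow>
    (nat \<Rightarrow> 'm \<Rightarrow> 'm) \<Rightarrow> nat \<Rightarrow> ('a, 'm) module \<Rightarrow> ('m \<Rightarrow> 'm) set" where
  "ext_coboundaries A P d i Y = (case i of 0 \<Rightarrow> {mod_zero_map (P 0) Y}
     | Suc j \<Rightarrow> (\<lambda>g. compose (carrier (P (Suc j))) g (d (Suc j))) ` mod_hom A (P j) Y)"

text \<open>The \<open>i\<close>-th cohomology group of \<open>Hom(P, Y)\<close> for a chosen projective resolution \<open>P\<close> of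
  \<open>W\<close>.\<close>

definition Ext :: "('a, 'x) ring_scheme \<Rightarrow> nat \<Rightarrow> ('a, 'm) module \<Rightarrow> ('a, 'm) module \<Rightarrow>
    ('m \<Rightarrow> 'm) set monoid" where
  "Ext A i W Y =
     (let Q = (SOME Q. resolution A {P. projective_mod A P} W (fst Q) (snd Q));
          P = fst Q; d = snd Q
      in \<lparr>carrier = ext_cocycles A P d i Y,
          monoid.mult = (\<lambda>f g. \<lambda>x\<in>carrier (P i). f x \<oplus>\<^bsub>Y\<^esub> g x),
          monoid.one = mod_zero_map (P i) Y\<rparr> Mod ext_coboundaries A P d i Y)"

definition Ext_zero ::
  "('a, 'x) ring_scheme \<Rightarrow> nat \<Rightarrow> ('a, 'm) module \<Rightarrow> ('a, 'm) module \<Rightarrow> bool" where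
  "Ext_zero A i W Y \<longleftrightarrow> carrier (Ext A i W Y) = {\<one>\<^bsub>Ext A i W Y\<^esub>}"

section \<open>Subcategories of \<open>A\<close>-mod\<close>

text \<open>A full subcategory is given by its class of objects.\<close>

definition subcategory :: "('a, 'x) ring_scheme \<Rightarrow> ('a, 'm) module set \<Rightarrow> bool" where
  "subcategory A \<chi> \<longleftrightarrow> \<chi> \<subseteq> fg_mods A \<and>
     (\<forall>W\<in>\<chi>. \<forall>Y\<in>fg_mods A. mod_iso A W Y \<longrightarrow> Y \<in> \<chi>) \<and>
     (\<forall>n W M. (\<forall>i<n. W i \<in> \<chi>) \<and> direct_sum A n W M \<longrightarrow> M \<in> \<chi>) \<and>
     (\<forall>M\<in>\<chi>. \<forall>W. direct_summand A W M \<longrightarrow> W \<in> \<chi>)"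

definition right_approximation :: "('a, 'x) ring_scheme \<Rightarrow> ('a, 'm) module set \<Rightarrow>
    ('a, 'm) module \<Rightarrow> ('m \<Rightarrow> 'm) \<Rightarrow> ('a, 'm) module \<Rightarrow> bool" where
  "right_approximation A \<chi> W f Y \<longleftrightarrow> W \<in> \<chi> \<and> f \<in> mod_hom A W Y \<and>
     (\<forall>Z\<in>\<chi>. \<forall>g\<in>mod_hom A Z Y. \<exists>h\<in>mod_hom A Z W. g = compose (carrier Z) f h)"

definition left_approximation :: "('a, 'x) ring_scheme \<Rightarrow> ('a, 'm) module set \<Rightarrow>
    ('a, 'm) module \<Rightarrow> ('m \<Rightarrow> 'm) \<Rightarrow> ('a, 'm) module \<Rightarrow> bool" where
  "left_approximation A \<chi> Y f W \<longleftrightarrow> W \<in> \<chi> \<and> f \<in> mod_hom A Y W \<and>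
     (\<forall>Z\<in>\<chi>. \<forall>g\<in>mod_hom A Y Z. \<exists>h\<in>mod_hom A W Z. g = compose (carrier Y) h f)"

definition functorially_finite :: "('a, 'x) ring_scheme \<Rightarrow> ('a, 'm) module set \<Rightarrow> bool" where
  "functorially_finite A \<chi> \<longleftrightarrow>
     (\<forall>Y\<in>fg_mods A. (\<exists>W f. right_approximation A \<chi> W f Y) \<and> (\<exists>W f. left_approximation A \<chi> Y f W))"

definition extension_closed :: "('a, 'x) ring_scheme \<Rightarrow> ('a, 'm) module set \<Rightarrow> bool" where
  "extension_closed A \<chi> \<longleftrightarrow>
     (\<forall>W f E g Y. short_exact A W f E g Y \<and> W \<in> \<chi> \<and> Y \<in> \<chi> \<longrightarrow> E \<in> \<chi>)"

definition resolving :: "('a, 'x) ring_scheme \<Rightarrow> ('a, 'm) module set \<Rightarrow> bool" where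
  "resolving A \<chi> \<longleftrightarrow> subcategory A \<chi> \<and> extension_closed A \<chi> \<and>
     (\<forall>W f E g Y. short_exact A W f E g Y \<and> E \<in> \<chi> \<and> Y \<in> \<chi> \<longrightarrow> W \<in> \<chi>) \<and>
     (\<exists>P\<in>\<chi>. mod_iso A P (regular_module A))"

definition add_mod :: "('a, 'x) ring_scheme \<Rightarrow> ('a, 'm) module \<Rightarrow> ('a, 'm) module set" where
  "add_mod A T = {W. \<exists>n M. direct_sum A n (\<lambda>_. T) M \<and> direct_summand A W M}"

definition left_perp :: "('a, 'x) ring_scheme \<Rightarrow> ('a, 'm) module \<Rightarrow> ('a, 'm) module set" where
  "left_perp A T = {W \<in> fg_mods A. \<forall>i\<ge>1. Ext_zero A i W T}"

definition generalized_cotilting :: "('a, 'x) ring_scheme \<Rightarrow> ('a, 'm) module \<Rightarrow> bool" where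
  "generalized_cotilting A T \<longleftrightarrow> T \<in> fg_mods A \<and> finite_injective_dim A T \<and>
     (\<forall>i\<ge>1. Ext_zero A i T T) \<and>
     (\<forall>J. injective_mod A J \<longrightarrow>
        (\<exists>P d n. resolution A (add_mod A T) J P d \<and> (\<forall>i>n. zero_module (P i))))"

section \<open>Almost split sequences and irreducible morphisms\<close>

definition ext_projective ::
  "('a, 'x) ring_scheme \<Rightarrow> ('a, 'm) module set \<Rightarrow> ('a, 'm) module \<Rightarrow> bool" where
  "ext_projective A \<chi> P \<longleftrightarrow> P \<in> \<chi> \<and> (\<forall>M\<in>\<chi>. \<forall>i\<ge>1. Ext_zero A i P M)"

definition ext_injective ::
  "('a, 'x) ring_scheme \<Rightarrow> ('a, 'm) module set \<Rightarrow> ('a, 'm) module \<Rightarrow> bool" where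
  "ext_injective A \<chi> J \<longleftrightarrow> J \<in> \<chi> \<and> (\<forall>M\<in>\<chi>. \<forall>i\<ge>1. Ext_zero A i M J)"

definition irreducible_in :: "('a, 'x) ring_scheme \<Rightarrow> ('a, 'm) module set \<Rightarrow>
    ('a, 'm) module \<Rightarrow> ('a, 'm) module \<Rightarrow> ('m \<Rightarrow> 'm) \<Rightarrow> bool" where
  "irreducible_in A \<chi> W Y f \<longleftrightarrow> W \<in> \<chi> \<and> Y \<in> \<chi> \<and> f \<in> mod_hom A W Y \<and>
     \<not> split_mono A W Y f \<and> \<not> split_epi A W Y f \<and>
     (\<forall>Z\<in>\<chi>. \<forall>h\<in>mod_hom A W Z. \<forall>g\<in>mod_hom A Z Y. f = compose (carrier W) g h \<longrightarrow>
        split_mono A W Z h \<or> split_epi A Z Y g)"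

definition minimal_left_almost_split :: "('a, 'x) ring_scheme \<Rightarrow> ('a, 'm) module set \<Rightarrow>
    ('a, 'm) module \<Rightarrow> ('a, 'm) module \<Rightarrow> ('m \<Rightarrow> 'm) \<Rightarrow> bool" where
  "minimal_left_almost_split A \<chi> W E f \<longleftrightarrow> W \<in> \<chi> \<and> E \<in> \<chi> \<and> f \<in> mod_hom A W E \<and>
     \<not> split_mono A W E f \<and>
     (\<forall>Z\<in>\<chi>. \<forall>h\<in>mod_hom A W Z. \<not> split_mono A W Z h \<longrightarrow>
        (\<exists>g\<in>mod_hom A E Z. h = compose (carrier W) g f)) \<and>
     (\<forall>g\<in>mod_hom A E E. compose (carrier W) g f = f \<longrightarrow> bij_betw g (carrier E) (carrier E))"

definition minimal_right_almost_split :: "('a, 'x) ring_scheme \<Rightarrow> ('a, 'm) module set \<Rightarrow>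
    ('a, 'm) module \<Rightarrow> ('a, 'm) module \<Rightarrow> ('m \<Rightarrow> 'm) \<Rightarrow> bool" where
  "minimal_right_almost_split A \<chi> E Y f \<longleftrightarrow> E \<in> \<chi> \<and> Y \<in> \<chi> \<and> f \<in> mod_hom A E Y \<and>
     \<not> split_epi A E Y f \<and>
     (\<forall>Z\<in>\<chi>. \<forall>h\<in>mod_hom A Z Y. \<not> split_epi A Z Y h \<longrightarrow>
        (\<exists>g\<in>mod_hom A Z E. h = compose (carrier Z) f g)) \<and>
     (\<forall>g\<in>mod_hom A E E. compose (carrier E) f g = f \<longrightarrow> bij_betw g (carrier E) (carrier E))"

definition almost_split_sequence :: "('a, 'x) ring_scheme \<Rightarrow> ('a, 'm) module set \<Rightarrow>
    ('a, 'm) module \<Rightarrow> ('m \<Rightarrow> 'm) \<Rightarrow> ('a, 'm) module \<Rightarrow> ('m \<Rightarrow> 'm) \<Rightarrow> ('a, 'm) module \<Rightarrow> bool" where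
  "almost_split_sequence A \<chi> W f E g Y \<longleftrightarrow> short_exact A W f E g Y \<and>
     minimal_left_almost_split A \<chi> W E f \<and> minimal_right_almost_split A \<chi> E Y g"

section \<open>The Auslander--Reiten quiver\<close>

text \<open>A vertex is an isomorphism class of indecomposable modules in \<open>\<chi>\<close>; it is handled
  through its representatives.\<close>

definition ind_mods :: "('a, 'x) ring_scheme \<Rightarrow> ('a, 'm) module set \<Rightarrow> ('a, 'm) module set" where
  "ind_mods A \<chi> = {W \<in> \<chi>. indecomposable A W}"

definition arrow :: "('a, 'x) ring_scheme \<Rightarrow> ('a, 'm) module set \<Rightarrow>
    ('a, 'm) module \<Rightarrow> ('a, 'm) module \<Rightarrow> bool" where
  "arrow A \<chi> W Y \<longleftrightarrow> W \<in> ind_mods A \<chi> \<and> Y \<in> ind_mods A \<chi> \<and> (\<exists>f. irreducible_in A \<chi> W Y f)"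

text \<open>\<open>tau A \<chi> Y W\<close> says that the translate of \<open>Y\<close> exists and is isomorphic to \<open>W\<close>,
  equivalently that the inverse translate of \<open>W\<close> exists and is isomorphic to \<open>Y\<close>.\<close>

definition tau :: "('a, 'x) ring_scheme \<Rightarrow> ('a, 'm) module set \<Rightarrow>
    ('a, 'm) module \<Rightarrow> ('a, 'm) module \<Rightarrow> bool" where
  "tau A \<chi> Y W \<longleftrightarrow> W \<in> ind_mods A \<chi> \<and> Y \<in> ind_mods A \<chi> \<and>
     \<not> ext_projective A \<chi> Y \<and> \<not> ext_injective A \<chi> W \<and>
     (\<exists>f E g. almost_split_sequence A \<chi> W f E g Y)"

text \<open>\<open>tau_pow A \<chi> n W Y\<close> says that the \<open>n\<close>-th translate of \<open>W\<close> exists and is isomorphic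
  to \<open>Y\<close>.\<close>

definition tau_pow :: "('a, 'x) ring_scheme \<Rightarrow> ('a, 'm) module set \<Rightarrow> int \<Rightarrow>
    ('a, 'm) module \<Rightarrow> ('a, 'm) module \<Rightarrow> bool" where
  "tau_pow A \<chi> n W Y \<longleftrightarrow> W \<in> ind_mods A \<chi> \<and> Y \<in> ind_mods A \<chi> \<and>
     (\<exists>Z. (if n \<ge> 0 then ((tau A \<chi>) ^^ nat n) W Z else ((tau A \<chi>)\<inverse>\<inverse> ^^ nat (- n)) W Z) \<and>
          mod_iso A Z Y)"

definition tau_orbit :: "('a, 'x) ring_scheme \<Rightarrow> ('a, 'm) module set \<Rightarrow>
    ('a, 'm) module \<Rightarrow> ('a, 'm) module set" where
  "tau_orbit A \<chi> W = {Y. \<exists>n. tau_pow A \<chi> n W Y}"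

definition stable_in :: "('a, 'x) ring_scheme \<Rightarrow> ('a, 'm) module set \<Rightarrow> ('a, 'm) module \<Rightarrow> bool" where
  "stable_in A \<chi> W \<longleftrightarrow> (\<forall>n. \<exists>Y. tau_pow A \<chi> n W Y)"

definition tau_periodic ::
  "('a, 'x) ring_scheme \<Rightarrow> ('a, 'm) module set \<Rightarrow> ('a, 'm) module \<Rightarrow> bool" where
  "tau_periodic A \<chi> W \<longleftrightarrow> (\<exists>n\<ge>1. tau_pow A \<chi> n W W)"

text \<open>Subquivers contain all arrows between their vertices, so a subquiver is given by its
  vertices, i.e. by a class of indecomposable modules closed under isomorphism.\<close>

definition subquiver :: "('a, 'x) ring_scheme \<Rightarrow> ('a, 'm) module set \<Rightarrow> ('a, 'm) module set \<Rightarrow> bool" where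
  "subquiver A \<chi> \<Gamma> \<longleftrightarrow> \<Gamma> \<subseteq> ind_mods A \<chi> \<and>
     (\<forall>W\<in>\<Gamma>. \<forall>Y\<in>ind_mods A \<chi>. mod_iso A W Y \<longrightarrow> Y \<in> \<Gamma>)"

text \<open>One step of a walk traverses an arrow or a 2-arrow in either direction, or replaces a
  module by an isomorphic one.\<close>

definition walk_step :: "('a, 'x) ring_scheme \<Rightarrow> ('a, 'm) module set \<Rightarrow> ('a, 'm) module set \<Rightarrow>
    ('a, 'm) module \<Rightarrow> ('a, 'm) module \<Rightarrow> bool" where
  "walk_step A \<chi> \<Gamma> W Y \<longleftrightarrow> W \<in> \<Gamma> \<and> Y \<in> \<Gamma> \<and>
     (arrow A \<chi> W Y \<or> arrow A \<chi> Y W \<or> tau A \<chi> W Y \<or> tau A \<chi> Y W \<or> mod_iso A W Y)"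

definition connected_subquiver ::
  "('a, 'x) ring_scheme \<Rightarrow> ('a, 'm) module set \<Rightarrow> ('a, 'm) module set \<Rightarrow> bool" where
  "connected_subquiver A \<chi> \<Gamma> \<longleftrightarrow> subquiver A \<chi> \<Gamma> \<and>
     (\<forall>W\<in>\<Gamma>. \<forall>Y\<in>\<Gamma>. (walk_step A \<chi> \<Gamma>)\<^sup>*\<^sup>* W Y)"

definition infinite_subquiver ::
  "('a, 'x) ring_scheme \<Rightarrow> ('a, 'm) module set \<Rightarrow> ('a, 'm) module set \<Rightarrow> bool" where
  "infinite_subquiver A \<chi> \<Gamma> \<longleftrightarrow> subquiver A \<chi> \<Gamma> \<and>
     infinite (\<Gamma> // {(W, Y). W \<in> \<Gamma> \<and> Y \<in> \<Gamma> \<and> mod_iso A W Y})"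

definition stable_subquiver ::
  "('a, 'x) ring_scheme \<Rightarrow> ('a, 'm) module set \<Rightarrow> ('a, 'm) module set \<Rightarrow> bool" where
  "stable_subquiver A \<chi> \<Gamma> \<longleftrightarrow> subquiver A \<chi> \<Gamma> \<and>
     (\<forall>W\<in>\<Gamma>. stable_in A \<chi> W \<and> (\<forall>n Y. tau_pow A \<chi> n W Y \<longrightarrow> Y \<in> \<Gamma>))"

text \<open>\<open>W\<close> is an infinite sectional path \<open>\<cdots> \<rightarrow> W 2 \<rightarrow> W 1 \<rightarrow> W 0\<close> in \<open>\<Gamma>\<close>.\<close>

definition infinite_sectional_path :: "('a, 'x) ring_scheme \<Rightarrow> ('a, 'm) module set \<Rightarrow>
    ('a, 'm) module set \<Rightarrow> (nat \<Rightarrow> ('a, 'm) module) \<Rightarrow> bool" where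
  "infinite_sectional_path A \<chi> \<Gamma> W \<longleftrightarrow> (\<forall>i. W i \<in> \<Gamma>) \<and> (\<forall>i. arrow A \<chi> (W (Suc i)) (W i)) \<and>
     (\<forall>i. \<not> tau A \<chi> (W i) (W (i + 2)))"

definition stable_tube ::
  "('a, 'x) ring_scheme \<Rightarrow> ('a, 'm) module set \<Rightarrow> ('a, 'm) module set \<Rightarrow> bool" where
  "stable_tube A \<chi> \<Gamma> \<longleftrightarrow> stable_subquiver A \<chi> \<Gamma> \<and> (\<forall>W\<in>\<Gamma>. tau_periodic A \<chi> W) \<and>
     (\<exists>W. infinite_sectional_path A \<chi> \<Gamma> W \<and>
        (\<forall>Y\<in>\<Gamma>. \<exists>!i. tau_orbit A \<chi> Y = tau_orbit A \<chi> (W i)))"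

end

theory Submission
  imports "Jordan_Normal_Form.Missing_VectorSpace" Defs
begin

text \<open>Let \<open>d\<close> be the dimension over \<open>k\<close>.  For \<open>Y\<close> in \<open>\<Gamma>\<close> with almost split sequence
  \<open>0 \<rightarrow> \<tau>Y \<rightarrow> E \<rightarrow> Y \<rightarrow> 0\<close>, the arrows \<open>W \<rightarrow> Y\<close> come from the indecomposable direct summands \<open>W\<close>
  of \<open>E\<close> (\<open>arrow_into_iff\<close>), and so do the arrows \<open>\<tau>Y \<rightarrow> W\<close> (\<open>arrow_from_iff\<close>).  By exchange, the
  direct sum of pairwise nonisomorphic indecomposable summands of \<open>E\<close> is again a summand, so that
  \<open>\<Sum> d W \<le> d Y + d (\<tau>Y)\<close>, the sum over the modules \<open>W\<close> in \<open>\<Gamma>\<close> with an arrow to \<open>Y\<close>.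
  In particular only finitely many arrows end at \<open>Y\<close>; a power of \<open>\<tau>\<close> that fixes \<open>Y\<close> permutes
  their starting points.  Hence periodicity spreads from one module to all of \<open>\<Gamma>\<close>.

  Averaging \<open>d\<close> over the finite \<open>\<tau>\<close>-orbits gives a positive function \<open>F\<close> on the infinite
  connected graph of orbits for which the values at the neighbours of an orbit \<open>a\<close> add up to at
  most \<open>2 * F a\<close>.  Such a function is concave, hence nondecreasing, along every infinite
  path without repetitions.  This leaves few possibilities (\<open>hamiltonian_ray_or_tight\<close>): either
  some one-sided infinite path visits every orbit, or the graph is \<open>D\<^sub>\<infinity>\<close> or \<open>A\<^sub>\<infinity>\<^sup>\<infinity>\<close>, the
  function \<open>F\<close> is bounded and all inequalities are equalities.

  In the first case the path lifts to a sectional path of modules, which shows that \<open>\<Gamma>\<close> is a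
  stable tube.  The second case is impossible.  There the predecessors of a module lie in
  different orbits, so that one period serves all of \<open>\<Gamma>\<close> and \<open>d\<close> itself is bounded.  The
  equalities say that every indecomposable summand of a middle term \<open>E\<close> belongs to \<open>\<Gamma>\<close>.  A
  nonzero element of a module in \<open>\<Gamma>\<close> can therefore be lifted through arbitrarily many middle
  terms, which yields arbitrarily long chains of nonisomorphisms in \<open>\<Gamma>\<close> with nonzero composite
  (\<open>no_bounded_closed_family\<close>).  This contradicts the lemma of Harada and Sai.\<close>

(* These names of the vector space library would shadow the notions of the theorem. *)
hide_const (open) LinearCombinations.mod_hom SumSpaces.direct_sum

section \<open>Finite-dimensional vector spaces\<close>

lemma (in abelian_monoid) finsum_mem:
  assumes "finite F" "H \<subseteq> carrier G" "\<zero> \<in> H" "\<And>x y. x \<in> H \<Longrightarrow> y \<in> H \<Longrightarrow> x \<oplus> y \<in> H"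
    "\<And>i. i \<in> F \<Longrightarrow> f i \<in> H"
  shows "finsum G f F \<in> H"
  using assms(1,5)
proof (induction F)
  case (insert i F)
  then show ?case using assms(2,4) by (subst finsum_insert) auto
qed (use assms in auto)

text \<open>The dimension of the whole space bounds the independent subsets of the subspace, so a maximal
  one exists; in particular subspaces are again finite-dimensional.\<close>

lemma (in vectorspace) subspace_basis:
  assumes fd: "fin_dim" and S: "submodule K S V"
  obtains B where "finite B" "B \<subseteq> S" "span B = S" "lin_indpt B" "vectorspace.dim K (vs S) = card B"
    "vectorspace.fin_dim K (vs S)"
proof -
  have SV: "S \<subseteq> carrier V" using S by (simp add: submodule_def)
  have sub: "VectorSpace.subspace K S V" using S by (simp add: VectorSpace.subspace_def vectorspace_axioms)
  interpret W: vectorspace K "vs S" using subspace_is_vs[OF sub] .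
  have dep: "W.lin_dep B = lin_dep B" "W.span B = span B" if "B \<subseteq> S" for B
    using span_li_not_depend[OF that S] by auto
  have "finite B \<and> card B \<le> dim" if "B \<subseteq> carrier (vs S) \<and> W.lin_indpt B" for B
    using that li_le_dim[OF fd, of B] SV dep(1)[of B] by auto
  moreover have "{} \<subseteq> carrier (vs S) \<and> W.lin_indpt {}" by (simp add: W.lin_dep_def)
  ultimately obtain B where B: "finite B" "maximal B (\<lambda>B. B \<subseteq> carrier (vs S) \<and> W.lin_indpt B)"
    using maximal_exists[where P="\<lambda>B. B \<subseteq> carrier (vs S) \<and> W.lin_indpt B" and N=dim and B="{}"]
    by blast
  have bas: "W.basis B" by (rule W.max_li_is_basis[OF B(2)])
  then have BS: "B \<subseteq> S" "W.lin_indpt B" "W.span B = S" by (auto simp: W.basis_def)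
  show thesis
    by (rule that[of B]) (use B BS dep[of B] W.dim_basis[OF B(1) bas] in \<open>auto simp: W.fin_dim_def\<close>)
qed

text \<open>A basis of the subspace is independent in the whole space; if it has full cardinality, it
  spans.\<close>

lemma (in vectorspace) subspace_dim_le:
  assumes fd: "fin_dim" and S: "submodule K S V"
  shows "vectorspace.dim K (vs S) \<le> dim" "vectorspace.dim K (vs S) = dim \<Longrightarrow> S = carrier V"
proof -
  have SV: "S \<subseteq> carrier V" using S by (simp add: submodule_def)
  obtain B where B: "finite B" "B \<subseteq> S" "span B = S" "lin_indpt B" "vectorspace.dim K (vs S) = card B"
    by (rule subspace_basis[OF fd S])
  show "vectorspace.dim K (vs S) \<le> dim" using li_le_dim[OF fd _ B(4)] B(2,5) SV by auto
  assume "vectorspace.dim K (vs S) = dim"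
  then have "basis B" using dim_li_is_basis[OF fd B(1) _ B(4)] B(2,5) SV by auto
  then show "S = carrier V" using B(3) by (simp add: basis_def)
qed

section \<open>The underlying vector space of a module\<close>

locale fd_algebra =
  fixes k :: "'k ring" and A :: "('k, 'a) module"
  assumes artin: "artin_algebra k A"
begin

text \<open>The scalar \<open>c\<close> acts on a module as the element \<open>c \<odot> \<one>\<close> of \<open>A\<close>; this provides modules with a
  dimension.\<close>

definition scal :: "('a, 'm) module \<Rightarrow> ('k, 'm) module" where
  "scal M = \<lparr>carrier = carrier M, monoid.mult = monoid.mult M, monoid.one = monoid.one M,
     ring.zero = \<zero>\<^bsub>M\<^esub>, ring.add = ring.add M, smult = (\<lambda>c x. (c \<odot>\<^bsub>A\<^esub> \<one>\<^bsub>A\<^esub>) \<odot>\<^bsub>M\<^esub> x)\<rparr>"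

lemma scal_simps [simp]:
  "carrier (scal M) = carrier M" "\<zero>\<^bsub>scal M\<^esub> = \<zero>\<^bsub>M\<^esub>" "ring.add (scal M) = ring.add M"
  "c \<odot>\<^bsub>scal M\<^esub> x = (c \<odot>\<^bsub>A\<^esub> \<one>\<^bsub>A\<^esub>) \<odot>\<^bsub>M\<^esub> x"
  by (simp_all add: scal_def)

lemma finsum_scal: "finsum (scal M) f S = finsum M f S"
  by (simp add: finsum_def scal_def finprod_def)

lemma scal_restrict: "scal (M\<lparr>carrier := S\<rparr>) = (scal M)\<lparr>carrier := S\<rparr>"
  by (simp add: scal_def)

sublocale field k using artin by (simp add: artin_algebra_def)
sublocale A: ring A using artin by (simp add: artin_algebra_def)
sublocale Ak: Module.module k A using artin by (simp add: artin_algebra_def)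

lemma scal_assoc:
  assumes "c \<in> carrier k" "a \<in> carrier A" "b \<in> carrier A"
  shows "(c \<odot>\<^bsub>A\<^esub> a) \<otimes>\<^bsub>A\<^esub> b = c \<odot>\<^bsub>A\<^esub> (a \<otimes>\<^bsub>A\<^esub> b)"
  using artin assms by (simp add: artin_algebra_def)

lemma scal_vectorspace:
  assumes "left_module A M" shows "vectorspace k (scal M)"
proof -
  have ab: "abelian_group M" using assms by (simp add: left_module_def)
  have ab': "abelian_group (scal M)"
  proof -
    interpret M: abelian_group M by (fact ab)
    show ?thesis
      by (rule abelian_groupI) (auto simp: M.add.m_ac intro: M.l_neg bexI[of _ "\<ominus>\<^bsub>M\<^esub> _"])
  qed
  have mul: "((c \<otimes>\<^bsub>k\<^esub> d) \<odot>\<^bsub>A\<^esub> \<one>\<^bsub>A\<^esub>) = (c \<odot>\<^bsub>A\<^esub> \<one>\<^bsub>A\<^esub>) \<otimes>\<^bsub>A\<^esub> (d \<odot>\<^bsub>A\<^esub> \<one>\<^bsub>A\<^esub>)"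
    if "c \<in> carrier k" "d \<in> carrier k" for c d
    using that by (simp add: scal_assoc Ak.smult_assoc1)
  have "Module.module k (scal M)"
    by (rule Module.module.intro, fact is_cring, fact ab')
      (unfold_locales, use assms in \<open>auto simp: left_module_def mul Ak.smult_l_distr\<close>)
  then show ?thesis by (simp add: vectorspace_def field_axioms)
qed

lemma fg_left_module: "M \<in> fg_mods A \<Longrightarrow> left_module A M"
  by (simp add: fg_mods_def)

lemma fg_abelian_group: "M \<in> fg_mods A \<Longrightarrow> abelian_group M"
  by (simp add: fg_mods_def left_module_def)

lemma smult_closed: "M \<in> fg_mods A \<Longrightarrow> a \<in> carrier A \<Longrightarrow> x \<in> carrier M \<Longrightarrow> a \<odot>\<^bsub>M\<^esub> x \<in> carrier M"
  by (simp add: fg_mods_def left_module_def)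

lemma smult_add: "M \<in> fg_mods A \<Longrightarrow> a \<in> carrier A \<Longrightarrow> x \<in> carrier M \<Longrightarrow> y \<in> carrier M \<Longrightarrow>
    a \<odot>\<^bsub>M\<^esub> (x \<oplus>\<^bsub>M\<^esub> y) = a \<odot>\<^bsub>M\<^esub> x \<oplus>\<^bsub>M\<^esub> a \<odot>\<^bsub>M\<^esub> y"
  by (simp add: fg_mods_def left_module_def)

lemma left_smult_zero:
  assumes "left_module A M" "x \<in> carrier M" shows "\<zero>\<^bsub>A\<^esub> \<odot>\<^bsub>M\<^esub> x = \<zero>\<^bsub>M\<^esub>"
proof -
  interpret M: abelian_group M using assms by (simp add: left_module_def)
  have c: "\<zero>\<^bsub>A\<^esub> \<odot>\<^bsub>M\<^esub> x \<in> carrier M" using assms by (simp add: left_module_def)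
  have "(\<zero>\<^bsub>A\<^esub> \<oplus>\<^bsub>A\<^esub> \<zero>\<^bsub>A\<^esub>) \<odot>\<^bsub>M\<^esub> x = \<zero>\<^bsub>A\<^esub> \<odot>\<^bsub>M\<^esub> x \<oplus>\<^bsub>M\<^esub> \<zero>\<^bsub>A\<^esub> \<odot>\<^bsub>M\<^esub> x"
    using assms A.zero_closed unfolding left_module_def by blast
  then show ?thesis using c by (metis A.l_zero A.zero_closed M.add.l_cancel_one)
qed

lemma left_smult_minus:
  assumes "left_module A M" "x \<in> carrier M" shows "(\<ominus>\<^bsub>A\<^esub> \<one>\<^bsub>A\<^esub>) \<odot>\<^bsub>M\<^esub> x = \<ominus>\<^bsub>M\<^esub> x"
proof -
  interpret M: abelian_group M using assms by (simp add: left_module_def)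
  have c: "(\<ominus>\<^bsub>A\<^esub> \<one>\<^bsub>A\<^esub>) \<odot>\<^bsub>M\<^esub> x \<in> carrier M" using assms by (simp add: left_module_def)
  have "(\<ominus>\<^bsub>A\<^esub> \<one>\<^bsub>A\<^esub> \<oplus>\<^bsub>A\<^esub> \<one>\<^bsub>A\<^esub>) \<odot>\<^bsub>M\<^esub> x = (\<ominus>\<^bsub>A\<^esub> \<one>\<^bsub>A\<^esub>) \<odot>\<^bsub>M\<^esub> x \<oplus>\<^bsub>M\<^esub> \<one>\<^bsub>A\<^esub> \<odot>\<^bsub>M\<^esub> x"
    using assms A.one_closed A.a_inv_closed unfolding left_module_def by blast
  moreover have "\<one>\<^bsub>A\<^esub> \<odot>\<^bsub>M\<^esub> x = x" using assms by (simp add: left_module_def)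
  ultimately have "(\<ominus>\<^bsub>A\<^esub> \<one>\<^bsub>A\<^esub>) \<odot>\<^bsub>M\<^esub> x \<oplus>\<^bsub>M\<^esub> x = \<zero>\<^bsub>M\<^esub>"
    using left_smult_zero[OF assms] by (simp add: A.l_neg)
  then show ?thesis using c assms(2) by (simp add: M.minus_equality)
qed

text \<open>The products of the generators of \<open>A\<close> over \<open>k\<close> with the generators of \<open>M\<close> over \<open>A\<close> span
  \<open>M\<close> over \<open>k\<close>.\<close>

lemma scal_fin_dim:
  assumes M: "M \<in> fg_mods A" shows "vectorspace.fin_dim k (scal M)"
proof -
  have lm: "left_module A M" by (rule fg_left_module[OF M])
  interpret M: abelian_group M by (rule fg_abelian_group[OF M])
  interpret V: vectorspace k "scal M" by (rule scal_vectorspace[OF lm])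
  obtain S where S: "finite S" "S \<subseteq> carrier M"
    "\<And>x. x \<in> carrier M \<Longrightarrow> \<exists>c\<in>S \<rightarrow> carrier A. x = finsum M (\<lambda>s. c s \<odot>\<^bsub>M\<^esub> s) S"
    using M by (auto simp: fg_mods_def fin_gen_def)
  obtain B where B: "finite B" "B \<subseteq> carrier A"
    "\<And>x. x \<in> carrier A \<Longrightarrow> \<exists>c\<in>B \<rightarrow> carrier k. x = finsum A (\<lambda>s. c s \<odot>\<^bsub>A\<^esub> s) B"
    using artin by (auto simp: artin_algebra_def fin_gen_def)
  define T where "T = (\<lambda>(b, s). b \<odot>\<^bsub>M\<^esub> s) ` (B \<times> S)"
  have T: "finite T" "T \<subseteq> carrier M"
    using S(1,2) B(1,2) lm by (auto simp: T_def left_module_def)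
  define H where "H = V.span T"
  have sub: "submodule k H (scal M)" unfolding H_def by (rule V.span_is_submodule) (simp add: T)
  have H: "H \<subseteq> carrier M" "\<zero>\<^bsub>M\<^esub> \<in> H" "\<And>x y. x \<in> H \<Longrightarrow> y \<in> H \<Longrightarrow> x \<oplus>\<^bsub>M\<^esub> y \<in> H"
    "\<And>c x. c \<in> carrier k \<Longrightarrow> x \<in> H \<Longrightarrow> (c \<odot>\<^bsub>A\<^esub> \<one>\<^bsub>A\<^esub>) \<odot>\<^bsub>M\<^esub> x \<in> H"
    using sub unfolding submodule_def by auto
  have TH: "T \<subseteq> H" unfolding H_def by (rule V.in_own_span) (simp add: T)
  have as: "a \<odot>\<^bsub>M\<^esub> s \<in> H" if a: "a \<in> carrier A" and s: "s \<in> S" for a s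
  proof -
    obtain c where c: "c \<in> B \<rightarrow> carrier k" "a = finsum A (\<lambda>b. c b \<odot>\<^bsub>A\<^esub> b) B" using B(3)[OF a] by blast
    have sM: "s \<in> carrier M" using s S by auto
    have "finsum A (\<lambda>b. c b \<odot>\<^bsub>A\<^esub> b) F \<odot>\<^bsub>M\<^esub> s \<in> H" if "finite F" "F \<subseteq> B" for F
      using that
    proof (induction F)
      case empty
      then show ?case using left_smult_zero[OF lm sM] H(2) by simp
    next
      case (insert b F)
      have cb: "c b \<in> carrier k" "b \<in> carrier A" using insert.prems c(1) B(2) by auto
      have cl: "(\<lambda>b. c b \<odot>\<^bsub>A\<^esub> b) \<in> F \<rightarrow> carrier A" using insert.prems c(1) B(2) by auto
      have e: "c b \<odot>\<^bsub>A\<^esub> b = (c b \<odot>\<^bsub>A\<^esub> \<one>\<^bsub>A\<^esub>) \<otimes>\<^bsub>A\<^esub> b" using cb by (simp add: scal_assoc)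
      have "(c b \<odot>\<^bsub>A\<^esub> b) \<odot>\<^bsub>M\<^esub> s = (c b \<odot>\<^bsub>A\<^esub> \<one>\<^bsub>A\<^esub>) \<odot>\<^bsub>M\<^esub> (b \<odot>\<^bsub>M\<^esub> s)"
        unfolding e using cb lm sM by (simp add: left_module_def)
      moreover have "b \<odot>\<^bsub>M\<^esub> s \<in> H" using insert.prems s TH by (auto simp: T_def)
      ultimately have "(c b \<odot>\<^bsub>A\<^esub> b) \<odot>\<^bsub>M\<^esub> s \<in> H" using H(4) cb(1) by simp
      moreover have "finsum A (\<lambda>b. c b \<odot>\<^bsub>A\<^esub> b) (insert b F)
          = c b \<odot>\<^bsub>A\<^esub> b \<oplus>\<^bsub>A\<^esub> finsum A (\<lambda>b. c b \<odot>\<^bsub>A\<^esub> b) F"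
        using insert.hyps cl cb by (subst A.finsum_insert) auto
      moreover have "(c b \<odot>\<^bsub>A\<^esub> b \<oplus>\<^bsub>A\<^esub> finsum A (\<lambda>b. c b \<odot>\<^bsub>A\<^esub> b) F) \<odot>\<^bsub>M\<^esub> s
          = (c b \<odot>\<^bsub>A\<^esub> b) \<odot>\<^bsub>M\<^esub> s \<oplus>\<^bsub>M\<^esub> finsum A (\<lambda>b. c b \<odot>\<^bsub>A\<^esub> b) F \<odot>\<^bsub>M\<^esub> s"
        using lm sM cb A.finsum_closed[OF cl] Ak.smult_closed unfolding left_module_def by blast
      ultimately show ?case using H(3) insert by simp
    qed
    from this[of B] show ?thesis using B(1) c(2) by simp
  qed
  have "x \<in> H" if xM: "x \<in> carrier M" for x
  proof -
    obtain c where c: "c \<in> S \<rightarrow> carrier A" "x = finsum M (\<lambda>s. c s \<odot>\<^bsub>M\<^esub> s) S" using S(3)[OF xM] by blast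
    show ?thesis unfolding c(2)
      by (rule M.finsum_mem[OF S(1) H(1-3)]) (use c(1) as in auto)
  qed
  then have "H = carrier M" using H(1) by auto
  then show ?thesis unfolding V.fin_dim_def H_def using T by auto
qed

definition submod :: "('a, 'm) module \<Rightarrow> 'm set \<Rightarrow> bool" where
  "submod M S \<longleftrightarrow> S \<subseteq> carrier M \<and> \<zero>\<^bsub>M\<^esub> \<in> S \<and> (\<forall>x\<in>S. \<forall>y\<in>S. x \<oplus>\<^bsub>M\<^esub> y \<in> S) \<and>
     (\<forall>a\<in>carrier A. \<forall>x\<in>S. a \<odot>\<^bsub>M\<^esub> x \<in> S)"

lemma submod_submodule:
  assumes "M \<in> fg_mods A" "submod M S" shows "submodule k S (scal M)"
proof -
  have "vectorspace k (scal M)" by (rule scal_vectorspace[OF fg_left_module[OF assms(1)]])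
  then have "Module.module k (scal M)" by (simp add: vectorspace_def)
  then show ?thesis using assms(2) by (auto simp: submodule_def submod_def)
qed

text \<open>Submodules are finitely generated because they are finite-dimensional: a basis over \<open>k\<close> also
  generates over \<open>A\<close>.\<close>

lemma submod_fg:
  assumes M: "M \<in> fg_mods A" and S: "submod M S" shows "M\<lparr>carrier := S\<rparr> \<in> fg_mods A"
proof -
  have lm: "left_module A M" by (rule fg_left_module[OF M])
  interpret M: abelian_group M by (rule fg_abelian_group[OF M])
  interpret V: vectorspace k "scal M" by (rule scal_vectorspace[OF lm])
  have SM: "S \<subseteq> carrier M" using S by (simp add: submod_def)
  have neg: "\<ominus>\<^bsub>M\<^esub> x \<in> S" if "x \<in> S" for x
  proof -
    have "\<ominus>\<^bsub>A\<^esub> \<one>\<^bsub>A\<^esub> \<in> carrier A" by simp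
    then have "(\<ominus>\<^bsub>A\<^esub> \<one>\<^bsub>A\<^esub>) \<odot>\<^bsub>M\<^esub> x \<in> S" using S that unfolding submod_def by blast
    then show ?thesis using left_smult_minus[OF lm, of x] that SM by auto
  qed
  have "abelian_group (M\<lparr>carrier := S\<rparr>)"
  proof (rule abelian_groupI)
    fix x assume x: "x \<in> carrier (M\<lparr>carrier := S\<rparr>)"
    show "\<exists>y\<in>carrier (M\<lparr>carrier := S\<rparr>). y \<oplus>\<^bsub>M\<lparr>carrier := S\<rparr>\<^esub> x = \<zero>\<^bsub>M\<lparr>carrier := S\<rparr>\<^esub>"
      using x neg[of x] SM by (auto intro!: bexI[of _ "\<ominus>\<^bsub>M\<^esub> x"] M.l_neg)
  qed (use S SM in \<open>auto simp: submod_def subset_iff M.a_assoc intro: M.a_comm\<close>)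
  then have lmS: "left_module A (M\<lparr>carrier := S\<rparr>)"
    using lm S SM by (auto simp: left_module_def submod_def subset_iff)
  have sub: "submodule k S (scal M)" by (rule submod_submodule[OF M S])
  obtain B where B: "finite B" "B \<subseteq> S" "V.span B = S"
    using V.subspace_basis[OF scal_fin_dim[OF M] sub] by metis
  have "\<exists>c\<in>B \<rightarrow> carrier A. x = finsum (M\<lparr>carrier := S\<rparr>) (\<lambda>s. c s \<odot>\<^bsub>M\<lparr>carrier := S\<rparr>\<^esub> s) B"
    if xS: "x \<in> S" for x
  proof -
    obtain c where c: "c \<in> B \<rightarrow> carrier k" "V.lincomb c B = x"
      using V.finite_in_span[OF B(1), of x] B(2,3) SM xS by auto
    have "x = finsum (scal M\<lparr>carrier := S\<rparr>) (\<lambda>s. c s \<odot>\<^bsub>scal M\<^esub> s) B"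
      unfolding c(2)[symmetric] V.lincomb_def
      by (rule V.finsum_not_depend[symmetric, OF B(1) _ sub])
        (use c(1) B(2) S Ak.smult_closed[OF _ A.one_closed] in
          \<open>auto simp: submod_def Pi_iff subset_iff\<close>)
    also have "\<dots> = finsum (M\<lparr>carrier := S\<rparr>) (\<lambda>s. (c s \<odot>\<^bsub>A\<^esub> \<one>\<^bsub>A\<^esub>) \<odot>\<^bsub>M\<^esub> s) B"
      unfolding scal_restrict[symmetric] finsum_scal by simp
    finally show ?thesis
      by (intro bexI[of _ "\<lambda>s. c s \<odot>\<^bsub>A\<^esub> \<one>\<^bsub>A\<^esub>"]) (use c(1) in auto)
  qed
  then have "fin_gen A (M\<lparr>carrier := S\<rparr>)"
    unfolding fin_gen_def using B(1,2) by (intro exI[of _ B]) auto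
  then show ?thesis using lmS by (simp add: fg_mods_def)
qed

definition mdim :: "('a, 'm) module \<Rightarrow> nat" where
  "mdim M = vectorspace.dim k (scal M)"

lemma mdim_submod:
  assumes M: "M \<in> fg_mods A" and S: "submod M S"
  shows "mdim (M\<lparr>carrier := S\<rparr>) \<le> mdim M" "mdim (M\<lparr>carrier := S\<rparr>) = mdim M \<Longrightarrow> S = carrier M"
proof -
  interpret V: vectorspace k "scal M" by (rule scal_vectorspace[OF fg_left_module[OF M]])
  note * = V.subspace_dim_le[OF scal_fin_dim[OF M] submod_submodule[OF M S]]
  show "mdim (M\<lparr>carrier := S\<rparr>) \<le> mdim M" "mdim (M\<lparr>carrier := S\<rparr>) = mdim M \<Longrightarrow> S = carrier M"
    using * by (simp_all add: mdim_def scal_restrict)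
qed

lemma mdim_eq_0_iff:
  fixes M :: "('a, 'm) module"
  assumes M: "M \<in> fg_mods A" shows "mdim M = 0 \<longleftrightarrow> zero_module M"
proof -
  interpret V: vectorspace k "scal M" by (rule scal_vectorspace[OF fg_left_module[OF M]])
  obtain B where B: "finite B" "V.basis B" using V.finite_basis_exists[OF scal_fin_dim[OF M]] by blast
  have d: "mdim M = card B" using V.dim_basis[OF B] by (simp add: mdim_def)
  show ?thesis
  proof
    assume "mdim M = 0"
    then have "B = {}" using d B(1) by simp
    then have "carrier M = V.span {}" using B(2) by (simp add: V.basis_def)
    also have "\<dots> = {\<zero>\<^bsub>M\<^esub>}" by (simp add: V.span_empty)
    finally show "zero_module M" by (simp add: zero_module_def)
  next
    assume "zero_module M"
    then have "V.span {} = carrier (scal M)" by (simp add: V.span_empty zero_module_def)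
    then have "V.dim \<le> card ({} :: 'm set)" using V.gen_ge_dim[of "{}"] by simp
    then show "mdim M = 0" by (simp add: mdim_def)
  qed
qed

section \<open>Homomorphisms\<close>

lemma hom_closed: "f \<in> mod_hom A M N \<Longrightarrow> x \<in> carrier M \<Longrightarrow> f x \<in> carrier N"
  by (auto simp: mod_hom_def)

lemma hom_add: "f \<in> mod_hom A M N \<Longrightarrow> x \<in> carrier M \<Longrightarrow> y \<in> carrier M \<Longrightarrow>
    f (x \<oplus>\<^bsub>M\<^esub> y) = f x \<oplus>\<^bsub>N\<^esub> f y"
  by (auto simp: mod_hom_def)

lemma hom_smult: "f \<in> mod_hom A M N \<Longrightarrow> a \<in> carrier A \<Longrightarrow> x \<in> carrier M \<Longrightarrow>
    f (a \<odot>\<^bsub>M\<^esub> x) = a \<odot>\<^bsub>N\<^esub> f x"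
  by (auto simp: mod_hom_def)

lemma hom_ext: "f \<in> mod_hom A M N \<Longrightarrow> g \<in> mod_hom A M N' \<Longrightarrow> (\<And>x. x \<in> carrier M \<Longrightarrow> f x = g x) \<Longrightarrow> f = g"
  by (rule extensionalityI[of _ "carrier M"]) (auto simp: mod_hom_def PiE_def)

lemma homI:
  assumes "\<And>x. x \<in> carrier M \<Longrightarrow> f x \<in> carrier N"
    "\<And>x y. x \<in> carrier M \<Longrightarrow> y \<in> carrier M \<Longrightarrow> f (x \<oplus>\<^bsub>M\<^esub> y) = f x \<oplus>\<^bsub>N\<^esub> f y"
    "\<And>a x. a \<in> carrier A \<Longrightarrow> x \<in> carrier M \<Longrightarrow> f (a \<odot>\<^bsub>M\<^esub> x) = a \<odot>\<^bsub>N\<^esub> f x"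
    "M \<in> fg_mods A"
  shows "(\<lambda>x\<in>carrier M. f x) \<in> mod_hom A M N"
proof -
  interpret M: abelian_group M by (rule fg_abelian_group[OF assms(4)])
  show ?thesis using assms smult_closed[OF assms(4)] by (auto simp: mod_hom_def)
qed

lemma hom_zero:
  assumes "M \<in> fg_mods A" "N \<in> fg_mods A" "f \<in> mod_hom A M N" shows "f \<zero>\<^bsub>M\<^esub> = \<zero>\<^bsub>N\<^esub>"
proof -
  interpret M: abelian_group M by (rule fg_abelian_group[OF assms(1)])
  interpret N: abelian_group N by (rule fg_abelian_group[OF assms(2)])
  have "f (\<zero>\<^bsub>M\<^esub> \<oplus>\<^bsub>M\<^esub> \<zero>\<^bsub>M\<^esub>) = f \<zero>\<^bsub>M\<^esub> \<oplus>\<^bsub>N\<^esub> f \<zero>\<^bsub>M\<^esub>" by (rule hom_add[OF assms(3)]) auto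
  then show ?thesis using hom_closed[OF assms(3), of "\<zero>\<^bsub>M\<^esub>"] by (simp add: N.add.l_cancel_one)
qed

lemma hom_minus:
  assumes "M \<in> fg_mods A" "N \<in> fg_mods A" "f \<in> mod_hom A M N" "x \<in> carrier M" "y \<in> carrier M"
  shows "f (x \<ominus>\<^bsub>M\<^esub> y) = f x \<ominus>\<^bsub>N\<^esub> f y"
proof -
  interpret M: abelian_group M by (rule fg_abelian_group[OF assms(1)])
  interpret N: abelian_group N by (rule fg_abelian_group[OF assms(2)])
  note c = hom_closed[OF assms(3)]
  have "f (\<ominus>\<^bsub>M\<^esub> y) \<oplus>\<^bsub>N\<^esub> f y = f (\<ominus>\<^bsub>M\<^esub> y \<oplus>\<^bsub>M\<^esub> y)" using assms by (simp add: hom_add)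
  also have "\<dots> = \<zero>\<^bsub>N\<^esub>" using assms by (simp add: M.l_neg hom_zero)
  finally have "\<ominus>\<^bsub>N\<^esub> f y = f (\<ominus>\<^bsub>M\<^esub> y)" using assms c by (simp add: N.minus_equality)
  then show ?thesis using assms by (simp add: a_minus_def hom_add)
qed

lemma hom_compose:
  assumes "M \<in> fg_mods A" "f \<in> mod_hom A M N" "g \<in> mod_hom A N P"
  shows "compose (carrier M) g f \<in> mod_hom A M P"
  unfolding compose_def
  by (rule homI) (use assms in \<open>auto simp: hom_closed hom_add hom_smult\<close>)

lemma hom_id: "M \<in> fg_mods A \<Longrightarrow> mod_id M \<in> mod_hom A M M"
  unfolding mod_id_def by (rule homI) auto

lemma hom_sum:
  assumes "M \<in> fg_mods A" "N \<in> fg_mods A" "f \<in> mod_hom A M N" "g \<in> mod_hom A M N"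
  shows "(\<lambda>x\<in>carrier M. f x \<oplus>\<^bsub>N\<^esub> g x) \<in> mod_hom A M N"
proof -
  interpret N: abelian_group N by (rule fg_abelian_group[OF assms(2)])
  show ?thesis
    by (rule homI) (use assms in \<open>auto simp: hom_closed hom_add hom_smult smult_add N.add.m_ac\<close>)
qed

lemma hom_diff_id:
  assumes "M \<in> fg_mods A" "f \<in> mod_hom A M M"
  shows "(\<lambda>x\<in>carrier M. x \<ominus>\<^bsub>M\<^esub> f x) \<in> mod_hom A M M"
proof -
  interpret M: abelian_group M by (rule fg_abelian_group[OF assms(1)])
  have lm: "left_module A M" by (rule fg_left_module[OF assms(1)])
  have neg: "\<ominus>\<^bsub>M\<^esub> (a \<odot>\<^bsub>M\<^esub> x) = a \<odot>\<^bsub>M\<^esub> (\<ominus>\<^bsub>M\<^esub> x)" if "a \<in> carrier A" "x \<in> carrier M" for a x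
  proof -
    have "a \<odot>\<^bsub>M\<^esub> (\<ominus>\<^bsub>M\<^esub> x) \<oplus>\<^bsub>M\<^esub> a \<odot>\<^bsub>M\<^esub> x = a \<odot>\<^bsub>M\<^esub> \<zero>\<^bsub>M\<^esub>"
      using that smult_add[OF assms(1), of a "\<ominus>\<^bsub>M\<^esub> x" x] by (simp add: M.l_neg)
    moreover have "a \<odot>\<^bsub>M\<^esub> \<zero>\<^bsub>M\<^esub> = \<zero>\<^bsub>M\<^esub>"
    proof -
      have "a \<odot>\<^bsub>M\<^esub> \<zero>\<^bsub>M\<^esub> \<oplus>\<^bsub>M\<^esub> a \<odot>\<^bsub>M\<^esub> \<zero>\<^bsub>M\<^esub> = a \<odot>\<^bsub>M\<^esub> \<zero>\<^bsub>M\<^esub>"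
        using smult_add[OF assms(1) that(1), of "\<zero>\<^bsub>M\<^esub>" "\<zero>\<^bsub>M\<^esub>"] by simp
      then show ?thesis using smult_closed[OF assms(1) that(1), of "\<zero>\<^bsub>M\<^esub>"] by (simp add: M.add.l_cancel_one)
    qed
    ultimately show ?thesis using that smult_closed[OF assms(1)] by (simp add: M.minus_equality)
  qed
  show ?thesis
    by (rule homI) (use assms in \<open>auto simp: hom_closed hom_add hom_smult smult_add smult_closed
      M.minus_add a_minus_def neg M.add.m_ac\<close>)
qed

lemma hom_inverse:
  assumes "M \<in> fg_mods A" "N \<in> fg_mods A" "f \<in> mod_hom A M N" "bij_betw f (carrier M) (carrier N)"
  shows "\<exists>g. g \<in> mod_hom A N M \<and> (\<forall>x\<in>carrier M. g (f x) = x) \<and> (\<forall>y\<in>carrier N. f (g y) = y)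
    \<and> bij_betw g (carrier N) (carrier M)"
proof -
  interpret M: abelian_group M by (rule fg_abelian_group[OF assms(1)])
  define h where "h = inv_into (carrier M) f"
  have inj: "inj_on f (carrier M)" and im: "f ` carrier M = carrier N"
    using assms(4) by (auto simp: bij_betw_def)
  have 1: "h (f x) = x" if "x \<in> carrier M" for x using that inj by (simp add: h_def)
  have 2: "f (h y) = y" "h y \<in> carrier M" if "y \<in> carrier N" for y
    using that im by (auto simp: h_def f_inv_into_f inv_into_into)
  have "(\<lambda>x\<in>carrier N. h x) \<in> mod_hom A N M"
  proof (rule homI)
    fix x y assume xy: "x \<in> carrier N" "y \<in> carrier N"
    have "f (h x \<oplus>\<^bsub>M\<^esub> h y) = x \<oplus>\<^bsub>N\<^esub> y" using xy 2 by (simp add: hom_add[OF assms(3)])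
    then show "h (x \<oplus>\<^bsub>N\<^esub> y) = h x \<oplus>\<^bsub>M\<^esub> h y" using 1[of "h x \<oplus>\<^bsub>M\<^esub> h y"] 2 xy by simp
  next
    fix a x assume ax: "a \<in> carrier A" "x \<in> carrier N"
    have "f (a \<odot>\<^bsub>M\<^esub> h x) = a \<odot>\<^bsub>N\<^esub> x" using ax 2 by (simp add: hom_smult[OF assms(3)])
    then show "h (a \<odot>\<^bsub>N\<^esub> x) = a \<odot>\<^bsub>M\<^esub> h x"
      using 1[of "a \<odot>\<^bsub>M\<^esub> h x"] 2 ax smult_closed[OF assms(1)] by simp
  qed (use 2 assms in auto)
  moreover have "bij_betw (\<lambda>x\<in>carrier N. h x) (carrier N) (carrier M)"
    by (rule bij_betw_byWitness[where f'=f]) (use 1 2 hom_closed[OF assms(3)] in auto)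
  ultimately show ?thesis using 1 2 hom_closed[OF assms(3)] by (intro exI[of _ "\<lambda>x\<in>carrier N. h x"]) auto
qed

lemma factor_through_mono:
  assumes fg: "W \<in> fg_mods A" "E \<in> fg_mods A" "Z \<in> fg_mods A"
    and f: "f \<in> mod_hom A W E" "inj_on f (carrier W)"
    and h: "h \<in> mod_hom A Z E" "h ` carrier Z \<subseteq> f ` carrier W"
  obtains q where "q \<in> mod_hom A Z W" "\<And>z. z \<in> carrier Z \<Longrightarrow> f (q z) = h z"
proof -
  interpret W: abelian_group W by (rule fg_abelian_group[OF fg(1)])
  define q where "q z = inv_into (carrier W) f (h z)" for z
  have q: "f (q z) = h z" "q z \<in> carrier W" if "z \<in> carrier Z" for z
    using that h(2) by (auto simp: q_def f_inv_into_f inv_into_into image_subset_iff)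
  have inj: "x = y" if "f x = f y" "x \<in> carrier W" "y \<in> carrier W" for x y
    using f(2) that by (auto simp: inj_on_def)
  interpret Z: abelian_group Z by (rule fg_abelian_group[OF fg(3)])
  have "(\<lambda>z\<in>carrier Z. q z) \<in> mod_hom A Z W"
  proof (rule homI)
    fix x y assume "x \<in> carrier Z" "y \<in> carrier Z"
    then show "q (x \<oplus>\<^bsub>Z\<^esub> y) = q x \<oplus>\<^bsub>W\<^esub> q y"
      by (intro inj[of "q (x \<oplus>\<^bsub>Z\<^esub> y)"]) (simp_all add: q hom_add[OF f(1)] hom_add[OF h(1)])
  next
    fix a x assume "a \<in> carrier A" "x \<in> carrier Z"
    then show "q (a \<odot>\<^bsub>Z\<^esub> x) = a \<odot>\<^bsub>W\<^esub> q x"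
      by (intro inj[of "q (a \<odot>\<^bsub>Z\<^esub> x)"])
        (simp_all add: q fg smult_closed hom_smult[OF f(1)] hom_smult[OF h(1)])
  qed (use q fg in auto)
  then show thesis using that[of "\<lambda>z\<in>carrier Z. q z"] q by auto
qed

lemma factor_through_epi:
  assumes fg: "E \<in> fg_mods A" "V \<in> fg_mods A" "Z \<in> fg_mods A"
    and g: "g \<in> mod_hom A E V" "g ` carrier E = carrier V"
    and h: "h \<in> mod_hom A E Z" "\<forall>y\<in>carrier E. g y = \<zero>\<^bsub>V\<^esub> \<longrightarrow> h y = \<zero>\<^bsub>Z\<^esub>"
  obtains q where "q \<in> mod_hom A V Z" "\<And>e. e \<in> carrier E \<Longrightarrow> q (g e) = h e"
proof -
  interpret E: abelian_group E by (rule fg_abelian_group[OF fg(1)])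
  interpret V: abelian_group V by (rule fg_abelian_group[OF fg(2)])
  interpret Z: abelian_group Z by (rule fg_abelian_group[OF fg(3)])
  define q where "q x = h (inv_into (carrier E) g x)" for x
  have wd: "h e = h e'" if "e \<in> carrier E" "e' \<in> carrier E" "g e = g e'" for e e'
  proof -
    have "g (e \<ominus>\<^bsub>E\<^esub> e') = \<zero>\<^bsub>V\<^esub>"
      using that hom_minus[OF fg(1,2) g(1)] hom_closed[OF g(1)] by (simp add: V.r_neg a_minus_def)
    then have "h (e \<ominus>\<^bsub>E\<^esub> e') = \<zero>\<^bsub>Z\<^esub>" using that(1,2) h(2) by blast
    then have "h e \<ominus>\<^bsub>Z\<^esub> h e' = \<zero>\<^bsub>Z\<^esub>"
      using that hom_minus[OF fg(1,3) h(1)] by simp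
    then show ?thesis using that hom_closed[OF h(1)] by (simp add: Z.minus_other_side)
  qed
  have q: "q (g e) = h e" if e: "e \<in> carrier E" for e
  proof -
    have "inv_into (carrier E) g (g e) \<in> carrier E" "g (inv_into (carrier E) g (g e)) = g e"
      using e by (auto intro: inv_into_into f_inv_into_f)
    then show ?thesis unfolding q_def using wd[OF _ e] by blast
  qed
  have ex: "\<exists>e\<in>carrier E. x = g e" if "x \<in> carrier V" for x using that g(2) by auto
  have "(\<lambda>x\<in>carrier V. q x) \<in> mod_hom A V Z"
  proof (rule homI)
    fix x y assume "x \<in> carrier V" "y \<in> carrier V"
    then obtain e e' where "e \<in> carrier E" "e' \<in> carrier E" "x = g e" "y = g e'" using ex by blast
    then show "q (x \<oplus>\<^bsub>V\<^esub> y) = q x \<oplus>\<^bsub>Z\<^esub> q y"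
      using q[of "e \<oplus>\<^bsub>E\<^esub> e'"] by (simp add: q hom_add[OF g(1)] hom_add[OF h(1)])
  next
    fix a x assume ax: "a \<in> carrier A" "x \<in> carrier V"
    then obtain e where "e \<in> carrier E" "x = g e" using ex by blast
    then show "q (a \<odot>\<^bsub>V\<^esub> x) = a \<odot>\<^bsub>Z\<^esub> q x"
      using q[of "a \<odot>\<^bsub>E\<^esub> e"] ax smult_closed[OF fg(1)] by (simp add: q hom_smult[OF g(1)] hom_smult[OF h(1)])
  next
    fix x assume "x \<in> carrier V"
    then show "q x \<in> carrier Z" using ex q hom_closed[OF h(1)] by fastforce
  qed (fact fg)
  then show thesis using that[of "\<lambda>x\<in>carrier V. q x"] q hom_closed[OF g(1)] by auto
qed

lemma submod_ker:
  assumes fg: "M \<in> fg_mods A" "N \<in> fg_mods A" and f: "f \<in> mod_hom A M N"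
  shows "submod M (mod_ker M N f)"
proof -
  interpret M: abelian_group M by (rule fg_abelian_group[OF fg(1)])
  interpret N: abelian_group N by (rule fg_abelian_group[OF fg(2)])
  have "a \<odot>\<^bsub>N\<^esub> \<zero>\<^bsub>N\<^esub> = \<zero>\<^bsub>N\<^esub>" if "a \<in> carrier A" for a
    using smult_add[OF fg(2) that, of "\<zero>\<^bsub>N\<^esub>" "\<zero>\<^bsub>N\<^esub>"] smult_closed[OF fg(2) that, of "\<zero>\<^bsub>N\<^esub>"]
    by (simp add: N.add.l_cancel_one)
  then show ?thesis
    by (auto simp: submod_def mod_ker_def hom_add[OF f] hom_smult[OF f] hom_zero[OF fg f] smult_closed[OF fg(1)])
qed

lemma submod_im:
  assumes fg: "M \<in> fg_mods A" "N \<in> fg_mods A" and f: "f \<in> mod_hom A M N"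
  shows "submod N (f ` carrier M)"
proof -
  interpret M: abelian_group M by (rule fg_abelian_group[OF fg(1)])
  have "\<zero>\<^bsub>N\<^esub> \<in> f ` carrier M" using hom_zero[OF fg f] by (metis M.zero_closed imageI)
  moreover have "f x \<oplus>\<^bsub>N\<^esub> f y \<in> f ` carrier M" if "x \<in> carrier M" "y \<in> carrier M" for x y
    using that hom_add[OF f] by (metis M.add.m_closed imageI)
  moreover have "a \<odot>\<^bsub>N\<^esub> f x \<in> f ` carrier M" if "a \<in> carrier A" "x \<in> carrier M" for a x
    using that hom_smult[OF f] smult_closed[OF fg(1)] by (metis imageI)
  ultimately show ?thesis by (auto simp: submod_def hom_closed[OF f])
qed

section \<open>Rank and nullity\<close>

definition rank :: "('a, 'm) module \<Rightarrow> ('a, 'n) module \<Rightarrow> ('m \<Rightarrow> 'n) \<Rightarrow> nat" where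
  "rank M N f = mdim (N\<lparr>carrier := f ` carrier M\<rparr>)"

lemma rank_nullity:
  assumes fg: "M \<in> fg_mods A" "N \<in> fg_mods A" and f: "f \<in> mod_hom A M N"
  shows "rank M N f + mdim (M\<lparr>carrier := mod_ker M N f\<rparr>) = mdim M"
proof -
  note vs = scal_vectorspace[OF fg_left_module[OF fg(1)]] scal_vectorspace[OF fg_left_module[OF fg(2)]]
  have "f \<in> LinearCombinations.module_hom k (scal M) (scal N)"
    unfolding LinearCombinations.module_hom_def
    using hom_closed[OF f] hom_add[OF f] hom_smult[OF f Ak.smult_closed[OF _ A.one_closed]] by simp
  then have lm: "linear_map k (scal M) (scal N) f"
    using vs by (simp add: linear_map_def mod_hom_axioms_def LinearCombinations.mod_hom_def vectorspace_def)
  then have mh: "LinearCombinations.mod_hom k (scal M) (scal N) f" by (simp add: linear_map_def)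
  have "mod_hom.im (scal M) f = f ` carrier M"
    "mod_hom.ker (scal M) (scal N) f = mod_ker M N f"
    by (simp_all add: mod_hom.im_def[OF mh] mod_hom.ker_def[OF mh] mod_ker_def)
  then show ?thesis
    using linear_map.rank_nullity[OF lm scal_fin_dim[OF fg(1)]]
    by (simp add: rank_def mdim_def scal_restrict)
qed

lemma inj_iff_ker:
  assumes fg: "M \<in> fg_mods A" "N \<in> fg_mods A" and f: "f \<in> mod_hom A M N"
  shows "inj_on f (carrier M) \<longleftrightarrow> mod_ker M N f = {\<zero>\<^bsub>M\<^esub>}"
proof -
  interpret M: abelian_group M by (rule fg_abelian_group[OF fg(1)])
  interpret N: abelian_group N by (rule fg_abelian_group[OF fg(2)])
  have z: "\<zero>\<^bsub>M\<^esub> \<in> mod_ker M N f" by (simp add: mod_ker_def hom_zero[OF fg f])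
  show ?thesis
  proof
    assume "inj_on f (carrier M)"
    then have "x = \<zero>\<^bsub>M\<^esub>" if "x \<in> carrier M" "f x = \<zero>\<^bsub>N\<^esub>" for x
      using that hom_zero[OF fg f] by (metis M.zero_closed inj_onD)
    then show "mod_ker M N f = {\<zero>\<^bsub>M\<^esub>}" using z unfolding mod_ker_def by blast
  next
    assume k: "mod_ker M N f = {\<zero>\<^bsub>M\<^esub>}"
    show "inj_on f (carrier M)"
    proof (rule inj_onI)
      fix x y assume xy: "x \<in> carrier M" "y \<in> carrier M" "f x = f y"
      then have "f (x \<ominus>\<^bsub>M\<^esub> y) = \<zero>\<^bsub>N\<^esub>"
        using hom_minus[OF fg f] hom_closed[OF f] by (simp add: N.r_neg a_minus_def)
      then have "x \<ominus>\<^bsub>M\<^esub> y \<in> mod_ker M N f" using xy by (simp add: mod_ker_def)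
      then show "x = y" using k xy by (simp add: M.minus_other_side)
    qed
  qed
qed

lemma ker_dim_0:
  assumes fg: "M \<in> fg_mods A" "N \<in> fg_mods A" and f: "f \<in> mod_hom A M N"
  shows "mdim (M\<lparr>carrier := mod_ker M N f\<rparr>) = 0 \<longleftrightarrow> inj_on f (carrier M)"
  using mdim_eq_0_iff[OF submod_fg[OF fg(1) submod_ker[OF fg f]]] inj_iff_ker[OF fg f]
  by (simp add: zero_module_def)

lemma rank_inj_iff:
  assumes fg: "M \<in> fg_mods A" "N \<in> fg_mods A" and f: "f \<in> mod_hom A M N"
  shows "rank M N f = mdim M \<longleftrightarrow> inj_on f (carrier M)"
  using rank_nullity[OF fg f] ker_dim_0[OF fg f] by auto

lemma rank_le_dim:
  assumes fg: "M \<in> fg_mods A" "N \<in> fg_mods A" and f: "f \<in> mod_hom A M N"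
  shows "rank M N f \<le> mdim M" "rank M N f \<le> mdim N"
  using rank_nullity[OF fg f] mdim_submod(1)[OF fg(2) submod_im[OF fg f]] by (simp_all add: rank_def)

lemma rank_surj_iff:
  assumes fg: "M \<in> fg_mods A" "N \<in> fg_mods A" and f: "f \<in> mod_hom A M N"
  shows "rank M N f = mdim N \<longleftrightarrow> f ` carrier M = carrier N"
proof
  show "f ` carrier M = carrier N" if "rank M N f = mdim N"
    using that unfolding rank_def by (rule mdim_submod(2)[OF fg(2) submod_im[OF fg f]])
qed (simp add: rank_def)

lemma rank_0_iff:
  assumes fg: "M \<in> fg_mods A" "N \<in> fg_mods A" and f: "f \<in> mod_hom A M N"
  shows "rank M N f = 0 \<longleftrightarrow> (\<forall>x\<in>carrier M. f x = \<zero>\<^bsub>N\<^esub>)"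
proof -
  have "\<zero>\<^bsub>N\<^esub> \<in> f ` carrier M" using submod_im[OF fg f] by (simp add: submod_def)
  then have "f ` carrier M = {\<zero>\<^bsub>N\<^esub>} \<longleftrightarrow> (\<forall>x\<in>carrier M. f x = \<zero>\<^bsub>N\<^esub>)" by blast
  then show ?thesis
    using mdim_eq_0_iff[OF submod_fg[OF fg(2) submod_im[OF fg f]]]
    by (simp add: zero_module_def rank_def)
qed

lemma iso_dim:
  assumes fg: "M \<in> fg_mods A" "N \<in> fg_mods A" and iso: "mod_iso A M N"
  shows "mdim M = mdim N"
proof -
  obtain f where f: "f \<in> mod_hom A M N" "bij_betw f (carrier M) (carrier N)"
    using iso by (auto simp: mod_iso_def)
  then show ?thesis
    using rank_inj_iff[OF fg f(1)] rank_surj_iff[OF fg f(1)] by (simp add: bij_betw_def)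
qed

lemma dim_eq_bij:
  assumes fg: "M \<in> fg_mods A" "N \<in> fg_mods A" and f: "f \<in> mod_hom A M N"
    and d: "mdim M = mdim N" and "inj_on f (carrier M) \<or> f ` carrier M = carrier N"
  shows "bij_betw f (carrier M) (carrier N)"
  using assms rank_inj_iff[OF fg f] rank_surj_iff[OF fg f] by (auto simp: bij_betw_def)

text \<open>The kernel of \<open>f\<close> is contained in that of \<open>g f\<close>, and the image of \<open>g f\<close> in that of \<open>g\<close>.  When
  the ranks agree, these submodules coincide; the last two parts express this by elements.\<close>

lemma rank_compose:
  assumes fg: "V \<in> fg_mods A" "M \<in> fg_mods A" "Y \<in> fg_mods A"
    and f: "f \<in> mod_hom A V M" and g: "g \<in> mod_hom A M Y"
  shows "rank V Y (compose (carrier V) g f) \<le> rank V M f"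
    "rank V Y (compose (carrier V) g f) \<le> rank M Y g"
    "rank V Y (compose (carrier V) g f) = rank V M f \<Longrightarrow> x \<in> carrier V \<Longrightarrow> g (f x) = \<zero>\<^bsub>Y\<^esub> \<Longrightarrow> f x = \<zero>\<^bsub>M\<^esub>"
    "rank V Y (compose (carrier V) g f) = rank M Y g \<Longrightarrow> m \<in> carrier M \<Longrightarrow> \<exists>x\<in>carrier V. g m = g (f x)"
proof -
  let ?h = "compose (carrier V) g f"
  have h: "?h \<in> mod_hom A V Y" by (rule hom_compose[OF fg(1) f g])
  have im: "?h ` carrier V \<subseteq> g ` carrier M" by (auto simp: compose_eq hom_closed[OF f])
  have ker: "mod_ker V M f \<subseteq> mod_ker V Y ?h"
    by (auto simp: mod_ker_def compose_eq hom_zero[OF fg(2,3) g])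
  let ?I = "Y\<lparr>carrier := g ` carrier M\<rparr>" and ?K = "V\<lparr>carrier := mod_ker V Y ?h\<rparr>"
  have I: "?I \<in> fg_mods A" by (rule submod_fg[OF fg(3) submod_im[OF fg(2,3) g]])
  have K: "?K \<in> fg_mods A" by (rule submod_fg[OF fg(1) submod_ker[OF fg(1,3) h]])
  have sI: "submod ?I (?h ` carrier V)" using submod_im[OF fg(1,3) h] im by (simp add: submod_def)
  have sK: "submod ?K (mod_ker V M f)" using submod_ker[OF fg(1,2) f] ker by (simp add: submod_def)
  show "rank V Y ?h \<le> rank M Y g" using mdim_submod(1)[OF I sI] by (simp add: rank_def)
  show "rank V Y ?h \<le> rank V M f"
    using mdim_submod(1)[OF K sK] rank_nullity[OF fg(1,2) f] rank_nullity[OF fg(1,3) h] by simp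
  show "\<exists>x\<in>carrier V. g m = g (f x)" if "rank V Y ?h = rank M Y g" "m \<in> carrier M"
  proof -
    have "?h ` carrier V = g ` carrier M" using mdim_submod(2)[OF I sI] that(1) by (simp add: rank_def)
    then have "g m \<in> ?h ` carrier V" using that(2) by blast
    then show ?thesis by (auto simp: compose_eq)
  qed
  show "f x = \<zero>\<^bsub>M\<^esub>" if "rank V Y ?h = rank V M f" "x \<in> carrier V" "g (f x) = \<zero>\<^bsub>Y\<^esub>"
  proof -
    have "mod_ker V M f = mod_ker V Y ?h"
      using mdim_submod(2)[OF K sK] rank_nullity[OF fg(1,2) f] rank_nullity[OF fg(1,3) h] that(1) by simp
    moreover have "x \<in> mod_ker V Y ?h" using that by (simp add: mod_ker_def compose_eq)
    ultimately have "x \<in> mod_ker V M f" by blast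
    then show ?thesis by (simp add: mod_ker_def)
  qed
qed

section \<open>Retracts and indecomposable modules\<close>

text \<open>A direct summand is described by its inclusion \<open>u\<close> and projection \<open>p\<close> alone, without choosing
  a complement: the kernel of \<open>p\<close> always is one.\<close>

definition retract ::
  "('a, 'm) module \<Rightarrow> ('a, 'm) module \<Rightarrow> ('m \<Rightarrow> 'm) \<Rightarrow> ('m \<Rightarrow> 'm) \<Rightarrow> bool" where
  "retract W M u p \<longleftrightarrow> u \<in> mod_hom A W M \<and> p \<in> mod_hom A M W \<and> (\<forall>x\<in>carrier W. p (u x) = x)"

lemma split_mono_iff: "split_mono A W M u \<longleftrightarrow> (\<exists>p. retract W M u p)"
proof -
  have "compose (carrier W) p u = mod_id W \<longleftrightarrow> (\<forall>x\<in>carrier W. p (u x) = x)" for p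
    by (auto simp: compose_def mod_id_def fun_eq_iff restrict_def)
  then show ?thesis by (auto simp: split_mono_def retract_def)
qed

lemma split_epi_iff: "split_epi A M W p \<longleftrightarrow> (\<exists>u. retract W M u p)"
proof -
  have "compose (carrier W) p u = mod_id W \<longleftrightarrow> (\<forall>x\<in>carrier W. p (u x) = x)" for u
    by (auto simp: compose_def mod_id_def fun_eq_iff restrict_def)
  then show ?thesis by (auto simp: split_epi_def retract_def)
qed

lemma direct_sum_two_iff:
  "direct_sum A 2 (\<lambda>i. if i = 0 then W else Y) M \<longleftrightarrow>
     M \<in> fg_mods A \<and> W \<in> fg_mods A \<and> Y \<in> fg_mods A \<and>
     (\<exists>u p v q. retract W M u p \<and> retract Y M v q \<and>
       (\<forall>x\<in>carrier W. q (u x) = \<zero>\<^bsub>Y\<^esub>) \<and> (\<forall>x\<in>carrier Y. p (v x) = \<zero>\<^bsub>W\<^esub>) \<and>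
       (\<forall>x\<in>carrier M. u (p x) \<oplus>\<^bsub>M\<^esub> v (q x) = x))" (is "?L \<longleftrightarrow> ?R")
proof
  have sum: "finsum M f {..<2} = f 0 \<oplus>\<^bsub>M\<^esub> f (Suc 0)"
    if "M \<in> fg_mods A" "f 0 \<in> carrier M" "f (Suc 0) \<in> carrier M" for f :: "nat \<Rightarrow> _"
  proof -
    interpret M: abelian_group M by (rule fg_abelian_group[OF that(1)])
    have "{..<2::nat} = insert 0 {Suc 0}" by auto
    then show ?thesis using that by (simp add: Pi_iff)
  qed
  have cid: "compose (carrier W) p u = mod_id W \<longleftrightarrow> (\<forall>x\<in>carrier W. p (u x) = x)" for p u and W :: "('a, 'b) module"
    by (auto simp: compose_def mod_id_def fun_eq_iff restrict_def)
  have czero: "compose (carrier W) p u = mod_zero_map W Y \<longleftrightarrow> (\<forall>x\<in>carrier W. p (u x) = \<zero>\<^bsub>Y\<^esub>)"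
    for p u and W Y :: "('a, 'b) module"
    by (auto simp: compose_def mod_zero_map_def fun_eq_iff restrict_def)
  have two: "(\<forall>i<2. P i) \<longleftrightarrow> P 0 \<and> P (Suc 0)" for P :: "nat \<Rightarrow> bool"
    by (metis One_nat_def less_2_cases less_2_cases_iff)
  show ?R if ?L
  proof -
    let ?X = "\<lambda>i::nat. if i = 0 then W else Y"
    have fg: "M \<in> fg_mods A" "W \<in> fg_mods A" "Y \<in> fg_mods A"
      using that unfolding direct_sum_def two by auto
    have "\<exists>u p. (\<forall>i<2. u i \<in> mod_hom A (?X i) M \<and> p i \<in> mod_hom A M (?X i)) \<and>
        (\<forall>i<2. \<forall>j<2. compose (carrier (?X i)) (p j) (u i) =
            (if i = j then mod_id (?X i) else mod_zero_map (?X i) (?X j))) \<and>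
        (\<forall>x\<in>carrier M. finsum M (\<lambda>i. u i (p i x)) {..<2} = x)"
      using that unfolding direct_sum_def by simp
    then obtain u p where up: "\<forall>i<2. u i \<in> mod_hom A (?X i) M \<and> p i \<in> mod_hom A M (?X i)"
      "\<forall>i<2. \<forall>j<2. compose (carrier (?X i)) (p j) (u i) =
            (if i = j then mod_id (?X i) else mod_zero_map (?X i) (?X j))"
      "\<forall>x\<in>carrier M. finsum M (\<lambda>i. u i (p i x)) {..<2} = x"
      by blast
    have h: "u 0 \<in> mod_hom A W M" "u (Suc 0) \<in> mod_hom A Y M" "p 0 \<in> mod_hom A M W" "p (Suc 0) \<in> mod_hom A M Y"
      using up(1) unfolding two by auto
    have "\<forall>x\<in>carrier M. u 0 (p 0 x) \<oplus>\<^bsub>M\<^esub> u (Suc 0) (p (Suc 0) x) = x"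
    proof
      fix x assume x: "x \<in> carrier M"
      have "u 0 (p 0 x) \<in> carrier M" "u (Suc 0) (p (Suc 0) x) \<in> carrier M"
        using x h by (blast intro: hom_closed)+
      then show "u 0 (p 0 x) \<oplus>\<^bsub>M\<^esub> u (Suc 0) (p (Suc 0) x) = x"
        using sum[of "\<lambda>i. u i (p i x)"] fg(1) bspec[OF up(3) x] by simp
    qed
    moreover have "retract W M (u 0) (p 0)" "retract Y M (u (Suc 0)) (p (Suc 0))"
      "\<forall>x\<in>carrier W. p (Suc 0) (u 0 x) = \<zero>\<^bsub>Y\<^esub>" "\<forall>x\<in>carrier Y. p 0 (u (Suc 0) x) = \<zero>\<^bsub>W\<^esub>"
      using up(2) h unfolding two retract_def by (simp_all add: cid czero)
    ultimately show ?R using fg by blast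
  qed
  show ?L if R: ?R
  proof -
    obtain u p v q where *: "retract W M u p" "retract Y M v q"
       "\<forall>x\<in>carrier W. q (u x) = \<zero>\<^bsub>Y\<^esub>" "\<forall>x\<in>carrier Y. p (v x) = \<zero>\<^bsub>W\<^esub>"
       "\<forall>x\<in>carrier M. u (p x) \<oplus>\<^bsub>M\<^esub> v (q x) = x" and fg: "M \<in> fg_mods A" "W \<in> fg_mods A" "Y \<in> fg_mods A"
      using R by blast
    let ?u = "\<lambda>i::nat. if i = 0 then u else v" and ?p = "\<lambda>i::nat. if i = 0 then p else q"
    have "finsum M (\<lambda>i. ?u i (?p i x)) {..<2} = x" if "x \<in> carrier M" for x
    proof -
      have "u (p x) \<in> carrier M" "v (q x) \<in> carrier M"
        using *(1,2) that unfolding retract_def by (blast intro: hom_closed)+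
      then show ?thesis using *(5) that fg by (subst sum) auto
    qed
    then show ?L
      using * fg unfolding direct_sum_def two
      by (intro conjI exI[of _ ?u] exI[of _ ?p]) (auto simp: retract_def cid czero)
  qed
qed

text \<open>The decomposition is \<open>x = u (p x) + (x - u (p x))\<close>.\<close>

lemma retract_complement:
  fixes M W :: "('a, 'm) module"
  assumes fg: "M \<in> fg_mods A" "W \<in> fg_mods A" and r: "retract W M u p"
  defines "K \<equiv> M\<lparr>carrier := mod_ker M W p\<rparr>"
  shows "K \<in> fg_mods A" "mdim M = mdim W + mdim K"
    "direct_sum A 2 (\<lambda>i. if i = 0 then W else K) M"
    "\<exists>v q. retract K M v q \<and> (\<forall>x\<in>carrier M. u (p x) \<oplus>\<^bsub>M\<^esub> v (q x) = x)"
proof -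
  interpret M: abelian_group M by (rule fg_abelian_group[OF fg(1)])
  have u: "u \<in> mod_hom A W M" and p: "p \<in> mod_hom A M W" and pu: "\<And>x. x \<in> carrier W \<Longrightarrow> p (u x) = x"
    using r by (auto simp: retract_def)
  interpret W: abelian_group W by (rule fg_abelian_group[OF fg(2)])
  show K: "K \<in> fg_mods A" unfolding K_def by (rule submod_fg[OF fg(1) submod_ker[OF fg p]])
  have "p ` carrier M = carrier W"
    using pu hom_closed[OF u] hom_closed[OF p] by (metis image_eqI image_subsetI subsetI subset_antisym)
  then show "mdim M = mdim W + mdim K"
    using rank_nullity[OF fg p] rank_surj_iff[OF fg p] by (simp add: K_def)
  define v where "v = (\<lambda>x\<in>carrier K. x)"
  define q where "q = (\<lambda>x\<in>carrier M. x \<ominus>\<^bsub>M\<^esub> compose (carrier M) u p x)"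
  have KM: "carrier K \<subseteq> carrier M" by (auto simp: K_def mod_ker_def)
  have Kops: "ring.add K = ring.add M" "smult K = smult M" "\<zero>\<^bsub>K\<^esub> = \<zero>\<^bsub>M\<^esub>" by (simp_all add: K_def)
  have v: "v \<in> mod_hom A K M"
    unfolding v_def by (rule homI) (use KM K in \<open>auto simp: Kops\<close>)
  have q': "q \<in> mod_hom A M M"
    unfolding q_def by (rule hom_diff_id[OF fg(1) hom_compose[OF fg(1) p u]])
  have pq: "p (q x) = \<zero>\<^bsub>W\<^esub>" if "x \<in> carrier M" for x
    using that by (simp add: q_def compose_eq hom_minus[OF fg p] hom_closed[OF u] hom_closed[OF p] pu)
  have q: "q \<in> mod_hom A M K"
    using q' pq hom_closed[OF q'] unfolding mod_hom_def by (auto simp: Kops K_def mod_ker_def PiE_def extensional_def)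
  have qv: "q (v x) = x" if "x \<in> carrier K" for x
    using that KM by (auto simp: q_def v_def compose_eq K_def mod_ker_def hom_zero[OF fg(2,1) u] a_minus_def)
  have qu: "q (u x) = \<zero>\<^bsub>K\<^esub>" if "x \<in> carrier W" for x
    using that by (simp add: q_def compose_eq hom_closed[OF u] pu Kops)
  have pv: "p (v x) = \<zero>\<^bsub>W\<^esub>" if "x \<in> carrier K" for x
    using that by (simp add: v_def K_def mod_ker_def)
  have sum: "u (p x) \<oplus>\<^bsub>M\<^esub> v (q x) = x" if "x \<in> carrier M" for x
  proof -
    have 1: "u (p x) \<in> carrier M" using that hom_closed[OF u] hom_closed[OF p] by simp
    have "v (q x) = x \<ominus>\<^bsub>M\<^esub> u (p x)"
      using that hom_closed[OF q that] by (simp add: v_def) (simp add: q_def compose_eq)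
    then show ?thesis using 1 that by (simp add: a_minus_def M.add.m_lcomm M.r_neg)
  qed
  have rK: "retract K M v q" using v q qv by (simp add: retract_def)
  show "\<exists>v q. retract K M v q \<and> (\<forall>x\<in>carrier M. u (p x) \<oplus>\<^bsub>M\<^esub> v (q x) = x)"
    using rK sum by blast
  show "direct_sum A 2 (\<lambda>i. if i = 0 then W else K) M"
    unfolding direct_sum_two_iff using fg K r rK qu pv sum by blast
qed

lemma retract_trans:
  assumes "W \<in> fg_mods A" "M \<in> fg_mods A" "E \<in> fg_mods A" "retract W M u p" "retract M E v q"
  shows "retract W E (compose (carrier W) v u) (compose (carrier E) p q)"
proof -
  have u: "u \<in> mod_hom A W M" "p \<in> mod_hom A M W" "\<And>x. x \<in> carrier W \<Longrightarrow> p (u x) = x"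
    and v: "v \<in> mod_hom A M E" "q \<in> mod_hom A E M" "\<And>x. x \<in> carrier M \<Longrightarrow> q (v x) = x"
    using assms(4,5) by (auto simp: retract_def)
  then show ?thesis
    unfolding retract_def
    using hom_compose[OF assms(1) u(1) v(1)] hom_compose[OF assms(3) v(2) u(2)]
    by (simp add: compose_eq hom_closed[OF u(1)] hom_closed[OF v(1)])
qed

text \<open>The complement of a nonzero retract of an indecomposable module vanishes.\<close>

lemma retract_indecomposable:
  assumes M: "indecomposable A M" and W: "W \<in> fg_mods A" "\<not> zero_module W" and r: "retract W M u p"
  shows "bij_betw u (carrier W) (carrier M)" "bij_betw p (carrier M) (carrier W)"
proof -
  have fg: "M \<in> fg_mods A" using M by (simp add: indecomposable_def)
  have u: "u \<in> mod_hom A W M" and p: "p \<in> mod_hom A M W" and pu: "\<And>x. x \<in> carrier W \<Longrightarrow> p (u x) = x"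
    using r by (auto simp: retract_def)
  note c = retract_complement[OF fg W(1) r]
  have "zero_module (M\<lparr>carrier := mod_ker M W p\<rparr>)"
    using M c(3) W(2) unfolding indecomposable_def by blast
  then have d: "mdim M = mdim W" using c(2) mdim_eq_0_iff[OF c(1)] by simp
  show "bij_betw u (carrier W) (carrier M)"
    by (rule dim_eq_bij[OF W(1) fg u d[symmetric]]) (metis inj_onI pu)
  have "p ` carrier M = carrier W"
    using pu hom_closed[OF u] hom_closed[OF p] by (metis image_eqI image_subsetI subsetI subset_antisym)
  then show "bij_betw p (carrier M) (carrier W)"
    using dim_eq_bij[OF fg W(1) p d] by blast
qed

text \<open>The image of \<open>f\<close> meets the kernel of \<open>g\<close> trivially because \<open>g f\<close> has the rank of \<open>f\<close>, and
  together they span \<open>M\<close> because \<open>g f\<close> has the image of \<open>g\<close>.  Since \<open>M\<close> is indecomposable, the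
  nonzero summand \<open>f ` carrier L\<close> is everything.  Both the lemma of Fitting and that of
  Harada and Sai rest on this.\<close>

lemma full_rank_factor:
  assumes M: "indecomposable A M" and fg: "L \<in> fg_mods A" "N \<in> fg_mods A"
    and f: "f \<in> mod_hom A L M" and g: "g \<in> mod_hom A M N"
    and r: "rank L N (compose (carrier L) g f) = rank L M f" "rank L N (compose (carrier L) g f) = rank M N g"
    and nz: "rank L M f \<noteq> 0"
  shows "f ` carrier L = carrier M" "inj_on g (carrier M)"
proof -
  have Mfg: "M \<in> fg_mods A" using M by (simp add: indecomposable_def)
  note rc = rank_compose[OF fg(1) Mfg fg(2) f g]
  define S where "S = M\<lparr>carrier := f ` carrier L\<rparr>"
  have S: "S \<in> fg_mods A" unfolding S_def by (rule submod_fg[OF Mfg submod_im[OF fg(1) Mfg f]])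
  have SM: "carrier S \<subseteq> carrier M" using hom_closed[OF f] by (auto simp: S_def)
  have Sops: "ring.add S = ring.add M" "smult S = smult M" "\<zero>\<^bsub>S\<^esub> = \<zero>\<^bsub>M\<^esub>" by (simp_all add: S_def)
  define i where "i = (\<lambda>x\<in>carrier S. x)"
  have i: "i \<in> mod_hom A S M"
    unfolding i_def by (rule homI) (use SM S in \<open>auto simp: Sops\<close>)
  have gi: "compose (carrier S) g i \<in> mod_hom A S N" by (rule hom_compose[OF S i g])
  have gi_eq: "compose (carrier S) g i x = g x" if "x \<in> carrier S" for x
    using that by (simp add: compose_eq i_def)
  have zS: "\<zero>\<^bsub>S\<^esub> \<in> carrier S" using fg_abelian_group[OF S] by (simp add: abelian_group_def abelian_monoid.zero_closed)
  have "mod_ker S N (compose (carrier S) g i) = {\<zero>\<^bsub>S\<^esub>}"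
  proof -
    have "x = \<zero>\<^bsub>S\<^esub>" if "x \<in> carrier S" "compose (carrier S) g i x = \<zero>\<^bsub>N\<^esub>" for x
    proof -
      obtain y where "y \<in> carrier L" "x = f y" using \<open>x \<in> carrier S\<close> by (auto simp: S_def)
      then show ?thesis using rc(3)[OF r(1), of y] that by (simp add: gi_eq Sops)
    qed
    moreover have "compose (carrier S) g i \<zero>\<^bsub>S\<^esub> = \<zero>\<^bsub>N\<^esub>" by (rule hom_zero[OF S fg(2) gi])
    ultimately show ?thesis using zS unfolding mod_ker_def by blast
  qed
  then have inj: "inj_on (compose (carrier S) g i) (carrier S)" using inj_iff_ker[OF S fg(2) gi] by simp
  have "g ` carrier M \<subseteq> compose (carrier S) g i ` carrier S"
  proof
    fix y assume "y \<in> g ` carrier M"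
    then obtain m where "m \<in> carrier M" "y = g m" by blast
    then obtain x where x: "x \<in> carrier L" "y = g (f x)" using rc(4)[OF r(2)] by blast
    then have "f x \<in> carrier S" by (simp add: S_def)
    then show "y \<in> compose (carrier S) g i ` carrier S" using x(2) gi_eq by (metis image_eqI)
  qed
  then obtain p where p: "p \<in> mod_hom A M S" "\<And>m. m \<in> carrier M \<Longrightarrow> compose (carrier S) g i (p m) = g m"
    using factor_through_mono[OF S fg(2) Mfg gi inj g] by blast
  have "p (i x) = x" if x: "x \<in> carrier S" for x
  proof -
    have "i x = x" "x \<in> carrier M" using x SM by (auto simp: i_def)
    then have "compose (carrier S) g i (p x) = compose (carrier S) g i x" using p(2)[of x] gi_eq[OF x] by simp
    then show ?thesis using inj x hom_closed[OF p(1) \<open>x \<in> carrier M\<close>] \<open>i x = x\<close> by (simp add: inj_on_def)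
  qed
  then have ret: "retract S M i p" using i p(1) by (simp add: retract_def)
  have "mdim S \<noteq> 0" using nz by (simp add: rank_def S_def)
  then have "\<not> zero_module S" using mdim_eq_0_iff[OF S] by simp
  note b = retract_indecomposable[OF M S this ret]
  have "i ` carrier S = carrier S" by (auto simp: i_def)
  then show surj: "f ` carrier L = carrier M" using b(1) by (simp add: bij_betw_def S_def)
  have "rank M N g = mdim M" using r rank_surj_iff[OF fg(1) Mfg f] surj by simp
  then show "inj_on g (carrier M)" using rank_inj_iff[OF Mfg fg(2) g] by simp
qed

fun pow :: "('a, 'm) module \<Rightarrow> ('m \<Rightarrow> 'm) \<Rightarrow> nat \<Rightarrow> 'm \<Rightarrow> 'm" where
  "pow M f 0 = mod_id M"
| "pow M f (Suc n) = compose (carrier M) f (pow M f n)"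

lemma pow_hom: "M \<in> fg_mods A \<Longrightarrow> f \<in> mod_hom A M M \<Longrightarrow> pow M f n \<in> mod_hom A M M"
  by (induction n) (auto intro: hom_id hom_compose)

lemma pow_add:
  assumes "M \<in> fg_mods A" "f \<in> mod_hom A M M" "x \<in> carrier M"
  shows "pow M f (m + n) x = pow M f m (pow M f n x)"
  using assms(3) hom_closed[OF pow_hom[OF assms(1,2)]]
  by (induction m) (auto simp: compose_eq mod_id_def)

text \<open>The lemma of Fitting.  If \<open>f\<^sup>n\<close> has the least rank among all positive powers, then its square
  has the same rank, so \<open>f\<^sup>n\<close> is injective unless it vanishes.\<close>

lemma endo_bij_or_nilpotent:
  assumes M: "indecomposable A M" and f: "f \<in> mod_hom A M M"
  shows "bij_betw f (carrier M) (carrier M) \<or> (\<exists>n. \<forall>x\<in>carrier M. pow M f n x = \<zero>\<^bsub>M\<^esub>)"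
proof -
  have Mfg: "M \<in> fg_mods A" using M by (simp add: indecomposable_def)
  note ph = pow_hom[OF Mfg f]
  obtain n where n: "n \<ge> 1" "\<And>m. m \<ge> 1 \<Longrightarrow> rank M M (pow M f n) \<le> rank M M (pow M f m)"
    using ex_has_least_nat[of "\<lambda>n. n \<ge> 1" 1 "\<lambda>n. rank M M (pow M f n)"] by auto
  have e: "compose (carrier M) (pow M f n) (pow M f n) = pow M f (n + n)"
    by (rule hom_ext[OF hom_compose[OF Mfg ph ph] ph]) (simp add: compose_eq pow_add[OF Mfg f])
  have "rank M M (pow M f (n + n)) \<le> rank M M (pow M f n)"
    using rank_compose(1)[OF Mfg Mfg Mfg ph ph, of n n] by (simp add: e)
  then have r: "rank M M (compose (carrier M) (pow M f n) (pow M f n)) = rank M M (pow M f n)"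
    using n(2)[of "n + n"] n(1) e by simp
  show ?thesis
  proof (cases "rank M M (pow M f n) = 0")
    case True
    then show ?thesis using rank_0_iff[OF Mfg Mfg ph] by blast
  next
    case False
    then have inj: "inj_on (pow M f n) (carrier M)" using full_rank_factor(2)[OF M Mfg Mfg ph ph r r] by simp
    obtain m where m: "n = m + 1" using n(1) by (metis Suc_eq_plus1 Suc_le_D One_nat_def)
    have "pow M f n x = pow M f m (f x)" if "x \<in> carrier M" for x
      using that pow_add[OF Mfg f that, of m 1] by (simp add: m compose_eq mod_id_def)
    then have "inj_on f (carrier M)" using inj by (metis (no_types, lifting) inj_on_def)
    then show ?thesis using dim_eq_bij[OF Mfg Mfg f] by blast
  qed
qed

text \<open>If \<open>g\<close> is nilpotent, then \<open>f\<close> is injective, because \<open>g\<close> is the identity on the kernel of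
  \<open>f\<close>.\<close>

lemma endo_local:
  assumes M: "indecomposable A M" and f: "f \<in> mod_hom A M M" and g: "g \<in> mod_hom A M M"
    and sum: "\<And>x. x \<in> carrier M \<Longrightarrow> f x \<oplus>\<^bsub>M\<^esub> g x = x"
  shows "bij_betw f (carrier M) (carrier M) \<or> bij_betw g (carrier M) (carrier M)"
proof (rule disjCI)
  have Mfg: "M \<in> fg_mods A" using M by (simp add: indecomposable_def)
  interpret M: abelian_group M by (rule fg_abelian_group[OF Mfg])
  assume "\<not> bij_betw g (carrier M) (carrier M)"
  then obtain n where n: "\<forall>x\<in>carrier M. pow M g n x = \<zero>\<^bsub>M\<^esub>" using endo_bij_or_nilpotent[OF M g] by blast
  have "x = \<zero>\<^bsub>M\<^esub>" if x: "x \<in> carrier M" "f x = \<zero>\<^bsub>M\<^esub>" for x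
  proof -
    have gx: "g x = x" using sum[OF x(1)] x hom_closed[OF g x(1)] by simp
    have "pow M g m x = x" for m by (induction m) (use x gx in \<open>auto simp: mod_id_def compose_eq\<close>)
    then show ?thesis using n x(1) by metis
  qed
  then have "mod_ker M M f = {\<zero>\<^bsub>M\<^esub>}" using hom_zero[OF Mfg Mfg f] unfolding mod_ker_def by blast
  then have "inj_on f (carrier M)" using inj_iff_ker[OF Mfg Mfg f] by simp
  then show "bij_betw f (carrier M) (carrier M)" using dim_eq_bij[OF Mfg Mfg f] by blast
qed

section \<open>Krull--Remak--Schmidt exchange\<close>

lemma iso_refl: "M \<in> fg_mods A \<Longrightarrow> mod_iso A M M"
  unfolding mod_iso_def using hom_id[of M] by (intro bexI[of _ "mod_id M"]) (auto simp: mod_id_def bij_betw_def)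

lemma iso_sym: "M \<in> fg_mods A \<Longrightarrow> N \<in> fg_mods A \<Longrightarrow> mod_iso A M N \<Longrightarrow> mod_iso A N M"
  unfolding mod_iso_def using hom_inverse by blast

lemma iso_trans:
  assumes "M \<in> fg_mods A" "mod_iso A M N" "mod_iso A N P" shows "mod_iso A M P"
proof -
  obtain f g where f: "f \<in> mod_hom A M N" "bij_betw f (carrier M) (carrier N)"
    and g: "g \<in> mod_hom A N P" "bij_betw g (carrier N) (carrier P)"
    using assms(2,3) by (auto simp: mod_iso_def)
  have "bij_betw (compose (carrier M) g f) (carrier M) (carrier P)"
    using bij_betw_trans[OF f(2) g(2)] by (rule bij_betw_cong[THEN iffD1, rotated]) (simp add: compose_eq)
  then show ?thesis using hom_compose[OF assms(1) f(1) g(1)] by (auto simp: mod_iso_def)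
qed

definition is_retract :: "('a, 'm) module \<Rightarrow> ('a, 'm) module \<Rightarrow> bool" where
  "is_retract W M \<longleftrightarrow> (\<exists>u p. retract W M u p)"

lemma is_retract_trans:
  "W \<in> fg_mods A \<Longrightarrow> M \<in> fg_mods A \<Longrightarrow> E \<in> fg_mods A \<Longrightarrow> is_retract W M \<Longrightarrow> is_retract M E \<Longrightarrow> is_retract W E"
  unfolding is_retract_def using retract_trans by blast

lemma iso_is_retract:
  assumes "W \<in> fg_mods A" "M \<in> fg_mods A" "mod_iso A W M" shows "is_retract W M"
proof -
  obtain f where f: "f \<in> mod_hom A W M" "bij_betw f (carrier W) (carrier M)"
    using assms(3) by (auto simp: mod_iso_def)
  obtain g where "g \<in> mod_hom A M W" "\<forall>x\<in>carrier W. g (f x) = x"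
    using hom_inverse[OF assms(1,2) f] by blast
  then show ?thesis using f(1) by (auto simp: is_retract_def retract_def)
qed

lemma is_retract_indecomposable:
  assumes "indecomposable A M" "indecomposable A W" "is_retract W M" shows "mod_iso A W M"
proof -
  obtain u p where r: "retract W M u p" using assms(3) by (auto simp: is_retract_def)
  have "bij_betw u (carrier W) (carrier M)"
    using assms(2) by (intro retract_indecomposable(1)[OF assms(1) _ _ r]) (simp_all add: indecomposable_def)
  then show ?thesis using r unfolding mod_iso_def retract_def by blast
qed

text \<open>If \<open>p v q u\<close> is invertible, then \<open>(p v q u)\<inverse> p v\<close> is a left inverse of \<open>q u\<close>.\<close>

lemma retract_exchange_part:
  assumes fg: "W \<in> fg_mods A" "E \<in> fg_mods A" "D \<in> fg_mods A"
    and r: "retract W E u p" "retract D E v q"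
    and b: "bij_betw (\<lambda>x\<in>carrier W. p (v (q (u x)))) (carrier W) (carrier W)"
  shows "is_retract W D"
proof -
  have u: "u \<in> mod_hom A W E" "p \<in> mod_hom A E W" and v: "v \<in> mod_hom A D E" "q \<in> mod_hom A E D"
    using r by (auto simp: retract_def)
  have qu: "compose (carrier W) q u \<in> mod_hom A W D" by (rule hom_compose[OF fg(1) u(1) v(2)])
  have pv: "compose (carrier D) p v \<in> mod_hom A D W" by (rule hom_compose[OF fg(3) v(1) u(2)])
  define a where "a = compose (carrier W) (compose (carrier D) p v) (compose (carrier W) q u)"
  have a: "a \<in> mod_hom A W W" unfolding a_def by (rule hom_compose[OF fg(1) qu pv])
  have ax: "a x = p (v (q (u x)))" if "x \<in> carrier W" for x
    using that hom_closed[OF u(1)] hom_closed[OF v(2)] by (simp add: a_def compose_eq)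
  have "bij_betw a (carrier W) (carrier W)"
    using b by (rule bij_betw_cong[THEN iffD1, rotated]) (simp add: ax)
  then obtain c where c: "c \<in> mod_hom A W W" "\<forall>x\<in>carrier W. c (a x) = x"
    using hom_inverse[OF fg(1,1) a] by blast
  have "c (p (v (q (u x)))) = x" if "x \<in> carrier W" for x using bspec[OF c(2) that] ax[OF that] by simp
  then have "retract W D (compose (carrier W) q u) (compose (carrier D) c (compose (carrier D) p v))"
    unfolding retract_def using qu hom_compose[OF fg(3) pv c(1)]
    by (simp add: compose_eq hom_closed[OF u(1)] hom_closed[OF v(2)])
  then show ?thesis by (auto simp: is_retract_def)
qed

text \<open>The endomorphisms of \<open>W\<close> that pass through \<open>D\<close> and through \<open>D'\<close> add up to the identity, so
  one of them is invertible.\<close>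

lemma retract_exchange:
  assumes W: "indecomposable A W" and fg: "E \<in> fg_mods A" "D \<in> fg_mods A" "D' \<in> fg_mods A"
    and r: "retract W E u p" "retract D E v q" "retract D' E v' q'"
    and sum: "\<And>x. x \<in> carrier E \<Longrightarrow> v (q x) \<oplus>\<^bsub>E\<^esub> v' (q' x) = x"
  shows "is_retract W D \<or> is_retract W D'"
proof -
  have Wfg: "W \<in> fg_mods A" using W by (simp add: indecomposable_def)
  have u: "u \<in> mod_hom A W E" "p \<in> mod_hom A E W" "\<And>x. x \<in> carrier W \<Longrightarrow> p (u x) = x"
    and v: "v \<in> mod_hom A D E" "q \<in> mod_hom A E D" "v' \<in> mod_hom A D' E" "q' \<in> mod_hom A E D'"
    using r by (auto simp: retract_def)
  have hom: "(\<lambda>x\<in>carrier W. p (w (r (u x)))) \<in> mod_hom A W W"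
    if "w \<in> mod_hom A B E" "r \<in> mod_hom A E B" for w r and B :: "('a, 'b) module"
    by (rule homI) (simp_all add: Wfg hom_closed[OF u(1)] hom_closed[OF u(2)] hom_closed[OF that(1)]
        hom_closed[OF that(2)] hom_add[OF u(1)] hom_add[OF u(2)] hom_add[OF that(1)] hom_add[OF that(2)]
        hom_smult[OF u(1)] hom_smult[OF u(2)] hom_smult[OF that(1)] hom_smult[OF that(2)])
  have "p (v (q (u x))) \<oplus>\<^bsub>W\<^esub> p (v' (q' (u x))) = x" if "x \<in> carrier W" for x
  proof -
    have "u x \<in> carrier E" using that hom_closed[OF u(1)] by simp
    then have "p (v (q (u x)) \<oplus>\<^bsub>E\<^esub> v' (q' (u x))) = p (v (q (u x))) \<oplus>\<^bsub>W\<^esub> p (v' (q' (u x)))"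
      using hom_add[OF u(2)] hom_closed[OF v(1)] hom_closed[OF v(2)] hom_closed[OF v(3)] hom_closed[OF v(4)] by simp
    then show ?thesis using sum[OF \<open>u x \<in> carrier E\<close>] u(3)[OF that] by simp
  qed
  then have "bij_betw (\<lambda>x\<in>carrier W. p (v (q (u x)))) (carrier W) (carrier W) \<or>
      bij_betw (\<lambda>x\<in>carrier W. p (v' (q' (u x)))) (carrier W) (carrier W)"
    by (intro endo_local[OF W hom[OF v(1,2)] hom[OF v(3,4)]]) simp
  then show ?thesis
    using retract_exchange_part[OF Wfg fg(1,2) r(1,2)] retract_exchange_part[OF Wfg fg(1,3) r(1,3)] by blast
qed

text \<open>After one member of \<open>S\<close> has been split off, the others are retracts of the complement: by
  exchange, the only alternative is to be isomorphic to the member split off.\<close>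

lemma sum_dim_retracts_le:
  assumes "finite S" "E \<in> fg_mods A" "\<And>W. W \<in> S \<Longrightarrow> indecomposable A W \<and> is_retract W E"
    "\<And>W V. W \<in> S \<Longrightarrow> V \<in> S \<Longrightarrow> mod_iso A W V \<Longrightarrow> W = V"
  shows "(\<Sum>W\<in>S. mdim W) \<le> mdim E"
  using assms
proof (induction S arbitrary: E)
  case (insert W S)
  have W: "indecomposable A W" "W \<in> fg_mods A" using insert.prems(2)[of W] by (auto simp: indecomposable_def)
  obtain u p where up: "retract W E u p" using insert.prems(2)[of W] by (auto simp: is_retract_def)
  define K where "K = E\<lparr>carrier := mod_ker E W p\<rparr>"
  note rc = retract_complement[OF insert.prems(1) W(2) up, folded K_def]
  obtain v q where vq: "retract K E v q" "\<forall>x\<in>carrier E. u (p x) \<oplus>\<^bsub>E\<^esub> v (q x) = x" using rc(4) by blast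
  have "is_retract V K" if V: "V \<in> S" for V
  proof -
    have iV: "indecomposable A V" using insert.prems(2) V by blast
    obtain a b where "retract V E a b" using insert.prems(2)[of V] V by (auto simp: is_retract_def)
    then have "is_retract V W \<or> is_retract V K"
      using retract_exchange[OF iV insert.prems(1) W(2) rc(1) _ up vq(1)] vq(2) by blast
    moreover have "\<not> is_retract V W"
      using is_retract_indecomposable[OF W(1) iV] insert.prems(3)[of V W] V insert.hyps(2) by blast
    ultimately show ?thesis by blast
  qed
  then have "(\<Sum>W\<in>S. mdim W) \<le> mdim K"
    using insert.prems(2,3) by (intro insert.IH rc(1)) auto
  then show ?case using insert.hyps rc(2) by simp
qed simp

text \<open>Otherwise \<open>V\<close> could be added to \<open>S\<close>, and the sum of the dimensions would become too large.\<close>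

lemma sum_dim_retracts_eq:
  assumes S: "finite S" "E \<in> fg_mods A" "\<And>W. W \<in> S \<Longrightarrow> indecomposable A W \<and> is_retract W E"
    "\<And>W V. W \<in> S \<Longrightarrow> V \<in> S \<Longrightarrow> mod_iso A W V \<Longrightarrow> W = V"
    and eq: "(\<Sum>W\<in>S. mdim W) = mdim E" and V: "indecomposable A V" "is_retract V E"
  shows "\<exists>W\<in>S. mod_iso A W V"
proof (rule ccontr)
  assume n: "\<not> ?thesis"
  have fg: "V \<in> fg_mods A" "W \<in> S \<Longrightarrow> W \<in> fg_mods A" for W
    using V S(3) by (auto simp: indecomposable_def)
  then have n': "\<not> mod_iso A V W" if "W \<in> S" for W using iso_sym n that by blast
  have "V \<notin> S" using n iso_refl[OF fg(1)] by blast
  moreover have "(\<Sum>W\<in>insert V S. mdim W) \<le> mdim E"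
    by (rule sum_dim_retracts_le) (use S V n n' in auto)
  ultimately have "mdim V = 0" using S(1) eq by simp
  then show False using mdim_eq_0_iff[OF fg(1)] V(1) by (simp add: indecomposable_def)
qed

section \<open>Almost split sequences and irreducible morphisms\<close>

text \<open>In the identity \<open>u p + (1 - u p)\<close> of \<open>E\<close> the first summand is replaced by \<open>m\<close>.  For suitable
  \<open>m\<close> the result \<open>e\<close> is compatible with one of the maps of an almost split sequence, and then it
  is invertible by minimality.\<close>

lemma perturb_projection:
  fixes E :: "('a, 'm) module"
  assumes fg: "W \<in> fg_mods A" "E \<in> fg_mods A" and r: "retract W E u p" and m: "m \<in> mod_hom A E E"
  defines "e \<equiv> (\<lambda>x\<in>carrier E. m x \<oplus>\<^bsub>E\<^esub> (x \<ominus>\<^bsub>E\<^esub> u (p x)))"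
  shows "e \<in> mod_hom A E E"
    and "y \<in> carrier W \<Longrightarrow> e (u y) = m (u y)"
    and "x \<in> carrier E \<Longrightarrow> p (e x) = p (m x)"
    and "Q \<in> fg_mods A \<Longrightarrow> q \<in> mod_hom A E Q \<Longrightarrow> x \<in> carrier E \<Longrightarrow> q (m x) = q (u (p x)) \<Longrightarrow> q (e x) = q x"
    and "x \<in> carrier E \<Longrightarrow> m x = u (p x) \<Longrightarrow> e x = x"
proof -
  interpret E: abelian_group E by (rule fg_abelian_group[OF fg(2)])
  interpret W: abelian_group W by (rule fg_abelian_group[OF fg(1)])
  have u: "u \<in> mod_hom A W E" and p: "p \<in> mod_hom A E W" and pu: "\<And>x. x \<in> carrier W \<Longrightarrow> p (u x) = x"
    using r by (auto simp: retract_def)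
  define d where "d = (\<lambda>x\<in>carrier E. x \<ominus>\<^bsub>E\<^esub> compose (carrier E) u p x)"
  have d: "d \<in> mod_hom A E E" unfolding d_def by (rule hom_diff_id[OF fg(2) hom_compose[OF fg(2) p u]])
  have cl: "u (p x) \<in> carrier E" "m x \<in> carrier E" if "x \<in> carrier E" for x
    using that by (auto intro: hom_closed[OF u] hom_closed[OF p] hom_closed[OF m])
  have ex: "e x = m x \<oplus>\<^bsub>E\<^esub> (x \<ominus>\<^bsub>E\<^esub> u (p x))" if "x \<in> carrier E" for x using that by (simp add: e_def)
  have "e = (\<lambda>x\<in>carrier E. m x \<oplus>\<^bsub>E\<^esub> d x)" by (auto simp: e_def d_def compose_eq)
  then show "e \<in> mod_hom A E E" using hom_sum[OF fg(2,2) m d] by simp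
  show "e (u y) = m (u y)" if "y \<in> carrier W"
    using that hom_closed[OF u that] cl[of "u y"] by (simp add: ex pu)
  show pe: "p (e x) = p (m x)" if "x \<in> carrier E"
    using that cl[OF that] hom_closed[OF p]
    by (simp add: ex hom_add[OF p] hom_minus[OF fg(2,1) p] pu)
  show "q (e x) = q x" if Q: "Q \<in> fg_mods A" and q: "q \<in> mod_hom A E Q" and x: "x \<in> carrier E" "q (m x) = q (u (p x))"
  proof -
    interpret Q: abelian_group Q by (rule fg_abelian_group[OF Q])
    have "q (e x) = q (u (p x)) \<oplus>\<^bsub>Q\<^esub> (q x \<ominus>\<^bsub>Q\<^esub> q (u (p x)))"
      using x cl[OF x(1)] by (simp add: ex hom_add[OF q] hom_minus[OF fg(2) Q q])
    then show ?thesis using x(1) cl[OF x(1)] hom_closed[OF q] by (simp add: a_minus_def Q.add.m_lcomm Q.r_neg)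
  qed
  show "e x = x" if "x \<in> carrier E" "m x = u (p x)"
    using that cl[OF that(1)] by (simp add: ex a_minus_def E.add.m_lcomm E.r_neg)
qed

lemma retract_between_indecomposables:
  assumes M: "indecomposable A M" and W: "indecomposable A W" and r: "retract W M u p"
  shows "retract M W p u"
proof -
  have Wfg: "W \<in> fg_mods A" "\<not> zero_module W" using W by (auto simp: indecomposable_def)
  have b: "u ` carrier W = carrier M" using retract_indecomposable(1)[OF M Wfg r] by (simp add: bij_betw_def)
  have "u (p y) = y" if "y \<in> carrier M" for y
  proof -
    obtain x where "x \<in> carrier W" "y = u x" using b \<open>y \<in> carrier M\<close> by blast
    then show ?thesis using r by (simp add: retract_def)
  qed
  then show ?thesis using r by (simp add: retract_def)
qed

lemma short_exact_dim:
  assumes "short_exact A Z f E g Y" shows "mdim E = mdim Z + mdim Y"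
proof -
  have fg: "Z \<in> fg_mods A" "E \<in> fg_mods A" "Y \<in> fg_mods A" and f: "f \<in> mod_hom A Z E" and g: "g \<in> mod_hom A E Y"
    and i: "inj_on f (carrier Z)" and k: "f ` carrier Z = mod_ker E Y g" and s: "g ` carrier E = carrier Y"
    using assms by (auto simp: short_exact_def)
  have "rank E Y g = mdim Y" using rank_surj_iff[OF fg(2,3) g] s by simp
  moreover have "mdim (E\<lparr>carrier := mod_ker E Y g\<rparr>) = mdim Z"
    using rank_inj_iff[OF fg(1,2) f] i by (simp add: rank_def k)
  ultimately show ?thesis using rank_nullity[OF fg(2,3) g] by simp
qed

text \<open>These facts are cited by number.  The last four are the lifting properties of the right and of
  the left map (14 and 15) and their minimality (16 and 17).\<close>

lemma almost_split_sequenceD: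
  assumes "almost_split_sequence A \<chi> Z f E g Y"
  shows "Z \<in> fg_mods A" "E \<in> fg_mods A" "Y \<in> fg_mods A" "f \<in> mod_hom A Z E" "g \<in> mod_hom A E Y"
    "inj_on f (carrier Z)" "f ` carrier Z = mod_ker E Y g" "g ` carrier E = carrier Y"
    "E \<in> \<chi>" "Z \<in> \<chi>" "Y \<in> \<chi>"
    "\<not> (\<exists>s. retract Z E f s)" "\<not> (\<exists>s. retract Y E s g)"
    "\<And>V h. V \<in> \<chi> \<Longrightarrow> h \<in> mod_hom A V Y \<Longrightarrow> \<not> (\<exists>s. retract Y V s h) \<Longrightarrow>
       \<exists>t\<in>mod_hom A V E. \<forall>x\<in>carrier V. g (t x) = h x"
    "\<And>V h. V \<in> \<chi> \<Longrightarrow> h \<in> mod_hom A Z V \<Longrightarrow> \<not> (\<exists>s. retract Z V h s) \<Longrightarrow>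
       \<exists>t\<in>mod_hom A E V. \<forall>x\<in>carrier Z. t (f x) = h x"
    "\<And>e. e \<in> mod_hom A E E \<Longrightarrow> (\<And>x. x \<in> carrier E \<Longrightarrow> g (e x) = g x) \<Longrightarrow> bij_betw e (carrier E) (carrier E)"
    "\<And>e. e \<in> mod_hom A E E \<Longrightarrow> (\<And>x. x \<in> carrier Z \<Longrightarrow> e (f x) = f x) \<Longrightarrow> bij_betw e (carrier E) (carrier E)"
proof -
  have se: "short_exact A Z f E g Y" and l: "minimal_left_almost_split A \<chi> Z E f"
    and r: "minimal_right_almost_split A \<chi> E Y g"
    using assms by (auto simp: almost_split_sequence_def)
  show fg: "Z \<in> fg_mods A" "E \<in> fg_mods A" "Y \<in> fg_mods A" and f: "f \<in> mod_hom A Z E" and g: "g \<in> mod_hom A E Y"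
    and "inj_on f (carrier Z)" "f ` carrier Z = mod_ker E Y g" "g ` carrier E = carrier Y"
    using se by (auto simp: short_exact_def)
  show "E \<in> \<chi>" "Z \<in> \<chi>" "Y \<in> \<chi>" "\<not> (\<exists>s. retract Z E f s)" "\<not> (\<exists>s. retract Y E s g)"
    using l r unfolding minimal_left_almost_split_def minimal_right_almost_split_def split_mono_iff split_epi_iff
    by blast+
  show "\<exists>t\<in>mod_hom A V E. \<forall>x\<in>carrier V. g (t x) = h x"
    if V: "V \<in> \<chi>" "h \<in> mod_hom A V Y" "\<not> (\<exists>s. retract Y V s h)" for V h
  proof -
    obtain t where "t \<in> mod_hom A V E" "h = compose (carrier V) g t"
      using r V unfolding minimal_right_almost_split_def split_epi_iff by blast
    then show ?thesis by (intro bexI[of _ t]) (auto simp: compose_eq)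
  qed
  show "\<exists>t\<in>mod_hom A E V. \<forall>x\<in>carrier Z. t (f x) = h x"
    if V: "V \<in> \<chi>" "h \<in> mod_hom A Z V" "\<not> (\<exists>s. retract Z V h s)" for V h
  proof -
    obtain t where "t \<in> mod_hom A E V" "h = compose (carrier Z) t f"
      using l V unfolding minimal_left_almost_split_def split_mono_iff by blast
    then show ?thesis by (intro bexI[of _ t]) (auto simp: compose_eq)
  qed
  show "bij_betw e (carrier E) (carrier E)"
    if e: "e \<in> mod_hom A E E" "\<And>x. x \<in> carrier E \<Longrightarrow> g (e x) = g x" for e
  proof -
    have "compose (carrier E) g e = g"
      by (rule hom_ext[OF hom_compose[OF fg(2) e(1) g] g]) (simp add: compose_eq e)
    then show ?thesis using r e(1) unfolding minimal_right_almost_split_def by blast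
  qed
  show "bij_betw e (carrier E) (carrier E)"
    if e: "e \<in> mod_hom A E E" "\<And>x. x \<in> carrier Z \<Longrightarrow> e (f x) = f x" for e
  proof -
    have "compose (carrier Z) e f = f"
      by (rule hom_ext[OF hom_compose[OF fg(1) f e(1)] f]) (simp add: compose_eq e)
    then show ?thesis using l e(1) unfolding minimal_left_almost_split_def by blast
  qed
qed

lemma irreducible_in_iff:
  "irreducible_in A \<chi> W Y f \<longleftrightarrow> W \<in> \<chi> \<and> Y \<in> \<chi> \<and> f \<in> mod_hom A W Y \<and>
     \<not> (\<exists>s. retract W Y f s) \<and> \<not> (\<exists>s. retract Y W s f) \<and>
     (\<forall>Z\<in>\<chi>. \<forall>h\<in>mod_hom A W Z. \<forall>g\<in>mod_hom A Z Y. (\<forall>x\<in>carrier W. g (h x) = f x) \<longrightarrow>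
        (\<exists>s. retract W Z h s) \<or> (\<exists>s. retract Y Z s g))"
proof -
  have "f = compose (carrier W) g h \<longleftrightarrow> (\<forall>x\<in>carrier W. g (h x) = f x)"
    if f: "f \<in> mod_hom A W Y" for h and g :: "'b \<Rightarrow> 'b"
  proof
    assume *: "\<forall>x\<in>carrier W. g (h x) = f x"
    show "f = compose (carrier W) g h"
      by (rule extensionalityI[of _ "carrier W"]) (use f * in \<open>auto simp: mod_hom_def compose_eq PiE_def\<close>)
  qed (auto simp: compose_eq)
  then show ?thesis unfolding irreducible_in_def split_mono_iff split_epi_iff by blast
qed

text \<open>An irreducible map to \<open>Y\<close> is not a split epimorphism, so it lifts to \<open>E\<close>, and irreducibility
  turns the lift into a split monomorphism.  Conversely let \<open>u\<close> be the inclusion of a summand \<open>W\<close>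
  and \<open>g u = b a\<close>, where \<open>b\<close> is not a split epimorphism.  Then \<open>b = g t\<close>, and the maps \<open>t a\<close> and
  \<open>u\<close> agree after composition with \<open>g\<close>.  Replacing \<open>u p\<close> by \<open>t a p\<close> in the identity of \<open>E\<close>
  gives an automorphism, which extends \<open>t a\<close>; therefore \<open>a\<close> is a split monomorphism.\<close>

lemma arrow_into_iff:
  assumes seq: "almost_split_sequence A \<chi> Z f E g Y" and sub: "\<chi> \<subseteq> fg_mods A"
    and W: "W \<in> ind_mods A \<chi>" and Y: "Y \<in> ind_mods A \<chi>"
  shows "arrow A \<chi> W Y \<longleftrightarrow> is_retract W E"
proof -
  note s = almost_split_sequenceD[OF seq]
  have W': "indecomposable A W" "W \<in> \<chi>" "W \<in> fg_mods A" using W by (auto simp: ind_mods_def indecomposable_def)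
  have Y': "indecomposable A Y" "Y \<in> \<chi>" using Y by (auto simp: ind_mods_def)
  show ?thesis
  proof
    assume "arrow A \<chi> W Y"
    then obtain \<phi> where \<phi>: "irreducible_in A \<chi> W Y \<phi>" by (auto simp: arrow_def)
    then obtain t where t: "t \<in> mod_hom A W E" "\<forall>x\<in>carrier W. g (t x) = \<phi> x"
      using s(14)[OF W'(2), of \<phi>] unfolding irreducible_in_iff by blast
    have "(\<exists>s. retract W E t s) \<or> (\<exists>s. retract Y E s g)"
      using \<phi> s(9) t s(5) unfolding irreducible_in_iff by blast
    then show "is_retract W E" using s(13) by (auto simp: is_retract_def)
  next
    assume "is_retract W E"
    then obtain u p where r: "retract W E u p" by (auto simp: is_retract_def)
    have u: "u \<in> mod_hom A W E" and p: "p \<in> mod_hom A E W" and pu: "\<And>x. x \<in> carrier W \<Longrightarrow> p (u x) = x"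
      using r by (auto simp: retract_def)
    define \<phi> where "\<phi> = compose (carrier W) g u"
    have \<phi>: "\<phi> \<in> mod_hom A W Y" unfolding \<phi>_def by (rule hom_compose[OF W'(3) u s(5)])
    have \<phi>x: "\<phi> x = g (u x)" if "x \<in> carrier W" for x using that by (simp add: \<phi>_def compose_eq)
    have nepi: "\<not> (\<exists>t. retract Y W t \<phi>)"
    proof
      assume "\<exists>t. retract Y W t \<phi>"
      then obtain t where t: "t \<in> mod_hom A Y W" "\<forall>y\<in>carrier Y. \<phi> (t y) = y" by (auto simp: retract_def)
      then have "\<forall>y\<in>carrier Y. g (compose (carrier Y) u t y) = y"
        using \<phi>x hom_closed[OF t(1)] by (simp add: compose_eq)
      then have "retract Y E (compose (carrier Y) u t) g"
        using hom_compose[OF s(3) t(1) u] s(5) by (simp add: retract_def)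
      then show False using s(13) by blast
    qed
    have nmono: "\<not> (\<exists>t. retract W Y \<phi> t)"
      using retract_between_indecomposables[OF Y'(1) W'(1)] nepi by blast
    have "(\<exists>s. retract W V a s) \<or> (\<exists>s. retract Y V s b)"
      if V: "V \<in> \<chi>" and a: "a \<in> mod_hom A W V" and b: "b \<in> mod_hom A V Y" and ba: "\<forall>x\<in>carrier W. b (a x) = \<phi> x"
      for V a b
    proof (rule disjCI)
      have Vfg: "V \<in> fg_mods A" using V sub by blast
      assume "\<not> (\<exists>s. retract Y V s b)"
      then obtain t where t: "t \<in> mod_hom A V E" "\<forall>x\<in>carrier V. g (t x) = b x" using s(14)[OF V b] by blast
      define m where "m = compose (carrier E) (compose (carrier W) t a) p"
      have m: "m \<in> mod_hom A E E"
        unfolding m_def by (rule hom_compose[OF s(2) p hom_compose[OF W'(3) a t(1)]])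
      have mx: "m x = t (a (p x))" if "x \<in> carrier E" for x
        using that hom_closed[OF p] by (simp add: m_def compose_eq)
      note e = perturb_projection[OF W'(3) s(2) r m]
      define e where "e = (\<lambda>x\<in>carrier E. m x \<oplus>\<^bsub>E\<^esub> (x \<ominus>\<^bsub>E\<^esub> u (p x)))"
      note e = e[folded e_def]
      have "g (e x) = g x" if x: "x \<in> carrier E" for x
      proof -
        have "p x \<in> carrier W" "a (p x) \<in> carrier V" using x hom_closed[OF p] hom_closed[OF a] by auto
        then have "g (m x) = g (u (p x))" using t(2) ba \<phi>x mx[OF x] by simp
        then show ?thesis using e(4)[OF s(3,5) x] by simp
      qed
      then have "bij_betw e (carrier E) (carrier E)" by (rule s(16)[OF e(1)])
      then obtain c where c: "c \<in> mod_hom A E E" "\<forall>x\<in>carrier E. c (e x) = x"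
        using hom_inverse[OF s(2,2) e(1)] by blast
      define w where "w = compose (carrier V) p (compose (carrier V) c t)"
      have w: "w \<in> mod_hom A V W" unfolding w_def by (rule hom_compose[OF Vfg hom_compose[OF Vfg t(1) c(1)] p])
      have "w (a x) = x" if x: "x \<in> carrier W" for x
      proof -
        have ux: "u x \<in> carrier E" and ax: "a x \<in> carrier V" using x hom_closed[OF u] hom_closed[OF a] by auto
        have "e (u x) = t (a x)" using e(2)[OF x] mx[OF ux] pu[OF x] by simp
        then have "c (t (a x)) = u x" using c(2) ux by metis
        then show ?thesis using ax pu[OF x] by (simp add: w_def compose_eq)
      qed
      then have "retract W V a w" using a w by (simp add: retract_def)
      then show "\<exists>s. retract W V a s" by blast
    qed
    then have "irreducible_in A \<chi> W Y \<phi>"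
      unfolding irreducible_in_iff using W' Y' \<phi> nmono nepi by blast
    then show "arrow A \<chi> W Y" using W Y by (auto simp: arrow_def)
  qed
qed

text \<open>The dual argument, with \<open>u b t\<close> in place of \<open>t a p\<close>.  Combined with the previous lemma it
  matches the arrows \<open>W \<rightarrow> Y\<close> with the arrows \<open>Z \<rightarrow> W\<close>.\<close>

lemma arrow_from_iff:
  assumes seq: "almost_split_sequence A \<chi> Z f E g Y" and sub: "\<chi> \<subseteq> fg_mods A"
    and W: "W \<in> ind_mods A \<chi>" and Z: "Z \<in> ind_mods A \<chi>"
  shows "arrow A \<chi> Z W \<longleftrightarrow> is_retract W E"
proof -
  note s = almost_split_sequenceD[OF seq]
  have W': "indecomposable A W" "W \<in> \<chi>" "W \<in> fg_mods A" using W by (auto simp: ind_mods_def indecomposable_def)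
  have Z': "indecomposable A Z" "Z \<in> \<chi>" using Z by (auto simp: ind_mods_def)
  show ?thesis
  proof
    assume "arrow A \<chi> Z W"
    then obtain \<phi> where \<phi>: "irreducible_in A \<chi> Z W \<phi>" by (auto simp: arrow_def)
    then obtain t where t: "t \<in> mod_hom A E W" "\<forall>x\<in>carrier Z. t (f x) = \<phi> x"
      using s(15)[OF W'(2), of \<phi>] unfolding irreducible_in_iff by blast
    have "(\<exists>s. retract Z E f s) \<or> (\<exists>s. retract W E s t)"
      using \<phi> s(9) t s(4) unfolding irreducible_in_iff by blast
    then show "is_retract W E" using s(12) by (auto simp: is_retract_def)
  next
    assume "is_retract W E"
    then obtain u p where r: "retract W E u p" by (auto simp: is_retract_def)
    have u: "u \<in> mod_hom A W E" and p: "p \<in> mod_hom A E W" and pu: "\<And>x. x \<in> carrier W \<Longrightarrow> p (u x) = x"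
      using r by (auto simp: retract_def)
    define \<phi> where "\<phi> = compose (carrier Z) p f"
    have \<phi>: "\<phi> \<in> mod_hom A Z W" unfolding \<phi>_def by (rule hom_compose[OF s(1) s(4) p])
    have \<phi>x: "\<phi> x = p (f x)" if "x \<in> carrier Z" for x using that by (simp add: \<phi>_def compose_eq)
    have nmono: "\<not> (\<exists>t. retract Z W \<phi> t)"
    proof
      assume "\<exists>t. retract Z W \<phi> t"
      then obtain t where t: "t \<in> mod_hom A W Z" "\<forall>y\<in>carrier Z. t (\<phi> y) = y" by (auto simp: retract_def)
      then have "\<forall>y\<in>carrier Z. compose (carrier E) t p (f y) = y"
        using \<phi>x hom_closed[OF s(4)] by (simp add: compose_eq)
      then have "retract Z E f (compose (carrier E) t p)"
        using hom_compose[OF s(2) p t(1)] s(4) by (simp add: retract_def)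
      then show False using s(12) by blast
    qed
    have nepi: "\<not> (\<exists>t. retract W Z t \<phi>)"
      using retract_between_indecomposables[OF Z'(1) W'(1)] nmono by blast
    have "(\<exists>s. retract Z V a s) \<or> (\<exists>s. retract W V s b)"
      if V: "V \<in> \<chi>" and a: "a \<in> mod_hom A Z V" and b: "b \<in> mod_hom A V W" and ba: "\<forall>x\<in>carrier Z. b (a x) = \<phi> x"
      for V a b
    proof (subst disj_commute, rule disjCI)
      have Vfg: "V \<in> fg_mods A" using V sub by blast
      assume "\<not> (\<exists>s. retract Z V a s)"
      then obtain t where t: "t \<in> mod_hom A E V" "\<forall>x\<in>carrier Z. t (f x) = a x" using s(15)[OF V a] by blast
      define m where "m = compose (carrier E) u (compose (carrier E) b t)"
      have m: "m \<in> mod_hom A E E"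
        unfolding m_def by (rule hom_compose[OF s(2) hom_compose[OF s(2) t(1) b] u])
      have mx: "m x = u (b (t x))" if "x \<in> carrier E" for x
        using that by (simp add: m_def compose_eq)
      note e = perturb_projection[OF W'(3) s(2) r m]
      define e where "e = (\<lambda>x\<in>carrier E. m x \<oplus>\<^bsub>E\<^esub> (x \<ominus>\<^bsub>E\<^esub> u (p x)))"
      note e = e[folded e_def]
      have "e (f x) = f x" if x: "x \<in> carrier Z" for x
      proof -
        have fx: "f x \<in> carrier E" using x hom_closed[OF s(4)] by auto
        have "m (f x) = u (p (f x))" using mx[OF fx] t(2) ba \<phi>x x by simp
        then show ?thesis using e(5)[OF fx] by simp
      qed
      then have "bij_betw e (carrier E) (carrier E)" by (rule s(17)[OF e(1)])
      then obtain c where c: "c \<in> mod_hom A E E" "\<forall>x\<in>carrier E. e (c x) = x"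
        using hom_inverse[OF s(2,2) e(1)] by blast
      define w where "w = compose (carrier W) t (compose (carrier W) c u)"
      have w: "w \<in> mod_hom A W V" unfolding w_def by (rule hom_compose[OF W'(3) hom_compose[OF W'(3) u c(1)] t(1)])
      have "b (w x) = x" if x: "x \<in> carrier W" for x
      proof -
        have ux: "u x \<in> carrier E" using x hom_closed[OF u] by auto
        then have cux: "c (u x) \<in> carrier E" using hom_closed[OF c(1)] by auto
        have bt: "b (t (c (u x))) \<in> carrier W" using hom_closed[OF b hom_closed[OF t(1) cux]] .
        have "p (e (c (u x))) = b (t (c (u x)))" using e(3)[OF cux] mx[OF cux] pu[OF bt] by simp
        moreover have "p (e (c (u x))) = x" using bspec[OF c(2) ux] pu[OF x] by simp
        ultimately show ?thesis using x by (simp add: w_def compose_eq)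
      qed
      then have "retract W V w b" using b w by (simp add: retract_def)
      then show "\<exists>s. retract W V s b" by blast
    qed
    then have "irreducible_in A \<chi> Z W \<phi>"
      unfolding irreducible_in_iff using W' Z' \<phi> nmono nepi by blast
    then show "arrow A \<chi> Z W" using W Z by (auto simp: arrow_def)
  qed
qed

lemma bij_from_both_composites:
  assumes "a \<in> mod_hom A E E'" "b \<in> mod_hom A E' E"
    and "bij_betw (compose (carrier E) b a) (carrier E) (carrier E)"
    and "bij_betw (compose (carrier E') a b) (carrier E') (carrier E')"
  shows "bij_betw a (carrier E) (carrier E')"
proof -
  have "inj_on (compose (carrier E) b a) (carrier E)" using assms(3) by (simp add: bij_betw_def)
  then have "inj_on a (carrier E)" by (auto simp: inj_on_def compose_eq)
  moreover have "carrier E' \<subseteq> a ` carrier E"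
  proof
    fix y assume "y \<in> carrier E'"
    then obtain x where "x \<in> carrier E'" "y = compose (carrier E') a b x"
      using assms(4) unfolding bij_betw_def by blast
    then show "y \<in> a ` carrier E" using hom_closed[OF assms(2)] by (simp add: compose_eq)
  qed
  ultimately show ?thesis using hom_closed[OF assms(1)] by (auto simp: bij_betw_def)
qed

text \<open>A section of \<open>i g\<close> would give one of \<open>g\<close>, because \<open>i\<close> has a left inverse.\<close>

lemma right_lift:
  assumes seq: "almost_split_sequence A \<chi> Z f E g Y" and seq': "almost_split_sequence A \<chi> Z' f' E' g' Y'"
    and i: "i \<in> mod_hom A Y Y'" "j \<in> mod_hom A Y' Y" "\<forall>y\<in>carrier Y. j (i y) = y"
  shows "\<exists>a\<in>mod_hom A E E'. \<forall>x\<in>carrier E. g' (a x) = i (g x)"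
proof -
  note s = almost_split_sequenceD[OF seq] and s' = almost_split_sequenceD[OF seq']
  define h where "h = compose (carrier E) i g"
  have h: "h \<in> mod_hom A E Y'" unfolding h_def by (rule hom_compose[OF s(2,5) i(1)])
  have hx: "h x = i (g x)" if "x \<in> carrier E" for x using that by (simp add: h_def compose_eq)
  have "\<not> (\<exists>t. retract Y' E t h)"
  proof
    assume "\<exists>t. retract Y' E t h"
    then obtain t where t: "t \<in> mod_hom A Y' E" "\<forall>y\<in>carrier Y'. h (t y) = y" by (auto simp: retract_def)
    have "g (compose (carrier Y) t i y) = y" if y: "y \<in> carrier Y" for y
    proof -
      have iy: "i y \<in> carrier Y'" "t (i y) \<in> carrier E" using y hom_closed[OF i(1)] hom_closed[OF t(1)] by auto
      have "i (g (t (i y))) = i y" using bspec[OF t(2) iy(1)] hx[OF iy(2)] by simp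
      then have "g (t (i y)) = y" using i(3) y hom_closed[OF s(5) iy(2)] by metis
      then show ?thesis using y by (simp add: compose_eq)
    qed
    then have "retract Y E (compose (carrier Y) t i) g"
      using hom_compose[OF s(3) i(1) t(1)] s(5) by (simp add: retract_def)
    then show False using s(13) by blast
  qed
  then show ?thesis using s'(14)[OF s(9) h] hx by simp
qed

lemma left_lift:
  assumes seq: "almost_split_sequence A \<chi> Z f E g Y" and seq': "almost_split_sequence A \<chi> Z' f' E' g' Y'"
    and i: "i \<in> mod_hom A Z Z'" "j \<in> mod_hom A Z' Z" "\<forall>z\<in>carrier Z'. i (j z) = z"
  shows "\<exists>a\<in>mod_hom A E E'. \<forall>x\<in>carrier Z. a (f x) = f' (i x)"
proof -
  note s = almost_split_sequenceD[OF seq] and s' = almost_split_sequenceD[OF seq']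
  define h where "h = compose (carrier Z) f' i"
  have h: "h \<in> mod_hom A Z E'" unfolding h_def by (rule hom_compose[OF s(1) i(1) s'(4)])
  have hx: "h x = f' (i x)" if "x \<in> carrier Z" for x using that by (simp add: h_def compose_eq)
  have "\<not> (\<exists>t. retract Z E' h t)"
  proof
    assume "\<exists>t. retract Z E' h t"
    then obtain t where t: "t \<in> mod_hom A E' Z" "\<forall>y\<in>carrier Z. t (h y) = y" by (auto simp: retract_def)
    have "compose (carrier E') i t (f' z) = z" if z: "z \<in> carrier Z'" for z
    proof -
      have jz: "j z \<in> carrier Z" using z hom_closed[OF i(2)] by auto
      have "t (f' z) = j z" using bspec[OF t(2) jz] hx[OF jz] bspec[OF i(3) z] by simp
      then show ?thesis using bspec[OF i(3) z] hom_closed[OF s'(4) z] by (simp add: compose_eq)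
    qed
    then have "retract Z' E' f' (compose (carrier E') i t)"
      using hom_compose[OF s'(2) t(1) i(1)] s'(4) by (simp add: retract_def)
    then show False using s'(12) by blast
  qed
  then show ?thesis using s(15)[OF s'(9) h] hx by simp
qed

text \<open>The lifts \<open>E \<rightarrow> E'\<close> and \<open>E' \<rightarrow> E\<close> compose to endomorphisms over \<open>Y\<close> and \<open>Y'\<close>, which are
  bijective by minimality.  The resulting isomorphism restricts to the kernels.\<close>

lemma almost_split_unique_right:
  assumes seq: "almost_split_sequence A \<chi> Z f E g Y" and seq': "almost_split_sequence A \<chi> Z' f' E' g' Y'"
    and iso: "mod_iso A Y Y'"
  shows "mod_iso A E E'" "mod_iso A Z Z'"
proof -
  note s = almost_split_sequenceD[OF seq] and s' = almost_split_sequenceD[OF seq']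
  obtain i where i: "i \<in> mod_hom A Y Y'" "bij_betw i (carrier Y) (carrier Y')" using iso by (auto simp: mod_iso_def)
  obtain j where j: "j \<in> mod_hom A Y' Y" "\<forall>x\<in>carrier Y. j (i x) = x" "\<forall>x\<in>carrier Y'. i (j x) = x"
    using hom_inverse[OF s(3) s'(3) i] by blast
  obtain a where a: "a \<in> mod_hom A E E'" "\<forall>x\<in>carrier E. g' (a x) = i (g x)"
    using right_lift[OF seq seq' i(1) j(1,2)] by blast
  obtain b where b: "b \<in> mod_hom A E' E" "\<forall>x\<in>carrier E'. g (b x) = j (g' x)"
    using right_lift[OF seq' seq j(1) i(1) j(3)] by blast
  have "bij_betw (compose (carrier E) b a) (carrier E) (carrier E)"
    by (rule s(16)[OF hom_compose[OF s(2) a(1) b(1)]])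
      (simp add: compose_eq a b j hom_closed[OF a(1)] hom_closed[OF s(5)])
  moreover have "bij_betw (compose (carrier E') a b) (carrier E') (carrier E')"
    by (rule s'(16)[OF hom_compose[OF s'(2) b(1) a(1)]])
      (simp add: compose_eq a b j hom_closed[OF b(1)] hom_closed[OF s'(5)])
  ultimately have abij: "bij_betw a (carrier E) (carrier E')" by (rule bij_from_both_composites[OF a(1) b(1)])
  then show iE: "mod_iso A E E'" using a(1) by (auto simp: mod_iso_def)
  have af: "compose (carrier Z) a f \<in> mod_hom A Z E'" by (rule hom_compose[OF s(1) s(4) a(1)])
  have "compose (carrier Z) a f ` carrier Z \<subseteq> f' ` carrier Z'"
  proof
    fix y assume "y \<in> compose (carrier Z) a f ` carrier Z"
    then obtain z where z: "z \<in> carrier Z" "y = a (f z)" by (auto simp: compose_eq)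
    have "f z \<in> mod_ker E Y g" using s(7) z(1) by blast
    then have fz: "f z \<in> carrier E" "g (f z) = \<zero>\<^bsub>Y\<^esub>" by (auto simp: mod_ker_def)
    then have "g' y = \<zero>\<^bsub>Y'\<^esub>" using a(2) z(2) hom_zero[OF s(3) s'(3) i(1)] by simp
    then show "y \<in> f' ` carrier Z'" unfolding s'(7) using z(2) hom_closed[OF a(1) fz(1)] by (simp add: mod_ker_def)
  qed
  then obtain q where q: "q \<in> mod_hom A Z Z'" "\<And>z. z \<in> carrier Z \<Longrightarrow> f' (q z) = compose (carrier Z) a f z"
    using factor_through_mono[OF s'(1,2) s(1) s'(4,6) af] by blast
  have "inj_on q (carrier Z)"
  proof (rule inj_onI)
    fix x y assume xy: "x \<in> carrier Z" "y \<in> carrier Z" "q x = q y"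
    then have "a (f x) = a (f y)" using q(2)[of x] q(2)[of y] by (simp add: compose_eq)
    then have "f x = f y" using abij xy hom_closed[OF s(4)] by (auto simp: bij_betw_def inj_on_def)
    then show "x = y" using s(6) xy by (simp add: inj_on_def)
  qed
  moreover have "mdim Z = mdim Z'"
    using short_exact_dim[of Z f E g Y] short_exact_dim[of Z' f' E' g' Y'] seq seq' iso_dim[OF s(2) s'(2) iE]
      iso_dim[OF s(3) s'(3) iso] by (simp add: almost_split_sequence_def)
  ultimately have "bij_betw q (carrier Z) (carrier Z')" using dim_eq_bij[OF s(1) s'(1) q(1)] by blast
  then show "mod_iso A Z Z'" using q(1) by (auto simp: mod_iso_def)
qed

text \<open>Dually, the isomorphism of the middle terms passes to the cokernels.\<close>

lemma almost_split_unique_left: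
  assumes seq: "almost_split_sequence A \<chi> Z f E g Y" and seq': "almost_split_sequence A \<chi> Z' f' E' g' Y'"
    and iso: "mod_iso A Z Z'"
  shows "mod_iso A Y Y'"
proof -
  note s = almost_split_sequenceD[OF seq] and s' = almost_split_sequenceD[OF seq']
  obtain i where i: "i \<in> mod_hom A Z Z'" "bij_betw i (carrier Z) (carrier Z')" using iso by (auto simp: mod_iso_def)
  obtain j where j: "j \<in> mod_hom A Z' Z" "\<forall>x\<in>carrier Z. j (i x) = x" "\<forall>x\<in>carrier Z'. i (j x) = x"
    using hom_inverse[OF s(1) s'(1) i] by blast
  obtain a where a: "a \<in> mod_hom A E E'" "\<forall>x\<in>carrier Z. a (f x) = f' (i x)"
    using left_lift[OF seq seq' i(1) j(1,3)] by blast
  obtain b where b: "b \<in> mod_hom A E' E" "\<forall>x\<in>carrier Z'. b (f' x) = f (j x)"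
    using left_lift[OF seq' seq j(1) i(1) j(2)] by blast
  have "bij_betw (compose (carrier E) b a) (carrier E) (carrier E)"
    by (rule s(17)[OF hom_compose[OF s(2) a(1) b(1)]])
      (simp add: compose_eq a b j hom_closed[OF i(1)] hom_closed[OF s(4)])
  moreover have "bij_betw (compose (carrier E') a b) (carrier E') (carrier E')"
    by (rule s'(17)[OF hom_compose[OF s'(2) b(1) a(1)]])
      (simp add: compose_eq a b j hom_closed[OF j(1)] hom_closed[OF s'(4)])
  ultimately have abij: "bij_betw a (carrier E) (carrier E')" by (rule bij_from_both_composites[OF a(1) b(1)])
  then have iE: "mod_iso A E E'" using a(1) by (auto simp: mod_iso_def)
  have ga: "compose (carrier E) g' a \<in> mod_hom A E Y'" by (rule hom_compose[OF s(2) a(1) s'(5)])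
  have "\<forall>y\<in>carrier E. g y = \<zero>\<^bsub>Y\<^esub> \<longrightarrow> compose (carrier E) g' a y = \<zero>\<^bsub>Y'\<^esub>"
  proof (intro ballI impI)
    fix y assume y: "y \<in> carrier E" "g y = \<zero>\<^bsub>Y\<^esub>"
    then have "y \<in> f ` carrier Z" unfolding s(7) by (simp add: mod_ker_def)
    then obtain z where z: "z \<in> carrier Z" "y = f z" by blast
    have "f' (i z) \<in> mod_ker E' Y' g'" using s'(7) hom_closed[OF i(1) z(1)] by blast
    then show "compose (carrier E) g' a y = \<zero>\<^bsub>Y'\<^esub>"
      using y(1) z a(2) by (simp add: compose_eq mod_ker_def)
  qed
  then obtain q where q: "q \<in> mod_hom A Y Y'" "\<And>x. x \<in> carrier E \<Longrightarrow> q (g x) = compose (carrier E) g' a x"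
    using factor_through_epi[OF s(2,3) s'(3) s(5,8) ga] by blast
  have "carrier Y' \<subseteq> q ` carrier Y"
  proof
    fix y assume "y \<in> carrier Y'"
    then obtain x' where "x' \<in> carrier E'" "y = g' x'" using s'(8) by blast
    moreover then obtain x where "x \<in> carrier E" "x' = a x" using abij by (auto simp: bij_betw_def)
    ultimately show "y \<in> q ` carrier Y" using q(2)[of x] hom_closed[OF s(5)] by (auto simp: compose_eq intro!: image_eqI[of _ _ "g x"])
  qed
  then have "q ` carrier Y = carrier Y'" using hom_closed[OF q(1)] by blast
  moreover have "mdim Y = mdim Y'"
    using short_exact_dim[of Z f E g Y] short_exact_dim[of Z' f' E' g' Y'] seq seq' iso_dim[OF s(2) s'(2) iE]
      iso_dim[OF s(1) s'(1) iso] by (simp add: almost_split_sequence_def)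
  ultimately have "bij_betw q (carrier Y) (carrier Y')" using dim_eq_bij[OF s(3) s'(3) q(1)] by blast
  then show "mod_iso A Y Y'" using q(1) by (auto simp: mod_iso_def)
qed

section \<open>Chains of nonisomorphisms\<close>

text \<open>If \<open>E\<close> decomposes, then \<open>b\<close> is nonzero on one of the two parts, which has smaller dimension.\<close>

lemma nonzero_on_indecomposable_retract:
  assumes "E \<in> fg_mods A" "Z \<in> fg_mods A" "b \<in> mod_hom A E Z" "x \<in> carrier E" "b x \<noteq> \<zero>\<^bsub>Z\<^esub>"
  shows "\<exists>W u p. indecomposable A W \<and> retract W E u p \<and> (\<exists>w\<in>carrier W. b (u w) \<noteq> \<zero>\<^bsub>Z\<^esub>)"
  using assms
proof (induction "mdim E" arbitrary: E b x rule: less_induct)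
  case less
  note fg = less.prems(1,2) and b = less.prems(3)
  interpret E: abelian_group E by (rule fg_abelian_group[OF fg(1)])
  interpret Z: abelian_group Z by (rule fg_abelian_group[OF fg(2)])
  show ?case
  proof (cases "indecomposable A E")
    case True
    have "retract E E (mod_id E) (mod_id E)" using hom_id[OF fg(1)] by (simp add: retract_def mod_id_def)
    then show ?thesis using True less.prems(4,5)
      by (intro exI[of _ E] exI[of _ "mod_id E"]) (auto simp: mod_id_def)
  next
    case False
    have "\<not> zero_module E" using less.prems(4,5) hom_zero[OF fg b] by (auto simp: zero_module_def)
    then obtain W Y where ds: "direct_sum A 2 (\<lambda>i. if i = 0 then W else Y) E"
      and nz: "\<not> zero_module W" "\<not> zero_module Y"
      using False fg by (auto simp: indecomposable_def)
    then obtain u p v q where *: "retract W E u p" "retract Y E v q"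
       "\<forall>x\<in>carrier W. q (u x) = \<zero>\<^bsub>Y\<^esub>" "\<forall>x\<in>carrier Y. p (v x) = \<zero>\<^bsub>W\<^esub>"
       "\<forall>x\<in>carrier E. u (p x) \<oplus>\<^bsub>E\<^esub> v (q x) = x" and fg': "W \<in> fg_mods A" "Y \<in> fg_mods A"
      unfolding direct_sum_two_iff by blast
    have u: "u \<in> mod_hom A W E" "p \<in> mod_hom A E W" "\<And>x. x \<in> carrier W \<Longrightarrow> p (u x) = x"
      and v: "v \<in> mod_hom A Y E" "q \<in> mod_hom A E Y" "\<And>x. x \<in> carrier Y \<Longrightarrow> q (v x) = x"
      using * by (auto simp: retract_def)
    have step: ?thesis if D: "D \<in> fg_mods A" "retract D E r s" "retract D' E r' s'" "D' \<in> fg_mods A"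
      "\<not> zero_module D'" "\<forall>x\<in>carrier D'. s (r' x) = \<zero>\<^bsub>D\<^esub>" "y \<in> carrier D" "b (r y) \<noteq> \<zero>\<^bsub>Z\<^esub>" for D D' r s r' s' y
    proof -
      have r: "r \<in> mod_hom A D E" "s \<in> mod_hom A E D" "r' \<in> mod_hom A D' E" "s' \<in> mod_hom A E D'"
        "\<And>x. x \<in> carrier D' \<Longrightarrow> s' (r' x) = x"
        using D(2,3) by (auto simp: retract_def)
      define K where "K = E\<lparr>carrier := mod_ker E D s\<rparr>"
      note rc = retract_complement[OF fg(1) D(1,2), folded K_def]
      have "\<not> zero_module K"
      proof
        assume z: "zero_module K"
        have "z = \<zero>\<^bsub>D'\<^esub>" if z': "z \<in> carrier D'" for z
        proof -
          have "r' z \<in> carrier K" using z' D(6) hom_closed[OF r(3)] by (simp add: K_def mod_ker_def)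
          then have "r' z = \<zero>\<^bsub>E\<^esub>" using z by (simp add: zero_module_def K_def)
          then show ?thesis using r(5)[OF z'] hom_zero[OF fg(1) D(4) r(4)] by simp
        qed
        moreover have "\<zero>\<^bsub>D'\<^esub> \<in> carrier D'"
          using fg_abelian_group[OF D(4)] by (simp add: abelian_group_def abelian_monoid.zero_closed)
        ultimately show False using D(5) unfolding zero_module_def by blast
      qed
      then have lt: "mdim D < mdim E" using rc(2) mdim_eq_0_iff[OF rc(1)] by simp
      have br: "compose (carrier D) b r \<in> mod_hom A D Z" by (rule hom_compose[OF D(1) r(1) b])
      obtain V a c w where V: "indecomposable A V" "retract V D a c" "w \<in> carrier V"
        "compose (carrier D) b r (a w) \<noteq> \<zero>\<^bsub>Z\<^esub>"
        using less.hyps[OF lt D(1) fg(2) br D(7)] D(7,8) by (auto simp: compose_eq)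
      have Vfg: "V \<in> fg_mods A" using V(1) by (simp add: indecomposable_def)
      have aw: "a w \<in> carrier D" using V(2,3) hom_closed[of a V D] by (simp add: retract_def)
      show ?thesis
        using V(1,3,4) aw retract_trans[OF Vfg D(1) fg(1) V(2) D(2)]
        by (intro exI[of _ V] exI[of _ "compose (carrier V) r a"] exI[of _ "compose (carrier E) c s"])
          (auto simp: compose_eq)
    qed
    have "b (u (p x)) \<oplus>\<^bsub>Z\<^esub> b (v (q x)) = b x"
    proof -
      have "u (p x) \<in> carrier E" "v (q x) \<in> carrier E"
        using less.prems(4) by (blast intro: hom_closed u v)+
      then show ?thesis using hom_add[OF b, of "u (p x)" "v (q x)"] *(5) less.prems(4) by simp
    qed
    then have "b (u (p x)) \<noteq> \<zero>\<^bsub>Z\<^esub> \<or> b (v (q x)) \<noteq> \<zero>\<^bsub>Z\<^esub>"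
      using less.prems(5) by (metis Z.l_zero Z.zero_closed)
    then show ?thesis
    proof
      assume "b (u (p x)) \<noteq> \<zero>\<^bsub>Z\<^esub>"
      then show ?thesis
        using step[OF fg'(1) *(1,2) fg'(2) nz(2) *(4)] hom_closed[OF u(2) less.prems(4)] by blast
    next
      assume "b (v (q x)) \<noteq> \<zero>\<^bsub>Z\<^esub>"
      then show ?thesis
        using step[OF fg'(2) *(2,1) fg'(1) nz(1) *(3)] hom_closed[OF v(2) less.prems(4)] by blast
    qed
  qed
qed

text \<open>Chains grow at the source, because that is where lifting along an epimorphism prolongs them.\<close>

inductive radical_path :: "('a, 'm) module set \<Rightarrow> nat \<Rightarrow> ('a, 'm) module \<Rightarrow> ('a, 'm) module \<Rightarrow> ('m \<Rightarrow> 'm) \<Rightarrow> bool"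
  for \<G> where
  refl: "M \<in> \<G> \<Longrightarrow> radical_path \<G> 0 M M (mod_id M)"
| step: "radical_path \<G> n N P \<phi> \<Longrightarrow> M \<in> \<G> \<Longrightarrow> h \<in> mod_hom A M N \<Longrightarrow> \<not> bij_betw h (carrier M) (carrier N) \<Longrightarrow>
     radical_path \<G> (Suc n) M P (compose (carrier M) \<phi> h)"

lemma radical_path_hom:
  assumes "radical_path \<G> n M P \<phi>" and fg: "\<G> \<subseteq> fg_mods A"
  shows "M \<in> \<G>" "P \<in> \<G>" "\<phi> \<in> mod_hom A M P"
proof -
  have "M \<in> \<G> \<and> P \<in> \<G> \<and> \<phi> \<in> mod_hom A M P"
    using assms(1)
  proof (induction rule: radical_path.induct)
    case (refl M)
    then show ?case using fg hom_id by blast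
  next
    case (step n N P \<phi> M h)
    then show ?case using fg hom_compose[of M h N \<phi> P] by blast
  qed
  then show "M \<in> \<G>" "P \<in> \<G>" "\<phi> \<in> mod_hom A M P" by blast+
qed

lemma radical_path_split:
  assumes "radical_path \<G> (n + m) M P \<phi>" "\<G> \<subseteq> fg_mods A"
  shows "\<exists>N \<psi> \<theta>. radical_path \<G> m M N \<psi> \<and> radical_path \<G> n N P \<theta> \<and> \<phi> = compose (carrier M) \<theta> \<psi>"
  using assms(1)
proof (induction m arbitrary: M \<phi>)
  case 0
  have M: "M \<in> \<G>" and \<phi>: "\<phi> \<in> mod_hom A M P" using radical_path_hom[OF 0 assms(2)] by auto
  have "\<phi> = compose (carrier M) \<phi> (mod_id M)"
    by (rule hom_ext[OF \<phi> hom_compose[OF _ hom_id \<phi>]]) (use M assms(2) in \<open>auto simp: compose_eq mod_id_def\<close>)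
  then show ?case using 0 M radical_path.refl[of M \<G>] by auto
next
  case (Suc m)
  from Suc.prems obtain N \<phi>' h where *: "radical_path \<G> (n + m) N P \<phi>'" "M \<in> \<G>" "h \<in> mod_hom A M N"
    "\<not> bij_betw h (carrier M) (carrier N)" "\<phi> = compose (carrier M) \<phi>' h"
    by (cases rule: radical_path.cases) auto
  from Suc.IH[OF *(1)] obtain N' \<psi> \<theta> where IH: "radical_path \<G> m N N' \<psi>" "radical_path \<G> n N' P \<theta>"
    "\<phi>' = compose (carrier N) \<theta> \<psi>" by blast
  have "\<phi> = compose (carrier M) \<theta> (compose (carrier M) \<psi> h)"
    unfolding *(5) IH(3) using hom_closed[OF *(3)] by (auto simp: compose_def fun_eq_iff)
  then show ?case using radical_path.step[OF IH(1) *(2-4)] IH(2) by blast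
qed

text \<open>The lemma of Harada and Sai.  A chain of length \<open>2 ^ (m + 1) - 1\<close> consists of two chains of
  length \<open>2 ^ m - 1\<close> and one map \<open>h\<close> between them.  If the composite still had rank \<open>b - m > 0\<close>, no
  rank would be lost on either side of \<open>h\<close>, and \<open>h\<close> would be both injective and surjective.\<close>

lemma harada_sai:
  fixes \<G> :: "('a, 'm) module set"
  assumes "\<And>M. M \<in> \<G> \<Longrightarrow> indecomposable A M \<and> mdim M \<le> b" "radical_path \<G> (2 ^ m - 1) M P \<phi>"
  shows "rank M P \<phi> \<le> b - m"
  using assms(2)
proof (induction m arbitrary: M P \<phi>)
  have fg: "\<G> \<subseteq> fg_mods A" using assms(1) by (auto simp: indecomposable_def)
  {
    case 0
    have "M \<in> \<G>" "P \<in> \<G>" "\<phi> \<in> mod_hom A M P" using radical_path_hom[OF 0 fg] by auto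
    then have "rank M P \<phi> \<le> mdim M" using rank_le_dim(1)[of M P \<phi>] fg by auto
    then show ?case using assms(1)[OF \<open>M \<in> \<G>\<close>] by simp
  next
    case (Suc m)
    have e: "2 ^ Suc m - 1 = Suc (2 ^ m - 1) + (2 ^ m - 1 :: nat)"
    proof -
      have "(2::nat) ^ m \<ge> 1" by simp
      then show ?thesis unfolding power_Suc by linarith
    qed
    obtain N \<psi> \<theta>' where 1: "radical_path \<G> (2 ^ m - 1) M N \<psi>" "radical_path \<G> (Suc (2 ^ m - 1)) N P \<theta>'"
      "\<phi> = compose (carrier M) \<theta>' \<psi>"
      using radical_path_split[OF Suc.prems[unfolded e] fg] by blast
    from 1(2) obtain N' \<theta> h where 2: "radical_path \<G> (2 ^ m - 1) N' P \<theta>" "h \<in> mod_hom A N N'"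
      "\<not> bij_betw h (carrier N) (carrier N')" "\<theta>' = compose (carrier N) \<theta> h"
      by (cases rule: radical_path.cases) auto
    have mem: "M \<in> \<G>" "N \<in> \<G>" "N' \<in> \<G>" "P \<in> \<G>" and \<psi>: "\<psi> \<in> mod_hom A M N" and \<theta>: "\<theta> \<in> mod_hom A N' P"
      using radical_path_hom[OF 1(1) fg] radical_path_hom[OF 2(1) fg] by auto
    then have f: "M \<in> fg_mods A" "N \<in> fg_mods A" "N' \<in> fg_mods A" "P \<in> fg_mods A" using fg by auto
    have ind: "indecomposable A N" "indecomposable A N'" using mem assms(1) by auto
    have h\<psi>: "compose (carrier M) h \<psi> \<in> mod_hom A M N'" by (rule hom_compose[OF f(1) \<psi> 2(2)])
    have \<theta>h: "compose (carrier N) \<theta> h \<in> mod_hom A N P" by (rule hom_compose[OF f(2) 2(2) \<theta>])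
    have e1: "\<phi> = compose (carrier M) (compose (carrier N) \<theta> h) \<psi>" using 1(3) 2(4) by simp
    have e2: "\<phi> = compose (carrier M) \<theta> (compose (carrier M) h \<psi>)"
      unfolding e1 using hom_closed[OF \<psi>] by (auto simp: compose_def fun_eq_iff)
    have r\<psi>: "rank M N \<psi> \<le> b - m" and r\<theta>: "rank N' P \<theta> \<le> b - m" using Suc.IH 1(1) 2(1) by auto
    have r1: "rank M P \<phi> \<le> rank M N \<psi>" "rank M P \<phi> \<le> rank N P (compose (carrier N) \<theta> h)"
      using rank_compose(1,2)[OF f(1,2,4) \<psi> \<theta>h] by (simp_all add: e1)
    have r2: "rank M P \<phi> \<le> rank M N' (compose (carrier M) h \<psi>)"
      using rank_compose(1)[OF f(1,3,4) h\<psi> \<theta>] by (simp add: e2)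
    have r3: "rank N P (compose (carrier N) \<theta> h) \<le> rank N' P \<theta>" by (rule rank_compose(2)[OF f(2,3,4) 2(2) \<theta>])
    have r4: "rank M N' (compose (carrier M) h \<psi>) \<le> rank M N \<psi>" by (rule rank_compose(1)[OF f(1,2,3) \<psi> 2(2)])
    have "rank M P \<phi> < b - m \<or> b - m = 0"
    proof (rule ccontr)
      assume "\<not> ?thesis"
      then have q: "rank M P \<phi> = b - m" "b - m \<noteq> 0" using r1(1) r\<psi> by auto
      have eqs: "rank M N \<psi> = b - m" "rank N' P \<theta> = b - m" "rank N P (compose (carrier N) \<theta> h) = b - m"
        "rank M N' (compose (carrier M) h \<psi>) = b - m"
        using q r1 r2 r3 r4 r\<psi> r\<theta> by auto
      have "inj_on (compose (carrier N) \<theta> h) (carrier N)"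
        by (rule full_rank_factor(2)[OF ind(1) f(1,4) \<psi> \<theta>h]) (use q eqs in \<open>simp_all add: e1[symmetric]\<close>)
      then have "inj_on h (carrier N)" by (auto simp: inj_on_def compose_eq)
      moreover have "compose (carrier M) h \<psi> ` carrier M = carrier N'"
        by (rule full_rank_factor(1)[OF ind(2) f(1,4) h\<psi> \<theta>]) (use q eqs in \<open>simp_all add: e2[symmetric]\<close>)
      then have "carrier N' \<subseteq> h ` carrier N" using hom_closed[OF \<psi>] by (force simp: compose_eq)
      then have "h ` carrier N = carrier N'" using hom_closed[OF 2(2)] by blast
      ultimately show False using 2(3) by (simp add: bij_betw_def)
    qed
    then show ?case using r1(1) r\<psi> by linarith
  }
qed

text \<open>An element with nonzero image under a chain starting in \<open>Y\<close> lifts along \<open>E \<rightarrow> Y\<close>, so the chain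
  is nonzero on some indecomposable retract of \<open>E\<close> and can be prolonged by it.  The new map is
  not an isomorphism, for its inverse would split \<open>E \<rightarrow> Y\<close>.  Nonzero chains of every length
  contradict the lemma of Harada and Sai.\<close>

lemma no_bounded_closed_family:
  fixes \<G> :: "('a, 'm) module set"
  assumes "\<G> \<noteq> {}" and b: "\<And>M. M \<in> \<G> \<Longrightarrow> indecomposable A M \<and> mdim M \<le> b"
    and seq: "\<And>Y. Y \<in> \<G> \<Longrightarrow> \<exists>E g. E \<in> fg_mods A \<and> g \<in> mod_hom A E Y \<and> g ` carrier E = carrier Y \<and>
       \<not> (\<exists>s. retract Y E s g) \<and> (\<forall>V. indecomposable A V \<longrightarrow> is_retract V E \<longrightarrow> V \<in> \<G>)"
  shows False
proof -
  have fg: "\<G> \<subseteq> fg_mods A" using b by (auto simp: indecomposable_def)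
  obtain Z where Z: "Z \<in> \<G>" using assms(1) by blast
  have Zfg: "Z \<in> fg_mods A" using Z fg by blast
  have "\<exists>Y \<phi>. radical_path \<G> n Y Z \<phi> \<and> (\<exists>x\<in>carrier Y. \<phi> x \<noteq> \<zero>\<^bsub>Z\<^esub>)" for n
  proof (induction n)
    case 0
    have "\<zero>\<^bsub>Z\<^esub> \<in> carrier Z"
      using fg_abelian_group[OF Zfg] by (simp add: abelian_group_def abelian_monoid.zero_closed)
    then obtain x where "x \<in> carrier Z" "x \<noteq> \<zero>\<^bsub>Z\<^esub>" using b[OF Z] by (auto simp: indecomposable_def zero_module_def)
    then have "\<exists>x\<in>carrier Z. mod_id Z x \<noteq> \<zero>\<^bsub>Z\<^esub>" by (auto simp: mod_id_def)
    then show ?case using radical_path.refl[OF Z] by blast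
  next
    case (Suc n)
    then obtain Y \<phi> x where \<phi>: "radical_path \<G> n Y Z \<phi>" "x \<in> carrier Y" "\<phi> x \<noteq> \<zero>\<^bsub>Z\<^esub>" by blast
    note h = radical_path_hom[OF \<phi>(1) fg]
    have Yfg: "Y \<in> fg_mods A" using h(1) fg by blast
    obtain E g where E: "E \<in> fg_mods A" "g \<in> mod_hom A E Y" "g ` carrier E = carrier Y"
       "\<not> (\<exists>s. retract Y E s g)" "\<forall>V. indecomposable A V \<longrightarrow> is_retract V E \<longrightarrow> V \<in> \<G>"
      using seq[OF h(1)] by blast
    obtain e where e: "e \<in> carrier E" "x = g e" using E(3) \<phi>(2) by blast
    have "compose (carrier E) \<phi> g e \<noteq> \<zero>\<^bsub>Z\<^esub>" using e \<phi>(3) by (simp add: compose_eq)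
    then obtain V u p w where V: "indecomposable A V" "retract V E u p" "w \<in> carrier V"
      "compose (carrier E) \<phi> g (u w) \<noteq> \<zero>\<^bsub>Z\<^esub>"
      using nonzero_on_indecomposable_retract[OF E(1) Zfg hom_compose[OF E(1,2) h(3)] e(1)] by blast
    have VG: "V \<in> \<G>" using E(5) V(1,2) unfolding is_retract_def by blast
    have Vfg: "V \<in> fg_mods A" using VG fg by blast
    have u: "u \<in> mod_hom A V E" using V(2) by (simp add: retract_def)
    have gu: "compose (carrier V) g u \<in> mod_hom A V Y" by (rule hom_compose[OF Vfg u E(2)])
    have "\<not> bij_betw (compose (carrier V) g u) (carrier V) (carrier Y)"
    proof
      assume "bij_betw (compose (carrier V) g u) (carrier V) (carrier Y)"
      then obtain c where c: "c \<in> mod_hom A Y V" "\<forall>y\<in>carrier Y. compose (carrier V) g u (c y) = y"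
        using hom_inverse[OF Vfg Yfg gu] by blast
      have "retract Y E (compose (carrier Y) u c) g"
        using hom_compose[OF Yfg c(1) u] E(2) c(2) hom_closed[OF c(1)] by (simp add: retract_def compose_eq)
      then show False using E(4) by blast
    qed
    then have "radical_path \<G> (Suc n) V Z (compose (carrier V) \<phi> (compose (carrier V) g u))"
      by (rule radical_path.step[OF \<phi>(1) VG gu])
    moreover have "compose (carrier V) \<phi> (compose (carrier V) g u) w \<noteq> \<zero>\<^bsub>Z\<^esub>"
      using V(3,4) hom_closed[OF u] by (simp add: compose_eq)
    ultimately show ?case using V(3) by blast
  qed
  then obtain Y \<phi> x where *: "radical_path \<G> (2 ^ b - 1) Y Z \<phi>" "x \<in> carrier Y" "\<phi> x \<noteq> \<zero>\<^bsub>Z\<^esub>" by blast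
  have "rank Y Z \<phi> = 0" using harada_sai[OF b *(1)] by simp
  moreover have "Y \<in> fg_mods A" "\<phi> \<in> mod_hom A Y Z" using radical_path_hom[OF *(1) fg] fg by auto
  ultimately show False using rank_0_iff[OF _ Zfg, of Y \<phi>] *(2,3) by blast
qed

end

section \<open>Subadditive functions on infinite graphs\<close>

text \<open>Loops are admitted: the vertices will be orbits of a translation, and an arrow may join two
  members of the same orbit.\<close>

locale subadditive_graph =
  fixes V :: "'v set" and adj :: "'v \<Rightarrow> 'v \<Rightarrow> bool" and F :: "'v \<Rightarrow> real"
  assumes adj_sym: "adj x y \<Longrightarrow> adj y x" and adj_V: "adj x y \<Longrightarrow> x \<in> V"
    and locally_finite: "x \<in> V \<Longrightarrow> finite {y. adj x y}" and infinite_V: "infinite V"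
    and connected: "x \<in> V \<Longrightarrow> y \<in> V \<Longrightarrow> adj\<^sup>*\<^sup>* x y"
    and F_pos: "x \<in> V \<Longrightarrow> F x > 0"
    and subadditive: "x \<in> V \<Longrightarrow> (\<Sum>y | adj x y. F y) \<le> 2 * F x"
begin

definition ray :: "(nat \<Rightarrow> 'v) \<Rightarrow> bool" where
  "ray v \<longleftrightarrow> inj v \<and> (\<forall>i. v i \<in> V \<and> adj (v i) (v (Suc i)))"

lemma subadditive_subset:
  assumes "x \<in> V" "S \<subseteq> {y. adj x y}" shows "sum F S \<le> 2 * F x"
proof -
  have "F y \<ge> 0" if "adj x y" for y using F_pos[of y] adj_V[OF adj_sym[OF that]] by simp
  then have "sum F S \<le> (\<Sum>y | adj x y. F y)"
    using assms locally_finite by (intro sum_mono2) auto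
  then show ?thesis using subadditive[OF assms(1)] by simp
qed

text \<open>A neighbour outside \<open>S\<close> would make the sum too large.\<close>

lemma tight_neighbours:
  assumes "x \<in> V" "S \<subseteq> {y. adj x y}" "2 * F x \<le> sum F S"
  shows "{y. adj x y} = S" "(\<Sum>y | adj x y. F y) = 2 * F x"
proof -
  show e: "{y. adj x y} = S"
  proof (rule ccontr)
    assume "{y. adj x y} \<noteq> S"
    then obtain y where y: "adj x y" "y \<notin> S" using assms(2) by auto
    have "sum F (insert y S) \<le> 2 * F x" using assms y by (intro subadditive_subset) auto
    moreover have "finite S" using assms(1,2) locally_finite finite_subset by blast
    ultimately show False using y F_pos[OF adj_V[OF adj_sym[OF y(1)]]] assms(3) by simp
  qed
  show "(\<Sum>y | adj x y. F y) = 2 * F x" using e assms subadditive[OF assms(1)] by simp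
qed

text \<open>Deleting \<open>v\<close> breaks its component outside \<open>S\<close> into pieces that contain neighbours of \<open>v\<close>.
  These are finitely many, so one of the pieces is infinite.\<close>

lemma infinite_component_step:
  assumes v: "v \<in> V" and inf: "infinite {w. (\<lambda>a b. adj a b \<and> b \<notin> S)\<^sup>*\<^sup>* v w}"
  shows "\<exists>u. adj v u \<and> u \<notin> insert v S \<and> infinite {w. (\<lambda>a b. adj a b \<and> b \<notin> insert v S)\<^sup>*\<^sup>* u w}"
proof (rule ccontr)
  let ?R = "\<lambda>S v. {w. (\<lambda>a b. adj a b \<and> b \<notin> S)\<^sup>*\<^sup>* v w}"
  let ?N = "{u. adj v u \<and> u \<notin> insert v S}"
  assume "\<not> ?thesis"
  then have "finite (insert v (\<Union>u\<in>?N. ?R (insert v S) u))"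
    using locally_finite[OF v] by auto
  moreover have "?R S v \<subseteq> insert v (\<Union>u\<in>?N. ?R (insert v S) u)"
  proof
    fix w assume "w \<in> ?R S v"
    then have "(\<lambda>a b. adj a b \<and> b \<notin> S)\<^sup>*\<^sup>* v w" by simp
    then show "w \<in> insert v (\<Union>u\<in>?N. ?R (insert v S) u)"
    proof (induction rule: rtranclp_induct)
      case (step y z)
      show ?case
      proof (cases "z = v \<or> y = v")
        case True
        then show ?thesis using step.hyps by auto
      next
        case False
        then obtain u where u: "u \<in> ?N" "y \<in> ?R (insert v S) u" using step.IH by auto
        then have "z \<in> ?R (insert v S) u"
          using step.hyps False by (auto intro: rtranclp.rtrancl_into_rtrancl)
        then show ?thesis using u(1) by blast
      qed
    qed simp
  qed
  ultimately show False using inf finite_subset by blast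
qed

lemma ray_exists:
  assumes x: "x \<in> V" shows "\<exists>v. ray v \<and> v 0 = x"
proof -
  let ?R = "\<lambda>S v. {w. (\<lambda>a b. adj a b \<and> b \<notin> S)\<^sup>*\<^sup>* v w}"
  \<comment> \<open>The state \<open>(S, v)\<close> consists of the vertices already visited and the current end point, whose
    component outside \<open>S\<close> is kept infinite.\<close>
  let ?P = "\<lambda>n s. snd s \<in> V \<and> snd s \<notin> fst s \<and> infinite (?R (fst s) (snd s)) \<and> (n = 0 \<longrightarrow> s = ({}, x))"
  let ?Q = "\<lambda>n s s'. fst s' = insert (snd s) (fst s) \<and> adj (snd s) (snd s')"
  have "\<exists>f. \<forall>n. ?P n (f n) \<and> ?Q n (f n) (f (Suc n))"
  proof (rule dependent_nat_choice)
    have "V \<subseteq> ?R {} x" using connected[OF x] by auto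
    then have "infinite (?R {} x)" using infinite_V finite_subset by blast
    then show "\<exists>s. ?P 0 s" using x by (intro exI[of _ "({}, x)"]) simp
  next
    fix s and n :: nat assume s: "?P n s"
    then obtain u where u: "adj (snd s) u" "u \<notin> insert (snd s) (fst s)" "infinite (?R (insert (snd s) (fst s)) u)"
      using infinite_component_step[of "snd s" "fst s"] by blast
    then show "\<exists>s'. ?P (Suc n) s' \<and> ?Q n s s'"
      using adj_V[OF adj_sym[OF u(1)]] by (intro exI[of _ "(insert (snd s) (fst s), u)"]) auto
  qed
  then obtain f where f: "\<And>n. ?P n (f n)" "\<And>n. ?Q n (f n) (f (Suc n))" by blast
  define v where "v n = snd (f n)" for n
  have mem: "v m \<in> fst (f (m + Suc j))" for m j
    by (induction j) (use f(2) in \<open>auto simp: v_def\<close>)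
  have "v m \<noteq> v n" if mn: "m < n" for m n
  proof -
    obtain j where "n = m + Suc j" using less_imp_Suc_add[OF mn] by auto
    then show ?thesis using mem[of m j] f(1)[of n] by (auto simp: v_def)
  qed
  then have "inj v" by (rule linorder_injI)
  then show ?thesis using f by (intro exI[of _ v]) (auto simp: ray_def v_def)
qed

lemma ray_neighbours:
  assumes "ray v"
  shows "v i \<in> V" "adj (v i) (v (Suc i))" "adj (v (Suc i)) (v i)" "v i = v j \<longleftrightarrow> i = j"
  using assms adj_sym by (auto simp: ray_def inj_eq)

lemma ray_concave:
  assumes "ray v" shows "F (v i) + F (v (Suc (Suc i))) \<le> 2 * F (v (Suc i))"
  using subadditive_subset[of "v (Suc i)" "{v i, v (Suc (Suc i))}"] ray_neighbours[OF assms] by auto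

text \<open>Along a ray \<open>F\<close> is concave, so a decrease would persist and eventually make \<open>F\<close> negative.\<close>

lemma ray_mono:
  assumes v: "ray v" shows "F (v i) \<le> F (v (Suc i))"
proof (rule ccontr)
  assume neg: "\<not> ?thesis"
  define \<delta> where "\<delta> = F (v i) - F (v (Suc i))"
  then have \<delta>: "\<delta> > 0" using neg by simp
  have dec: "F (v (i + Suc n)) \<le> F (v (i + n)) - \<delta>" for n
  proof (induction n)
    case (Suc n)
    then show ?case using ray_concave[OF v, of "i + n"] by simp
  qed (simp add: \<delta>_def)
  have le: "F (v (i + n)) \<le> F (v i) - real n * \<delta>" for n
  proof (induction n)
    case (Suc n)
    then show ?case using dec[of n] by (simp add: algebra_simps)
  qed simp
  obtain n where "F (v i) < real n * \<delta>" using reals_Archimedean3[OF \<delta>] by blast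
  then show False using le[of n] F_pos[OF ray_neighbours(1)[OF v, of "i + n"]] by simp
qed

lemma ray_Cons:
  assumes v: "ray v" and u: "adj (v 0) u" "u \<notin> range v"
  shows "ray (case_nat u v)"
proof -
  have "inj (case_nat u v)"
  proof (rule injI)
    fix x y assume e: "case_nat u v x = case_nat u v y"
    show "x = y"
      by (cases x; cases y) (use e u(2) v in \<open>auto simp: ray_def inj_eq\<close>)
  qed
  moreover have "case_nat u v i \<in> V \<and> adj (case_nat u v i) (case_nat u v (Suc i))" for i
    using adj_sym[OF u(1)] adj_V[OF adj_sym[OF u(1)]] ray_neighbours(1,2)[OF v] by (cases i) simp_all
  ultimately show ?thesis by (simp add: ray_def)
qed

text \<open>The ray \<open>v\<close> can be prolonged at its start again and again, and the successive starting points
  form a ray in the opposite direction.  Since \<open>F\<close> is nondecreasing in both directions, it is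
  constant near \<open>v 0\<close>, and the two neighbours of \<open>v 0\<close> on this line exhaust the inequality there.\<close>

lemma extendable_ray_start:
  assumes ext: "\<And>v. ray v \<Longrightarrow> \<exists>u. adj (v 0) u \<and> u \<notin> range v" and v: "ray v"
  shows "(\<Sum>y | adj (v 0) y. F y) = 2 * F (v 0)" "\<And>y. adj (v 0) y \<Longrightarrow> F y = F (v 0)"
proof -
  have "\<exists>R. \<forall>n. (ray (R n) \<and> (n = 0 \<longrightarrow> R n = v)) \<and> (\<forall>i. R (Suc n) (Suc i) = R n i)"
  proof (rule dependent_nat_choice)
    fix r and n :: nat assume "ray r \<and> (n = 0 \<longrightarrow> r = v)"
    then obtain u where "ray (case_nat u r)" using ext[of r] ray_Cons by blast
    then show "\<exists>r'. (ray r' \<and> (Suc n = 0 \<longrightarrow> r' = v)) \<and> (\<forall>i. r' (Suc i) = r i)"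
      by (intro exI[of _ "case_nat u r"]) simp
  qed (use v in blast)
  then obtain R where R: "\<And>n. ray (R n)" "R 0 = v" "\<And>n i. R (Suc n) (Suc i) = R n i" by blast
  define w where "w n = R n 0" for n
  have wR: "R (m + j) j = w m" for m j by (induction j) (simp_all add: w_def R(3))
  have "w m \<noteq> w n" if mn: "m < n" for m n
  proof -
    obtain j where j: "n = m + j" "j \<noteq> 0" using less_imp_add_positive[OF mn] by auto
    have "R n j \<noteq> R n 0" using ray_neighbours(4)[OF R(1)] j(2) by simp
    then show ?thesis using wR[of m j] j(1) by (simp add: w_def)
  qed
  then have "inj w" by (rule linorder_injI)
  moreover have "w n \<in> V \<and> adj (w n) (w (Suc n))" for n
    using ray_neighbours(1)[OF R(1)[of n], of 0] ray_neighbours(3)[OF R(1)[of "Suc n"], of 0]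
    by (simp add: w_def R(3))
  ultimately have w: "ray w" by (simp add: ray_def)
  define u where "u = R (Suc 0) 0"
  have ru: "R (Suc 0) (Suc i) = v i" for i by (simp add: R(2,3))
  have "F (v 0) \<le> F u" using ray_mono[OF w, of 0] by (simp add: w_def u_def R(2))
  moreover have "F u \<le> F (v 0)" using ray_mono[OF R(1)[of "Suc 0"], of 0] by (simp add: ru u_def)
  ultimately have Fu: "F u = F (v 0)" by simp
  have mono: "F (v 0) \<le> F (v (Suc 0))" by (rule ray_mono[OF v])
  have conc: "F u + F (v (Suc 0)) \<le> 2 * F (v 0)"
    using ray_concave[OF R(1)[of "Suc 0"], of 0] by (simp add: ru u_def)
  have "u \<noteq> v (Suc 0)" using ray_neighbours(4)[OF R(1)[of "Suc 0"], of 0 "Suc (Suc 0)"] by (simp add: ru u_def)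
  then have sum: "sum F {u, v (Suc 0)} = F u + F (v (Suc 0))" by simp
  have "adj (v 0) u" using ray_neighbours(3)[OF R(1)[of "Suc 0"], of 0] by (simp add: ru u_def)
  then have sub: "{u, v (Suc 0)} \<subseteq> {y. adj (v 0) y}" using ray_neighbours(2)[OF v, of 0] by simp
  note t = tight_neighbours[OF ray_neighbours(1)[OF v] sub]
  show "(\<Sum>y | adj (v 0) y. F y) = 2 * F (v 0)" using t(2) sum Fu mono by simp
  show "F y = F (v 0)" if "adj (v 0) y" for y
  proof -
    have "{y. adj (v 0) y} = {u, v (Suc 0)}" using t(1) sum Fu mono by simp
    then show ?thesis using that Fu mono conc by auto
  qed
qed

text \<open>A vertex \<open>u\<close> attached to the ray at \<open>v i\<close> with \<open>i > 0\<close> uses up at least half of \<open>F (v i)\<close>.  By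
  concavity this is possible only for \<open>i = 1\<close>, with values \<open>c / 2\<close> at \<open>u\<close> and \<open>v 0\<close> and \<open>c\<close> at all
  other vertices of the ray.  All inequalities are then equalities, so that no vertex has further
  neighbours: the graph is \<open>D\<^sub>\<infinity>\<close>.\<close>

lemma branching_ray:
  assumes v: "ray v" and end0: "\<And>u. adj (v 0) u \<Longrightarrow> u \<in> range v" and ne: "range v \<noteq> V"
  shows "(\<forall>x\<in>V. (\<Sum>y | adj x y. F y) = 2 * F x) \<and> (\<exists>c. \<forall>x\<in>V. F x \<le> c)"
proof -
  note rn = ray_neighbours[OF v]
  have "\<exists>i u. adj (v i) u \<and> u \<notin> range v"
  proof (rule ccontr)
    assume *: "\<not> ?thesis"
    have "y \<in> range v" if "y \<in> V" for y
      using connected[OF rn(1)[of 0] that] by (induction rule: rtranclp_induct) (use * in auto)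
    then show False using ne rn(1) by blast
  qed
  then obtain i u where u: "adj (v i) u" "u \<notin> range v" by blast
  have uV: "u \<in> V" using adj_V[OF adj_sym[OF u(1)]] .
  have "i \<noteq> 0" using end0 u by metis
  then obtain j where j: "i = Suc j" using not0_implies_Suc by blast
  have ne': "u \<noteq> v n" for n using u(2) by blast
  have Fu: "F (v i) \<le> 2 * F u" using subadditive_subset[OF uV, of "{v i}"] adj_sym[OF u(1)] by simp
  have three: "F (v j) + F (v (Suc i)) + F u \<le> 2 * F (v i)"
    using subadditive_subset[OF rn(1)[of i], of "{v j, v (Suc i), u}"] rn(2)[of i] rn(3)[of j] u(1) j ne' ne'[symmetric]
    by (simp add: rn(4))
  have mono: "F (v i) \<le> F (v (Suc i))" by (rule ray_mono[OF v])
  \<comment> \<open>Otherwise concavity at \<open>v j\<close> gives \<open>F (v i) < 2 * F (v j)\<close>, while the branch at \<open>v i\<close> forces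
    \<open>2 * F (v j) \<le> F (v i)\<close>.\<close>
  have "j = 0"
  proof (rule ccontr)
    assume "j \<noteq> 0"
    then obtain l where l: "j = Suc l" using not0_implies_Suc by blast
    have "F (v l) + F (v i) \<le> 2 * F (v j)" using ray_concave[OF v, of l] l j by simp
    then show False using F_pos[OF rn(1)[of l]] Fu three mono by linarith
  qed
  then have i: "i = Suc 0" using j by simp
  have F0: "F (v (Suc 0)) \<le> 2 * F (v 0)" using subadditive_subset[OF rn(1)[of 0], of "{v (Suc 0)}"] rn(2)[of 0] by simp
  define c where "c = F (v (Suc 0))"
  have eqs: "2 * F u = c" "2 * F (v 0) = c" "F (v (Suc (Suc 0))) = c"
    using Fu three mono F0 i \<open>j = 0\<close> by (simp_all add: c_def)
  have const: "F (v (Suc n)) = c" for n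
  proof (induction n rule: less_induct)
    case (less n)
    show ?case
    proof (cases n)
      case (Suc m)
      show ?thesis
      proof (cases m)
        case 0
        then show ?thesis using Suc eqs by simp
      next
        case (Suc l)
        then have "F (v (Suc l)) = c" "F (v (Suc (Suc l))) = c" using less.IH \<open>n = Suc m\<close> by auto
        then show ?thesis
          using ray_concave[OF v, of "Suc l"] ray_mono[OF v, of "Suc (Suc l)"] Suc \<open>n = Suc m\<close> by simp
      qed
    qed (simp add: c_def)
  qed
  have t0: "{y. adj (v 0) y} = {v (Suc 0)}" "(\<Sum>y | adj (v 0) y. F y) = 2 * F (v 0)"
    using tight_neighbours[OF rn(1)[of 0], of "{v (Suc 0)}"] rn(2)[of 0] eqs const[of 0] by auto
  have tu: "{y. adj u y} = {v (Suc 0)}" "(\<Sum>y | adj u y. F y) = 2 * F u"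
    using tight_neighbours[OF uV, of "{v (Suc 0)}"] adj_sym[OF u(1)] i eqs const[of 0] by auto
  have sum3: "sum F {v 0, v (Suc (Suc 0)), u} = 2 * c"
    using ne'[of 0] ne'[of "Suc (Suc 0)"] ne'[symmetric] eqs by (simp add: rn(4))
  have t1: "{y. adj (v (Suc 0)) y} = {v 0, v (Suc (Suc 0)), u}" "(\<Sum>y | adj (v (Suc 0)) y. F y) = 2 * F (v (Suc 0))"
    using tight_neighbours[OF rn(1)[of "Suc 0"], of "{v 0, v (Suc (Suc 0)), u}"] rn(2)[of "Suc 0"] rn(3)[of 0] u(1) i
      sum3 const[of 0] by auto
  have t2: "{y. adj (v (Suc (Suc n))) y} = {v (Suc n), v (Suc (Suc (Suc n)))}"
    "(\<Sum>y | adj (v (Suc (Suc n))) y. F y) = 2 * F (v (Suc (Suc n)))" for n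
  proof -
    have "sum F {v (Suc n), v (Suc (Suc (Suc n)))} = 2 * c" using const[of n] const[of "Suc (Suc n)"] by (simp add: rn(4))
    then show "{y. adj (v (Suc (Suc n))) y} = {v (Suc n), v (Suc (Suc (Suc n)))}"
      "(\<Sum>y | adj (v (Suc (Suc n))) y. F y) = 2 * F (v (Suc (Suc n)))"
      using tight_neighbours[OF rn(1)[of "Suc (Suc n)"], of "{v (Suc n), v (Suc (Suc (Suc n)))}"]
        rn(2)[of "Suc (Suc n)"] rn(3)[of "Suc n"] const[of "Suc n"] by auto
  qed
  have V: "V = insert u (range v)"
  proof
    show "insert u (range v) \<subseteq> V" using uV rn(1) by auto
    have closed: "z \<in> insert u (range v)" if yz: "adj y z" "y \<in> insert u (range v)" for y z
    proof (cases "y = u")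
      case True
      then have "z \<in> {v (Suc 0)}" using yz(1) tu(1) by blast
      then show ?thesis by blast
    next
      case False
      then obtain n where n: "y = v n" using yz(2) by blast
      consider "n = 0" | "n = Suc 0" | m where "n = Suc (Suc m)" by (metis not0_implies_Suc)
      then show ?thesis
      proof cases
        case 1
        then have "z \<in> {v (Suc 0)}" using yz(1) t0(1) n by blast
        then show ?thesis by blast
      next
        case 2
        then have "z \<in> {v 0, v (Suc (Suc 0)), u}" using yz(1) t1(1) n by blast
        then show ?thesis by blast
      next
        case (3 m)
        then have "z \<in> {v (Suc m), v (Suc (Suc (Suc m)))}" using yz(1) t2(1)[of m] n by blast
        then show ?thesis by blast
      qed
    qed
    have "y \<in> insert u (range v)" if "y \<in> V" for y
      using connected[OF uV that] by (induction rule: rtranclp_induct) (use closed in blast)+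
    then show "V \<subseteq> insert u (range v)" by blast
  qed
  have "(\<Sum>y | adj (v n) y. F y) = 2 * F (v n)" "F (v n) \<le> c" for n
  proof -
    consider "n = 0" | "n = Suc 0" | m where "n = Suc (Suc m)" by (metis not0_implies_Suc)
    then show "(\<Sum>y | adj (v n) y. F y) = 2 * F (v n)" by cases (use t0(2) t1(2) t2(2) in auto)
    show "F (v n) \<le> c" using eqs const F_pos[OF rn(1)[of 0]] by (cases n) auto
  qed
  moreover have "F u \<le> c" using eqs F_pos[OF uV] by simp
  ultimately show ?thesis unfolding V using tu(2) by blast
qed

text \<open>If some ray cannot be prolonged at its start, then it visits all vertices or the graph is
  \<open>D\<^sub>\<infinity>\<close>.  If all rays can be prolonged, then every vertex has exactly two neighbours, with the
  same value of \<open>F\<close>, and the graph is the line \<open>A\<^sub>\<infinity>\<^sup>\<infinity>\<close>.\<close>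

theorem hamiltonian_ray_or_tight:
  "(\<exists>v. ray v \<and> range v = V) \<or>
   (\<forall>x\<in>V. (\<Sum>y | adj x y. F y) = 2 * F x) \<and> (\<exists>c. \<forall>x\<in>V. F x \<le> c)"
proof (cases "\<exists>v. ray v \<and> (\<forall>u. adj (v 0) u \<longrightarrow> u \<in> range v)")
  case True
  then show ?thesis using branching_ray by blast
next
  case False
  then have ext: "\<And>v. ray v \<Longrightarrow> \<exists>u. adj (v 0) u \<and> u \<notin> range v" by blast
  have *: "(\<Sum>y | adj x y. F y) = 2 * F x" "\<And>y. adj x y \<Longrightarrow> F y = F x" if "x \<in> V" for x
    using ray_exists[OF that] extendable_ray_start[OF ext] by blast+
  obtain x where x: "x \<in> V" using infinite_V by fastforce
  have "F y = F x" if "y \<in> V" for y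
    using connected[OF x that]
  proof (induction rule: rtranclp_induct)
    case (step y z)
    then show ?case using *(2)[of y z] adj_V by metis
  qed simp
  then show ?thesis using *(1) by (metis order_refl)
qed

end

section \<open>Translation quivers with a periodic vertex\<close>

lemma sum_periodic:
  fixes g :: "nat \<Rightarrow> real"
  assumes "\<And>i. g (i + p) = g i" shows "(\<Sum>i<N * p. g i) = real N * (\<Sum>i<p. g i)"
proof (induction N)
  case (Suc N)
  have per: "g (N * p + i) = g i" for i
    by (induction N) (use assms in \<open>simp_all add: algebra_simps\<close>, metis add.assoc add.commute)
  have "(\<Sum>i<a + p. g i) = (\<Sum>i<a. g i) + (\<Sum>i<p. g (a + i))" for a by (induction p) simp_all
  from this[of "N * p"] show ?case using Suc per by (simp add: algebra_simps)
qed simp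

text \<open>The sum in the inequality counts every starting point of an arrow once, whatever the
  multiplicity of the arrow.\<close>

locale translation_quiver =
  fixes V :: "'v set" and t :: "'v \<Rightarrow> 'v" and arr :: "'v \<Rightarrow> 'v \<Rightarrow> bool" and d :: "'v \<Rightarrow> nat"
  assumes t_bij: "bij_betw t V V" and arr_V: "arr x y \<Longrightarrow> x \<in> V \<and> y \<in> V"
    and mesh: "x \<in> V \<Longrightarrow> y \<in> V \<Longrightarrow> arr (t y) x \<longleftrightarrow> arr x y"
    and finite_pred: "y \<in> V \<Longrightarrow> finite {x. arr x y}"
    and d_pos: "x \<in> V \<Longrightarrow> d x > 0"
    and d_subadditive: "y \<in> V \<Longrightarrow> (\<Sum>x | arr x y. d x) \<le> d y + d (t y)"
    and connected: "x \<in> V \<Longrightarrow> y \<in> V \<Longrightarrow>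
      (\<lambda>a b. a \<in> V \<and> b \<in> V \<and> (arr a b \<or> arr b a \<or> b = t a \<or> a = t b))\<^sup>*\<^sup>* x y"
    and infinite_V: "infinite V" and periodic_vertex: "\<exists>x\<in>V. \<exists>p\<ge>1. (t ^^ p) x = x"
begin

lemma t_V: "x \<in> V \<Longrightarrow> t x \<in> V"
  using t_bij by (auto simp: bij_betw_def)

lemma t_eq: "x \<in> V \<Longrightarrow> y \<in> V \<Longrightarrow> t x = t y \<longleftrightarrow> x = y"
  using t_bij by (auto simp: bij_betw_def inj_on_def)

lemma tn_V: "x \<in> V \<Longrightarrow> (t ^^ n) x \<in> V"
  by (induction n) (auto simp: t_V)

lemma tn_tn: "(t ^^ m) ((t ^^ n) x) = (t ^^ (m + n)) x"
  by (simp add: funpow_add)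

lemma tn_eq: "x \<in> V \<Longrightarrow> y \<in> V \<Longrightarrow> (t ^^ n) x = (t ^^ n) y \<longleftrightarrow> x = y"
  by (induction n) (auto simp: t_eq tn_V)

lemma tn_surj: "y \<in> V \<Longrightarrow> \<exists>x\<in>V. y = (t ^^ n) x"
proof (induction n arbitrary: y)
  case (Suc n)
  then obtain z where "z \<in> V" "y = t z" using t_bij by (auto simp: bij_betw_def)
  then show ?case using Suc.IH[of z] by auto
qed auto

lemma arr_t: "x \<in> V \<Longrightarrow> y \<in> V \<Longrightarrow> arr (t x) (t y) \<longleftrightarrow> arr x y"
  using mesh[of x y] mesh[of "t y" x] t_V by blast

lemma arr_tn: "x \<in> V \<Longrightarrow> y \<in> V \<Longrightarrow> arr ((t ^^ n) x) ((t ^^ n) y) \<longleftrightarrow> arr x y"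
  by (induction n) (auto simp: arr_t tn_V)

lemma pred_tn:
  assumes y: "y \<in> V" shows "bij_betw (t ^^ n) {x. arr x y} {x. arr x ((t ^^ n) y)}"
proof -
  have "x \<in> (t ^^ n) ` {x. arr x y}" if x: "arr x ((t ^^ n) y)" for x
  proof -
    obtain z where z: "z \<in> V" "x = (t ^^ n) z" using tn_surj arr_V[OF x] by blast
    then show ?thesis using x arr_tn[OF z(1) y] by blast
  qed
  then show ?thesis
    using arr_V tn_eq arr_tn y by (auto simp: bij_betw_def inj_on_def)
qed

text \<open>Inheritance by successors follows: an arrow \<open>a \<rightarrow> b\<close> yields an arrow \<open>t b \<rightarrow> a\<close>.\<close>

lemma spread:
  assumes x: "x \<in> V" "P x" and y: "y \<in> V"
    and P: "\<And>a. a \<in> V \<Longrightarrow> P (t a) \<longleftrightarrow> P a" "\<And>a b. arr a b \<Longrightarrow> P b \<Longrightarrow> P a"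
  shows "P y"
  using connected[OF x(1) y]
proof (induction rule: rtranclp_induct)
  case (step a b)
  then have ab: "a \<in> V" "b \<in> V" by auto
  from step consider "arr a b" | "arr b a" | "b = t a" | "a = t b" by blast
  then show ?case
  proof cases
    case 1
    then have "P (t b)" using P(2)[of "t b" a] mesh[OF ab] step.IH by blast
    then show ?thesis using P(1)[OF ab(2)] by blast
  qed (use P ab step.IH in auto)
qed (fact x(2))

text \<open>A power of \<open>t\<close> that fixes \<open>b\<close> permutes the finitely many predecessors of \<open>b\<close>.\<close>

lemma periodic:
  assumes "y \<in> V" shows "\<exists>p\<ge>1. (t ^^ p) y = y"
proof -
  obtain x where x: "x \<in> V" "\<exists>p\<ge>1. (t ^^ p) x = x" using periodic_vertex by blast
  show ?thesis
  proof (rule spread[where P="\<lambda>y. \<exists>p\<ge>1. (t ^^ p) y = y", OF x assms])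
    fix a assume a: "a \<in> V"
    show "(\<exists>p\<ge>1. (t ^^ p) (t a) = t a) \<longleftrightarrow> (\<exists>p\<ge>1. (t ^^ p) a = a)"
      unfolding funpow_swap1[symmetric] using t_eq tn_V a by simp
  next
    fix a b assume ab: "arr a b" and "\<exists>p\<ge>1. (t ^^ p) b = b"
    then obtain p where p: "p \<ge> 1" "(t ^^ p) b = b" by blast
    have V: "a \<in> V" "b \<in> V" using arr_V[OF ab] by auto
    have "(t ^^ (p * n)) a \<in> {x. arr x b}" for n
    proof (induction n)
      case (Suc n)
      then have "arr ((t ^^ p) ((t ^^ (p * n)) a)) ((t ^^ p) b)" using arr_tn[OF tn_V[OF V(1)] V(2)] by blast
      then show ?case by (simp add: p(2) funpow_add)
    qed (simp add: ab)
    then have "range (\<lambda>n. (t ^^ (p * n)) a) \<subseteq> {x. arr x b}" by blast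
    then have "finite (range (\<lambda>n. (t ^^ (p * n)) a))" by (rule finite_subset[OF _ finite_pred[OF V(2)]])
    then have "\<not> inj (\<lambda>n. (t ^^ (p * n)) a)" using finite_imageD infinite_UNIV_nat by blast
    then obtain m n where mn: "m < n" "(t ^^ (p * m)) a = (t ^^ (p * n)) a"
      using linorder_injI[of "\<lambda>n. (t ^^ (p * n)) a"] by blast
    have "p * n = p * m + p * (n - m)" using mn(1) by (metis add_mult_distrib2 le_add_diff_inverse less_imp_le)
    then have "(t ^^ (p * m)) ((t ^^ (p * (n - m))) a) = (t ^^ (p * m)) a" using mn(2) by (simp add: funpow_add)
    then have "(t ^^ (p * (n - m))) a = a" using tn_eq tn_V V(1) by blast
    moreover have "p * (n - m) \<ge> 1" using p(1) mn(1) by (simp add: Suc_le_eq)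
    ultimately show "\<exists>p\<ge>1. (t ^^ p) a = a" by blast
  qed
qed

lemma period_mult: "(t ^^ p) x = x \<Longrightarrow> (t ^^ (N * p)) x = x"
  by (induction N) (simp_all add: funpow_add)

lemma common_period:
  assumes "finite S" "S \<subseteq> V" shows "\<exists>N\<ge>1. \<forall>x\<in>S. (t ^^ N) x = x"
  using assms
proof (induction S)
  case (insert x S)
  then obtain N p where N: "N \<ge> 1" "\<forall>x\<in>S. (t ^^ N) x = x" and p: "p \<ge> 1" "(t ^^ p) x = x"
    using periodic[of x] by auto
  have "(t ^^ (N * p)) z = z" if "z \<in> insert x S" for z
    using that period_mult[OF p(2), of N] period_mult[of N z p] N(2) by (auto simp: mult.commute)
  then show ?case using N(1) p(1) by (intro exI[of _ "N * p"]) simp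
qed auto

text \<open>All periods of \<open>x\<close> give the same mean value; the choice of one makes it a function of \<open>x\<close>.\<close>

definition avg :: "'v \<Rightarrow> real" where
  "avg x = (let p = (SOME p. p \<ge> 1 \<and> (t ^^ p) x = x) in (\<Sum>i<p. real (d ((t ^^ i) x))) / p)"

text \<open>The sums over two periods of \<open>x\<close> are compared through the sum over their product.\<close>

lemma avg_eq:
  assumes x: "x \<in> V" and N: "N \<ge> 1" "(t ^^ N) x = x"
  shows "real N * avg x = (\<Sum>i<N. real (d ((t ^^ i) x)))"
proof -
  define p where "p = (SOME p. p \<ge> 1 \<and> (t ^^ p) x = x)"
  have p: "p \<ge> 1" "(t ^^ p) x = x" using someI_ex[OF periodic[OF x, unfolded Bex_def]] unfolding p_def by auto
  let ?g = "\<lambda>i. real (d ((t ^^ i) x))"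
  have per: "?g (i + q) = ?g i" if "(t ^^ q) x = x" for q i using that by (simp add: funpow_add)
  have "real N * (\<Sum>i<p. ?g i) = (\<Sum>i<N * p. ?g i)" using sum_periodic[of ?g p N] per[OF p(2)] by simp
  also have "\<dots> = (\<Sum>i<p * N. ?g i)" by (simp add: mult.commute)
  also have "\<dots> = real p * (\<Sum>i<N. ?g i)" using sum_periodic[of ?g N p] per[OF N(2)] by simp
  finally show ?thesis using p(1) unfolding avg_def Let_def p_def[symmetric] by (simp add: field_simps)
qed

lemma avg_pos: assumes x: "x \<in> V" shows "avg x > 0"
proof -
  obtain N where N: "N \<ge> 1" "(t ^^ N) x = x" using periodic[OF x] by blast
  have "(\<Sum>i<N. real (d ((t ^^ i) x))) > 0" using N(1) d_pos tn_V[OF x] by (intro sum_pos) (auto simp: lessThan_empty_iff)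
  then show ?thesis using avg_eq[OF x N] N(1) by (metis of_nat_0_le_iff zero_less_mult_pos2 mult.commute zero_less_mult_iff not_less)
qed

lemma avg_t: assumes x: "x \<in> V" shows "avg (t x) = avg x"
proof -
  obtain N where N: "N \<ge> 1" "(t ^^ N) x = x" using periodic[OF x] by blast
  let ?g = "\<lambda>i. real (d ((t ^^ i) x))"
  have N': "(t ^^ N) (t x) = t x" using N(2) by (simp add: funpow_swap1[symmetric])
  have "real N * avg (t x) = (\<Sum>i<N. ?g (Suc i))"
    using avg_eq[OF t_V[OF x] N(1) N'] by (simp add: funpow_swap1)
  also have "\<dots> = (\<Sum>i<N. ?g i)"
    using sum.lessThan_Suc_shift[of ?g N] sum.lessThan_Suc[of ?g N] N(2) by simp
  also have "\<dots> = real N * avg x" using avg_eq[OF x N] by simp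
  finally show ?thesis using N(1) by simp
qed

lemma avg_tn: "x \<in> V \<Longrightarrow> avg ((t ^^ n) x) = avg x"
  by (induction n) (auto simp: avg_t tn_V)

text \<open>The inequality for \<open>d\<close> is summed over a common period of \<open>y\<close> and its predecessors; powers of
  \<open>t\<close> map predecessors bijectively to predecessors.  If the sums are equal, then so are all
  their terms.\<close>

lemma avg_subadditive:
  assumes y: "y \<in> V"
  shows "(\<Sum>x | arr x y. avg x) \<le> 2 * avg y"
    and "(\<Sum>x | arr x y. avg x) = 2 * avg y \<Longrightarrow> (\<Sum>x | arr x y. d x) = d y + d (t y)"
proof -
  let ?P = "\<lambda>y. {x. arr x y}"
  obtain N where N: "N \<ge> 1" "\<And>x. x \<in> insert y (?P y) \<Longrightarrow> (t ^^ N) x = x"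
    using common_period[of "insert y (?P y)"] finite_pred[OF y] y arr_V by blast
  let ?y = "\<lambda>i. (t ^^ i) y"
  have "real N * (\<Sum>x\<in>?P y. avg x) = (\<Sum>x\<in>?P y. \<Sum>i<N. real (d ((t ^^ i) x)))"
    unfolding sum_distrib_left using avg_eq N arr_V by (intro sum.cong) auto
  also have "\<dots> = (\<Sum>i<N. \<Sum>x\<in>?P y. real (d ((t ^^ i) x)))" by (rule sum.swap)
  also have "\<dots> = (\<Sum>i<N. \<Sum>x\<in>?P (?y i). real (d x))"
    by (intro sum.cong refl sum.reindex_bij_betw[OF pred_tn[OF y]])
  finally have L: "real N * (\<Sum>x\<in>?P y. avg x) = (\<Sum>i<N. real (\<Sum>x\<in>?P (?y i). d x))" by simp
  have N': "(t ^^ N) (t y) = t y" using N(2)[of y] by (simp add: funpow_swap1[symmetric])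
  have "real N * (2 * avg y) = real N * avg y + real N * avg (t y)" using avg_t[OF y] by simp
  also have "\<dots> = (\<Sum>i<N. real (d (?y i))) + (\<Sum>i<N. real (d (t (?y i))))"
    using avg_eq[OF y N(1)] avg_eq[OF t_V[OF y] N(1) N'] N(2)[of y] by (simp add: funpow_swap1)
  finally have R: "real N * (2 * avg y) = (\<Sum>i<N. real (d (?y i) + d (t (?y i))))" by (simp add: sum.distrib)
  have le: "real (\<Sum>x\<in>?P (?y i). d x) \<le> real (d (?y i) + d (t (?y i)))" for i
    using d_subadditive[OF tn_V[OF y]] of_nat_le_iff by blast
  then have "real N * (\<Sum>x\<in>?P y. avg x) \<le> real N * (2 * avg y)" unfolding L R by (intro sum_mono)
  then show "(\<Sum>x\<in>?P y. avg x) \<le> 2 * avg y" using N(1) by simp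
  assume "(\<Sum>x\<in>?P y. avg x) = 2 * avg y"
  then have eq: "(\<Sum>i<N. real (\<Sum>x\<in>?P (?y i). d x)) = (\<Sum>i<N. real (d (?y i) + d (t (?y i))))" using L R by simp
  have "real (\<Sum>x\<in>?P (?y 0). d x) = real (d (?y 0) + d (t (?y 0)))"
  proof (rule ccontr)
    assume "\<not> ?thesis"
    then have "real (\<Sum>x\<in>?P (?y 0). d x) < real (d (?y 0) + d (t (?y 0)))" using le[of 0] by linarith
    then have "(\<Sum>i<N. real (\<Sum>x\<in>?P (?y i). d x)) < (\<Sum>i<N. real (d (?y i) + d (t (?y i))))"
      using N(1) le by (intro sum_strict_mono_ex1) (auto intro!: bexI[of _ 0])
    then show False using eq by simp
  qed
  then show "(\<Sum>x\<in>?P y. d x) = d y + d (t y)" using of_nat_eq_iff[where 'a=real] by fastforce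
qed

section \<open>The graph of orbits\<close>

text \<open>Forward orbits are the whole orbits, since every vertex is periodic.\<close>

definition orb :: "'v \<Rightarrow> 'v set" where
  "orb x = {z. \<exists>n. z = (t ^^ n) x}"

lemma orb_eq_iff: assumes x: "x \<in> V" and y: "y \<in> V" shows "orb x = orb y \<longleftrightarrow> (\<exists>n. y = (t ^^ n) x)"
proof
  assume "orb x = orb y"
  moreover have "y \<in> orb y" by (auto simp: orb_def intro: exI[of _ 0])
  ultimately show "\<exists>n. y = (t ^^ n) x" by (auto simp: orb_def)
next
  assume "\<exists>n. y = (t ^^ n) x"
  then obtain n where n: "y = (t ^^ n) x" by blast
  obtain p where p: "p \<ge> 1" "(t ^^ p) x = x" using periodic[OF x] by blast
  \<comment> \<open>The step from \<open>x\<close> to \<open>y\<close> is undone by going on to a multiple of the period that is at least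
    \<open>n\<close>.\<close>
  have "n \<le> n * p" using p(1) by simp
  then have "(t ^^ (n * p - n)) y = (t ^^ (n * p)) x" unfolding n by (simp add: tn_tn)
  then have x_eq: "x = (t ^^ (n * p - n)) y" using period_mult[OF p(2)] by simp
  show "orb x = orb y"
  proof
    show "orb y \<subseteq> orb x" by (auto simp: orb_def n tn_tn)
    show "orb x \<subseteq> orb y" by (subst x_eq) (auto simp: orb_def tn_tn)
  qed
qed

lemma orb_tn: "x \<in> V \<Longrightarrow> orb ((t ^^ n) x) = orb x"
  using orb_eq_iff tn_V by blast

lemma orb_t: "x \<in> V \<Longrightarrow> orb (t x) = orb x"
  using orb_tn[of x 1] by simp

definition oadj :: "'v set \<Rightarrow> 'v set \<Rightarrow> bool" where
  "oadj a b \<longleftrightarrow> (\<exists>x y. arr x y \<and> a = orb x \<and> b = orb y)"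

definition oavg :: "'v set \<Rightarrow> real" where
  "oavg a = avg (SOME x. x \<in> a)"

lemma oavg: assumes x: "x \<in> V" shows "oavg (orb x) = avg x"
proof -
  have "\<exists>z. z \<in> orb x" by (auto simp: orb_def)
  then have "(SOME z. z \<in> orb x) \<in> orb x" by (rule someI_ex)
  then show ?thesis unfolding oavg_def using avg_tn[OF x] by (auto simp: orb_def)
qed

lemma oadj_sym: "oadj a b \<Longrightarrow> oadj b a"
  unfolding oadj_def using mesh arr_V orb_t by metis

lemma oadj_pred: assumes y: "y \<in> V" shows "{b. oadj (orb y) b} = orb ` {x. arr x y}"
proof
  have "oadj (orb y) (orb x)" if "arr x y" for x
    by (rule oadj_sym) (use that in \<open>auto simp: oadj_def\<close>)
  then show "orb ` {x. arr x y} \<subseteq> {b. oadj (orb y) b}" by blast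
  show "{b. oadj (orb y) b} \<subseteq> orb ` {x. arr x y}"
  proof
    fix b assume "b \<in> {b. oadj (orb y) b}"
    then have "oadj b (orb y)" using oadj_sym by simp
    then obtain x z where xz: "arr x z" "b = orb x" "orb z = orb y" by (auto simp: oadj_def)
    have V: "x \<in> V" "z \<in> V" using arr_V[OF xz(1)] by auto
    obtain n where n: "y = (t ^^ n) z" using orb_eq_iff[OF V(2) y] xz(3) by blast
    then have "arr ((t ^^ n) x) y" using arr_tn[OF V] xz(1) by simp
    then show "b \<in> orb ` {x. arr x y}" using orb_tn[OF V(1)] xz(2) by (metis image_eqI mem_Collect_eq)
  qed
qed

lemma finite_orb: assumes x: "x \<in> V" shows "finite (orb x)"
proof -
  obtain p where p: "p \<ge> 1" "(t ^^ p) x = x" using periodic[OF x] by blast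
  have "orb x \<subseteq> (\<lambda>i. (t ^^ i) x) ` {..<p}"
  proof
    fix z assume "z \<in> orb x"
    then obtain n where "z = (t ^^ n) x" by (auto simp: orb_def)
    then have "z = (t ^^ (n mod p)) x" using funpow_mod_eq[OF p(2)] by simp
    then show "z \<in> (\<lambda>i. (t ^^ i) x) ` {..<p}" using p(1) by auto
  qed
  then show ?thesis using finite_surj by blast
qed

lemma oavg_image_le:
  assumes "finite S" "S \<subseteq> V" shows "sum oavg (orb ` S) \<le> sum avg S"
proof -
  have "sum oavg (orb ` S) \<le> sum (oavg \<circ> orb) S"
    using assms oavg avg_pos by (intro sum_image_le) (auto simp: less_imp_le subset_iff)
  also have "\<dots> = sum avg S" using assms oavg by (intro sum.cong) auto
  finally show ?thesis .
qed

sublocale orbits: subadditive_graph "orb ` V" oadj oavg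
proof
  show "oadj b a" if "oadj a b" for a b using that by (rule oadj_sym)
  show "a \<in> orb ` V" if "oadj a b" for a b using that arr_V by (auto simp: oadj_def)
  show "infinite (orb ` V)"
  proof
    assume "finite (orb ` V)"
    moreover have "x \<in> orb x" for x by (auto simp: orb_def intro: exI[of _ 0])
    then have "V \<subseteq> \<Union> (orb ` V)" by blast
    ultimately show False using infinite_V finite_orb finite_subset by (metis finite_Union imageE)
  qed
  fix a assume "a \<in> orb ` V"
  then obtain y where y: "y \<in> V" "a = orb y" by blast
  show "finite {b. oadj a b}" unfolding y(2) oadj_pred[OF y(1)] using finite_pred[OF y(1)] by simp
  show "oavg a > 0" using y oavg avg_pos by simp
  show "(\<Sum>b | oadj a b. oavg b) \<le> 2 * oavg a"
    unfolding y(2) oadj_pred[OF y(1)] oavg[OF y(1)]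
    using oavg_image_le[OF finite_pred[OF y(1)]] avg_subadditive(1)[OF y(1)] arr_V by fastforce
  fix b assume "b \<in> orb ` V"
  then obtain z where z: "z \<in> V" "b = orb z" by blast
  show "oadj\<^sup>*\<^sup>* a b"
    unfolding y(2) z(2) using connected[OF y(1) z(1)]
  proof (induction rule: rtranclp_induct)
    case (step u v)
    then have "oadj (orb u) (orb v) \<or> orb u = orb v" using oadj_sym orb_t by (metis oadj_def)
    then show ?case using step.IH by (auto intro: rtranclp.rtrancl_into_rtrancl)
  qed simp
qed

text \<open>If two predecessors of \<open>y\<close> lay in one orbit, omitting one of them would not change the set of
  neighbouring orbits but would lower the bound on the sum of their values.\<close>

lemma orb_inj_pred:
  assumes y: "y \<in> V" and tight: "(\<Sum>b | oadj (orb y) b. oavg b) = 2 * avg y"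
    and x: "arr x y" "arr x' y" "orb x = orb x'"
  shows "x = x'"
proof (rule ccontr)
  assume ne: "x \<noteq> x'"
  let ?P = "{x. arr x y}"
  have fin: "finite ?P" by (rule finite_pred[OF y])
  have "orb x' \<in> orb ` (?P - {x'})" using x ne by (metis Diff_iff image_eqI mem_Collect_eq singletonD)
  then have "orb ` ?P = orb ` (?P - {x'})" by blast
  then have "2 * avg y \<le> sum avg (?P - {x'})"
    using tight oavg_image_le[of "?P - {x'}"] fin arr_V by (fastforce simp: oadj_pred[OF y])
  also have "\<dots> = sum avg ?P - avg x'" using fin x by (simp add: sum_diff1)
  also have "\<dots> \<le> 2 * avg y - avg x'" using avg_subadditive(1)[OF y] by simp
  finally show False using avg_pos[of x'] arr_V[OF x(2)] by simp
qed

text \<open>An edge between two orbits is realized by an arrow ending at any prescribed vertex of either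
  orbit, so a ray of orbits lifts step by step.  In the tight case predecessors lie in different
  orbits, so a period of a vertex is also a period of its predecessors.  Hence all vertices have a
  common period \<open>p\<close>, and \<open>d x \<le> p * avg x\<close> is bounded.\<close>

theorem hamiltonian_path_or_additive:
  "(\<exists>w. (\<forall>i. w i \<in> V \<and> arr (w (Suc i)) (w i)) \<and> (\<forall>y\<in>V. \<exists>!i. orb y = orb (w i))) \<or>
   (\<forall>y\<in>V. (\<Sum>x | arr x y. d x) = d y + d (t y)) \<and> (\<exists>c. \<forall>x\<in>V. d x \<le> c)"
  using orbits.hamiltonian_ray_or_tight
proof
  assume "\<exists>v. orbits.ray v \<and> range v = orb ` V"
  then obtain v where v: "orbits.ray v" "range v = orb ` V" by blast
  note vn = orbits.ray_neighbours[OF v(1)]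
  have "\<exists>w. \<forall>i. (w i \<in> V \<and> orb (w i) = v i) \<and> arr (w (Suc i)) (w i)"
  proof (rule dependent_nat_choice)
    show "\<exists>x. x \<in> V \<and> orb x = v 0" using vn(1)[of 0] by auto
    fix y i assume y: "y \<in> V \<and> orb y = v i"
    then have "v (Suc i) \<in> orb ` {x. arr x y}" using oadj_pred[of y] vn(2)[of i] by auto
    then show "\<exists>x. (x \<in> V \<and> orb x = v (Suc i)) \<and> arr x y" using arr_V by auto
  qed
  then obtain w where w: "\<And>i. w i \<in> V" "\<And>i. orb (w i) = v i" "\<And>i. arr (w (Suc i)) (w i)" by blast
  have "\<exists>!i. orb y = orb (w i)" if y: "y \<in> V" for y
  proof -
    have "orb y \<in> range v" using y v(2) by blast
    then obtain i where "orb y = v i" by blast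
    then show ?thesis using vn(4) w(2) by (intro ex1I[of _ i]) auto
  qed
  then have "\<forall>y\<in>V. \<exists>!i. orb y = orb (w i)" by blast
  moreover have "\<forall>i. w i \<in> V \<and> arr (w (Suc i)) (w i)" using w(1,3) by simp
  ultimately show ?thesis by (intro disjI1 exI[of _ w] conjI)
next
  assume *: "(\<forall>a\<in>orb ` V. (\<Sum>b | oadj a b. oavg b) = 2 * oavg a) \<and> (\<exists>c. \<forall>a\<in>orb ` V. oavg a \<le> c)"
  then obtain c where c: "\<And>x. x \<in> V \<Longrightarrow> avg x \<le> c" using oavg by fastforce
  have tight: "(\<Sum>b | oadj (orb y) b. oavg b) = 2 * avg y" if "y \<in> V" for y using * that oavg by simp
  have additive: "(\<Sum>x | arr x y. d x) = d y + d (t y)" if y: "y \<in> V" for y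
  proof (rule avg_subadditive(2)[OF y])
    have "2 * avg y \<le> (\<Sum>x | arr x y. avg x)"
      using tight[OF y] oavg_image_le[OF finite_pred[OF y]] arr_V by (fastforce simp: oadj_pred[OF y])
    then show "(\<Sum>x | arr x y. avg x) = 2 * avg y" using avg_subadditive(1)[OF y] by simp
  qed
  obtain x0 p where x0: "x0 \<in> V" and p: "p \<ge> 1" "(t ^^ p) x0 = x0" using periodic_vertex by blast
  have all: "(t ^^ p) y = y" if "y \<in> V" for y
  proof (rule spread[where P="\<lambda>y. (t ^^ p) y = y", OF x0 p(2) that])
    fix a assume "a \<in> V"
    then show "(t ^^ p) (t a) = t a \<longleftrightarrow> (t ^^ p) a = a"
      unfolding funpow_swap1[symmetric] using t_eq tn_V by simp
  next
    fix a b assume ab: "arr a b" "(t ^^ p) b = b"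
    have V: "a \<in> V" "b \<in> V" using arr_V[OF ab(1)] by auto
    have "arr ((t ^^ p) a) b" using arr_tn[OF V, of p] ab by simp
    then show "(t ^^ p) a = a" using orb_inj_pred[OF V(2) tight[OF V(2)] _ ab(1)] orb_tn[OF V(1)] by blast
  qed
  have "d x \<le> nat \<lceil>real p * c\<rceil>" if x: "x \<in> V" for x
  proof -
    have "real (d ((t ^^ 0) x)) \<le> (\<Sum>i<p. real (d ((t ^^ i) x)))" using p(1) by (intro member_le_sum) auto
    also have "\<dots> = real p * avg x" using avg_eq[OF x p(1) all[OF x]] by simp
    also have "\<dots> \<le> real p * c" using c[OF x] by (simp add: mult_left_mono)
    finally have "real (d x) \<le> real p * c" by simp
    then show ?thesis by linarith
  qed
  then show ?thesis using additive by blast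
qed

end

section \<open>The translation quiver of a stable subquiver\<close>

locale stable_periodic_subquiver = fd_algebra k A for k :: "'k ring" and A :: "('k, 'a) module" +
  fixes \<chi> \<Gamma> :: "('a, 'm) module set"
  assumes subcat: "subcategory A \<chi>"
    and stable: "stable_subquiver A \<chi> \<Gamma>" and conn: "connected_subquiver A \<chi> \<Gamma>"
    and infin: "infinite_subquiver A \<chi> \<Gamma>" and periodic_module: "\<exists>W\<in>\<Gamma>. tau_periodic A \<chi> W"
begin

lemma \<chi>_fg: "\<chi> \<subseteq> fg_mods A" using subcat by (simp add: subcategory_def)

lemma \<Gamma>D:
  assumes "W \<in> \<Gamma>" shows "W \<in> ind_mods A \<chi>" "W \<in> \<chi>" "indecomposable A W" "W \<in> fg_mods A"
proof -
  show i: "W \<in> ind_mods A \<chi>" using assms stable unfolding stable_subquiver_def subquiver_def by blast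
  then show "W \<in> \<chi>" "indecomposable A W" by (simp_all add: ind_mods_def)
  then show "W \<in> fg_mods A" by (simp add: indecomposable_def)
qed

lemma \<Gamma>_iso:
  assumes "W \<in> \<Gamma>" "indecomposable A Y" "mod_iso A W Y" shows "Y \<in> \<Gamma>"
proof -
  have "Y \<in> fg_mods A" using assms(2) by (simp add: indecomposable_def)
  then have "Y \<in> \<chi>" using subcat \<Gamma>D(2)[OF assms(1)] assms(3) unfolding subcategory_def by blast
  then have "Y \<in> ind_mods A \<chi>" using assms(2) by (simp add: ind_mods_def)
  then show ?thesis using stable assms(1,3) unfolding stable_subquiver_def subquiver_def by blast
qed

lemma tau_pow_\<Gamma>: "W \<in> \<Gamma> \<Longrightarrow> tau_pow A \<chi> n W Y \<Longrightarrow> Y \<in> \<Gamma>"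
  using stable unfolding stable_subquiver_def by blast

lemma tau_\<Gamma>:
  assumes "tau A \<chi> Y W" shows "Y \<in> \<Gamma> \<longleftrightarrow> W \<in> \<Gamma>"
proof -
  have YW: "Y \<in> ind_mods A \<chi>" "W \<in> ind_mods A \<chi>" using assms by (auto simp: tau_def)
  then have "mod_iso A W W" "mod_iso A Y Y" using iso_refl by (auto simp: ind_mods_def indecomposable_def)
  then have "tau_pow A \<chi> 1 Y W" "tau_pow A \<chi> (-1) W Y"
    unfolding tau_pow_def using YW assms by (auto simp: relcompp_apply)
  then show ?thesis using tau_pow_\<Gamma> by blast
qed

lemma tau_exists: assumes "Y \<in> \<Gamma>" shows "\<exists>W. tau A \<chi> Y W" "\<exists>W. tau A \<chi> W Y"
proof -
  have s: "\<exists>W. tau_pow A \<chi> n Y W" for n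
    using stable assms unfolding stable_subquiver_def stable_in_def by blast
  show "\<exists>W. tau A \<chi> Y W" using s[of 1] by (auto simp: tau_pow_def)
  show "\<exists>W. tau A \<chi> W Y" using s[of "-1"] by (auto simp: tau_pow_def)
qed

lemma tau_cong:
  assumes "tau A \<chi> Y W" "tau A \<chi> Y' W'" shows "mod_iso A Y Y' \<longleftrightarrow> mod_iso A W W'"
proof -
  obtain f E g f' E' g' where s: "almost_split_sequence A \<chi> W f E g Y"
    and s': "almost_split_sequence A \<chi> W' f' E' g' Y'"
    using assms by (auto simp: tau_def)
  then show ?thesis using almost_split_unique_right(2)[OF s s'] almost_split_unique_left[OF s s'] by blast
qed

lemma arrow_tau: assumes "tau A \<chi> Y Z" "W \<in> \<Gamma>" shows "arrow A \<chi> W Y \<longleftrightarrow> arrow A \<chi> Z W"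
proof -
  obtain f E g where s: "almost_split_sequence A \<chi> Z f E g Y"
    using assms by (auto simp: tau_def)
  have "Y \<in> ind_mods A \<chi>" "Z \<in> ind_mods A \<chi>" using assms(1) by (auto simp: tau_def)
  then show ?thesis
    using arrow_into_iff[OF s \<chi>_fg \<Gamma>D(1)[OF assms(2)]] arrow_from_iff[OF s \<chi>_fg \<Gamma>D(1)[OF assms(2)]] by blast
qed

lemma arrow_cong:
  assumes mem: "W \<in> \<Gamma>" "W' \<in> \<Gamma>" "Y \<in> \<Gamma>" "Y' \<in> \<Gamma>"
    and iso: "mod_iso A W W'" "mod_iso A Y Y'" and a: "arrow A \<chi> W Y"
  shows "arrow A \<chi> W' Y'"
proof -
  obtain Z Z' where "tau A \<chi> Y Z" "tau A \<chi> Y' Z'" using tau_exists(1) mem by blast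
  then obtain f E g f' E' g' where s: "almost_split_sequence A \<chi> Z f E g Y"
    and s': "almost_split_sequence A \<chi> Z' f' E' g' Y'"
    by (auto simp: tau_def)
  note fg = almost_split_sequenceD(2)[OF s] almost_split_sequenceD(2)[OF s'] \<Gamma>D(4)[OF mem(1)] \<Gamma>D(4)[OF mem(2)]
  have "is_retract W E" using arrow_into_iff[OF s \<chi>_fg \<Gamma>D(1)[OF mem(1)] \<Gamma>D(1)[OF mem(3)]] a by simp
  then have "is_retract W' E"
    using is_retract_trans[OF fg(4,3,1)] iso_is_retract[OF fg(4,3)] iso_sym[OF fg(3,4) iso(1)] by blast
  then have "is_retract W' E'"
    using is_retract_trans[OF fg(4,1,2)] iso_is_retract[OF fg(1,2) almost_split_unique_right(1)[OF s s' iso(2)]] by blast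
  then show ?thesis using arrow_into_iff[OF s' \<chi>_fg \<Gamma>D(1)[OF mem(2)] \<Gamma>D(1)[OF mem(4)]] by simp
qed

text \<open>Chosen representatives of the isomorphism classes turn the translation into a function.\<close>

definition rep :: "('a, 'm) module \<Rightarrow> ('a, 'm) module" where
  "rep W = (SOME Y. Y \<in> \<Gamma> \<and> mod_iso A W Y)"

lemma rep: assumes "W \<in> \<Gamma>" shows "rep W \<in> \<Gamma>" "mod_iso A W (rep W)"
proof -
  have "W \<in> \<Gamma> \<and> mod_iso A W W" using assms iso_refl \<Gamma>D(4) by blast
  then have "rep W \<in> \<Gamma> \<and> mod_iso A W (rep W)" unfolding rep_def by (rule someI)
  then show "rep W \<in> \<Gamma>" "mod_iso A W (rep W)" by auto
qed

lemma rep_iso: assumes "W \<in> \<Gamma>" shows "mod_iso A (rep W) W"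
  using iso_sym \<Gamma>D(4) rep[OF assms] assms by blast

lemma rep_eq_iff: assumes "W \<in> \<Gamma>" "Y \<in> \<Gamma>" shows "rep W = rep Y \<longleftrightarrow> mod_iso A W Y"
proof
  note fg = \<Gamma>D(4)[OF assms(1)] \<Gamma>D(4)[OF assms(2)]
  show "mod_iso A W Y" if "rep W = rep Y"
    using iso_trans[OF fg(1) rep(2)[OF assms(1)]] rep_iso[OF assms(2)] that by simp
  assume i: "mod_iso A W Y"
  have "(\<lambda>V. V \<in> \<Gamma> \<and> mod_iso A W V) = (\<lambda>V. V \<in> \<Gamma> \<and> mod_iso A Y V)"
    using iso_trans[OF fg(1) i] iso_trans[OF fg(2) iso_sym[OF fg i]] by blast
  then show "rep W = rep Y" unfolding rep_def by (rule arg_cong)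
qed

lemma rep_rep: "W \<in> \<Gamma> \<Longrightarrow> rep (rep W) = rep W"
  using rep_eq_iff rep rep_iso by blast

definition verts :: "('a, 'm) module set" where "verts = rep ` \<Gamma>"

lemma vertsD: assumes "x \<in> verts" shows "x \<in> \<Gamma>" "rep x = x"
  using assms rep rep_rep by (auto simp: verts_def)

definition tr :: "('a, 'm) module \<Rightarrow> ('a, 'm) module" where
  "tr x = rep (SOME Z. tau A \<chi> x Z)"

lemma tr_rep: assumes "W \<in> \<Gamma>" "tau A \<chi> W Z" shows "tr (rep W) = rep Z"
proof -
  have "tau A \<chi> (rep W) (SOME Z. tau A \<chi> (rep W) Z)" using tau_exists(1)[OF rep(1)[OF assms(1)]] by (rule someI_ex)
  then have "mod_iso A (SOME Z. tau A \<chi> (rep W) Z) Z" "(SOME Z. tau A \<chi> (rep W) Z) \<in> \<Gamma>"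
    using tau_cong[OF _ assms(2)] rep_iso[OF assms(1)] tau_\<Gamma> rep(1)[OF assms(1)] by blast+
  moreover have "Z \<in> \<Gamma>" using tau_\<Gamma>[OF assms(2)] assms(1) by simp
  ultimately show ?thesis unfolding tr_def using rep_eq_iff by blast
qed

definition arr :: "('a, 'm) module \<Rightarrow> ('a, 'm) module \<Rightarrow> bool" where
  "arr x y \<longleftrightarrow> x \<in> verts \<and> y \<in> verts \<and> arrow A \<chi> x y"

lemma arr_rep: assumes "W \<in> \<Gamma>" "Y \<in> \<Gamma>" shows "arr (rep W) (rep Y) \<longleftrightarrow> arrow A \<chi> W Y"
  using arrow_cong[OF assms(1) rep(1)[OF assms(1)] assms(2) rep(1)[OF assms(2)]]
    arrow_cong[OF rep(1)[OF assms(1)] assms(1) rep(1)[OF assms(2)] assms(2)]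
    rep(2) rep_iso assms by (auto simp: arr_def verts_def)

lemma mdim_rep: "W \<in> \<Gamma> \<Longrightarrow> mdim (rep W) = mdim W"
  using iso_dim[of "rep W" W] rep_iso rep \<Gamma>D(4) by blast

lemma pred_retracts:
  assumes Y: "Y \<in> \<Gamma>" and s: "almost_split_sequence A \<chi> Z f E g Y" and x: "x \<in> {x. arr x (rep Y)}"
  shows "indecomposable A x \<and> is_retract x E"
proof -
  have "x \<in> \<Gamma>" "rep x = x" using x vertsD by (auto simp: arr_def)
  moreover then have "arrow A \<chi> x Y" using x arr_rep[of x Y] Y by simp
  ultimately show ?thesis using arrow_into_iff[OF s \<chi>_fg \<Gamma>D(1) \<Gamma>D(1)[OF Y]] \<Gamma>D(3) by blast
qed

lemma pred_noniso: "x \<in> {x. arr x y} \<Longrightarrow> x' \<in> {x. arr x y} \<Longrightarrow> mod_iso A x x' \<Longrightarrow> x = x'"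
  using vertsD rep_eq_iff by (fastforce simp: arr_def)

lemma mdim_pos: "W \<in> \<Gamma> \<Longrightarrow> mdim W > 0"
  using mdim_eq_0_iff[OF \<Gamma>D(4)] \<Gamma>D(3) by (auto simp: indecomposable_def)

text \<open>Since dimensions are positive, a set of more than \<open>mdim E\<close> predecessors would violate the
  bound on the sum of their dimensions; hence there are only finitely many.\<close>

lemma pred_sum:
  assumes Y: "Y \<in> \<Gamma>" and s: "almost_split_sequence A \<chi> Z f E g Y"
  shows "finite {x. arr x (rep Y)}" "(\<Sum>x | arr x (rep Y). mdim x) \<le> mdim E"
proof -
  let ?P = "{x. arr x (rep Y)}"
  have le: "(\<Sum>x\<in>S. mdim x) \<le> mdim E" if "finite S" "S \<subseteq> ?P" for S
    by (rule sum_dim_retracts_le)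
      (use that almost_split_sequenceD(2)[OF s] pred_retracts[OF Y s] pred_noniso in blast)+
  show fin: "finite ?P"
  proof (rule ccontr)
    assume "infinite ?P"
    then obtain S where S: "S \<subseteq> ?P" "finite S" "card S = Suc (mdim E)"
      using infinite_arbitrarily_large by blast
    have "card S = (\<Sum>x\<in>S. 1)" by simp
    also have "\<dots> \<le> (\<Sum>x\<in>S. mdim x)"
    proof (rule sum_mono)
      fix x assume "x \<in> S"
      then have "x \<in> \<Gamma>" using S(1) vertsD(1) by (auto simp: arr_def)
      then show "1 \<le> mdim x" using mdim_pos[of x] by simp
    qed
    finally show False using le[OF S(2,1)] S(3) by simp
  qed
  show "(\<Sum>x\<in>?P. mdim x) \<le> mdim E" by (rule le[OF fin]) simp
qed

lemma middle_dim:
  assumes Y: "Y \<in> \<Gamma>" and t: "tau A \<chi> Y Z" and s: "almost_split_sequence A \<chi> Z f E g Y"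
  shows "mdim E = mdim (rep Y) + mdim (tr (rep Y))"
proof -
  have "Z \<in> \<Gamma>" using tau_\<Gamma>[OF t] Y by simp
  then show ?thesis
    using short_exact_dim[of Z f E g Y] s mdim_rep Y tr_rep[OF Y t] by (simp add: almost_split_sequence_def)
qed

lemma relpow_tau:
  assumes "W \<in> \<Gamma>" "((tau A \<chi>) ^^ n) W Z" shows "Z \<in> \<Gamma> \<and> rep Z = (tr ^^ n) (rep W)"
  using assms(2)
proof (induction n arbitrary: Z)
  case (Suc n)
  then obtain Z' where Z': "((tau A \<chi>) ^^ n) W Z'" "tau A \<chi> Z' Z" by auto
  then show ?case using Suc.IH[OF Z'(1)] tau_\<Gamma>[OF Z'(2)] tr_rep[OF _ Z'(2)] by simp
qed (use assms(1) in simp)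

lemma relpow_tau_inverse:
  assumes "W \<in> \<Gamma>" "((tau A \<chi>)\<inverse>\<inverse> ^^ n) W Z" shows "Z \<in> \<Gamma> \<and> rep W = (tr ^^ n) (rep Z)"
  using assms(2)
proof (induction n arbitrary: Z)
  case (Suc n)
  then obtain Z' where Z': "((tau A \<chi>)\<inverse>\<inverse> ^^ n) W Z'" "tau A \<chi> Z Z'"
    by (metis relpowp_Suc_E conversepD)
  then show ?case using Suc.IH[OF Z'(1)] tau_\<Gamma>[OF Z'(2)] tr_rep[OF _ Z'(2)] by (simp add: funpow_swap1)
qed (use assms(1) in simp)

lemma relpow_tau_exists:
  assumes "W \<in> \<Gamma>" shows "\<exists>Z. ((tau A \<chi>) ^^ n) W Z"
proof (induction n)
  case (Suc n)
  then obtain Z where "((tau A \<chi>) ^^ n) W Z" by blast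
  moreover then obtain Z' where "tau A \<chi> Z Z'" using relpow_tau[OF assms] tau_exists(1) by blast
  ultimately show ?case by auto
qed auto

lemma tau_pow_iff:
  assumes "W \<in> \<Gamma>" "Y \<in> \<Gamma>" shows "tau_pow A \<chi> (int n) W Y \<longleftrightarrow> rep Y = (tr ^^ n) (rep W)"
proof
  assume "tau_pow A \<chi> (int n) W Y"
  then obtain Z where Z: "((tau A \<chi>) ^^ n) W Z" "mod_iso A Z Y" by (auto simp: tau_pow_def)
  then show "rep Y = (tr ^^ n) (rep W)" using relpow_tau[OF assms(1) Z(1)] rep_eq_iff assms(2) by metis
next
  assume e: "rep Y = (tr ^^ n) (rep W)"
  obtain Z where Z: "((tau A \<chi>) ^^ n) W Z" using relpow_tau_exists[OF assms(1)] by blast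
  then have "mod_iso A Z Y" using relpow_tau[OF assms(1) Z] e rep_eq_iff[of Z Y] assms(2) by simp
  then show "tau_pow A \<chi> (int n) W Y" using Z \<Gamma>D(1) assms by (auto simp: tau_pow_def)
qed

sublocale quiver: translation_quiver verts tr arr mdim
proof
  have tau: "\<exists>Z f E g. tau A \<chi> Y Z \<and> Z \<in> \<Gamma> \<and> almost_split_sequence A \<chi> Z f E g Y" if "Y \<in> \<Gamma>" for Y
  proof -
    obtain Z where Z: "tau A \<chi> Y Z" using tau_exists(1) \<open>Y \<in> \<Gamma>\<close> by blast
    then have "Z \<in> \<Gamma>" using tau_\<Gamma> \<open>Y \<in> \<Gamma>\<close> by blast
    then show ?thesis using Z by (auto simp: tau_def)
  qed
  have tr_verts: "tr x \<in> verts" if "x \<in> verts" for x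
    using tau[of x] tr_rep[of x] vertsD[OF that] by (metis verts_def imageI)
  show "bij_betw tr verts verts"
    unfolding bij_betw_def
  proof
    show "inj_on tr verts"
    proof (rule inj_onI)
      fix x y assume xy: "x \<in> verts" "y \<in> verts" "tr x = tr y"
      obtain Z where Z: "tau A \<chi> x Z" "Z \<in> \<Gamma>" using tau vertsD(1)[OF xy(1)] by blast
      obtain Z' where Z': "tau A \<chi> y Z'" "Z' \<in> \<Gamma>" using tau vertsD(1)[OF xy(2)] by blast
      have "rep Z = rep Z'"
        using tr_rep[OF _ Z(1)] tr_rep[OF _ Z'(1)] vertsD[OF xy(1)] vertsD[OF xy(2)] xy(3) by simp
      then have "mod_iso A x y" using rep_eq_iff[OF Z(2) Z'(2)] tau_cong[OF Z(1) Z'(1)] by simp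
      then show "x = y" using rep_eq_iff vertsD[OF xy(1)] vertsD[OF xy(2)] by metis
    qed
    have "y \<in> tr ` verts" if y: "y \<in> verts" for y
    proof -
      obtain W where W: "tau A \<chi> W y" using tau_exists(2) vertsD(1)[OF y] by blast
      then have "W \<in> \<Gamma>" using tau_\<Gamma> vertsD(1)[OF y] by blast
      then show ?thesis using tr_rep[OF _ W] vertsD(2)[OF y] by (metis verts_def imageI)
    qed
    then show "tr ` verts = verts" using tr_verts by blast
  qed
  show "x \<in> verts \<and> y \<in> verts" if "arr x y" for x y using that by (simp add: arr_def)
  show "arr (tr y) x \<longleftrightarrow> arr x y" if xy: "x \<in> verts" "y \<in> verts" for x y
  proof -
    obtain Z where Z: "tau A \<chi> y Z" "Z \<in> \<Gamma>" using tau vertsD(1)[OF xy(2)] by blast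
    have "tr y = rep Z" using tr_rep[OF _ Z(1)] vertsD[OF xy(2)] by simp
    then have "arr (tr y) x \<longleftrightarrow> arrow A \<chi> Z x" using arr_rep[OF Z(2), of x] vertsD[OF xy(1)] by simp
    then show ?thesis using arrow_tau[OF Z(1) vertsD(1)[OF xy(1)]] xy by (simp add: arr_def)
  qed
  fix y assume y: "y \<in> verts"
  obtain Z f E g where Z: "tau A \<chi> y Z" "almost_split_sequence A \<chi> Z f E g y" using tau vertsD(1)[OF y] by blast
  show "finite {x. arr x y}" using pred_sum(1)[OF vertsD(1)[OF y] Z(2)] vertsD(2)[OF y] by simp
  show "(\<Sum>x | arr x y. mdim x) \<le> mdim y + mdim (tr y)"
    using pred_sum(2)[OF vertsD(1)[OF y] Z(2)] middle_dim[OF vertsD(1)[OF y] Z] vertsD(2)[OF y] by simp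
  show "0 < mdim y" using mdim_pos vertsD(1)[OF y] by blast
  fix x assume x: "x \<in> verts"
  let ?S = "\<lambda>a b. a \<in> verts \<and> b \<in> verts \<and> (arr a b \<or> arr b a \<or> b = tr a \<or> a = tr b)"
  have "(walk_step A \<chi> \<Gamma>)\<^sup>*\<^sup>* x y"
    using conn vertsD(1)[OF x] vertsD(1)[OF y] unfolding connected_subquiver_def by blast
  then have "?S\<^sup>*\<^sup>* (rep x) (rep y)"
  proof (induction rule: rtranclp_induct)
    case (step W Y)
    have mem: "W \<in> \<Gamma>" "Y \<in> \<Gamma>" using step.hyps(2) by (auto simp: walk_step_def)
    then have "rep W \<in> verts" "rep Y \<in> verts" by (auto simp: verts_def)
    moreover have "arr (rep W) (rep Y) \<or> arr (rep Y) (rep W) \<or> rep Y = tr (rep W) \<or> rep W = tr (rep Y) \<or> rep W = rep Y"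
    proof -
      consider "arrow A \<chi> W Y" | "arrow A \<chi> Y W" | "tau A \<chi> W Y" | "tau A \<chi> Y W" | "mod_iso A W Y"
        using step.hyps(2) by (auto simp: walk_step_def)
      then show ?thesis
        by cases (simp_all add: arr_rep[OF mem] arr_rep[OF mem(2,1)] tr_rep[OF mem(1)] tr_rep[OF mem(2)] rep_eq_iff[OF mem])
    qed
    ultimately have "?S (rep W) (rep Y) \<or> rep W = rep Y" by blast
    then show ?case
    proof
      assume "?S (rep W) (rep Y)"
      with step.IH show ?case by (rule rtranclp.rtrancl_into_rtrancl)
    qed (use step.IH in simp)
  qed simp
  then show "?S\<^sup>*\<^sup>* x y" using vertsD(2)[OF x] vertsD(2)[OF y] by simp
next
  show "infinite verts"
  proof
    assume fin: "finite verts"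
    let ?R = "{(W, Y). W \<in> \<Gamma> \<and> Y \<in> \<Gamma> \<and> mod_iso A W Y}"
    have "\<Gamma> // ?R \<subseteq> (\<lambda>x. {Y \<in> \<Gamma>. rep Y = x}) ` verts"
    proof
      fix C assume "C \<in> \<Gamma> // ?R"
      then obtain W where W: "W \<in> \<Gamma>" "C = ?R `` {W}" by (auto simp: quotient_def)
      have "rep Y = rep W \<longleftrightarrow> mod_iso A W Y" if "Y \<in> \<Gamma>" for Y
        using rep_eq_iff[OF W(1) that] by metis
      then have "C = {Y \<in> \<Gamma>. rep Y = rep W}" using W by auto
      then show "C \<in> (\<lambda>x. {Y \<in> \<Gamma>. rep Y = x}) ` verts" using W(1) by (auto simp: verts_def)
    qed
    then have "finite (\<Gamma> // ?R)" using fin finite_surj by blast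
    then show False using infin by (simp add: infinite_subquiver_def)
  qed
  obtain W n where W: "W \<in> \<Gamma>" "n \<ge> 1" "tau_pow A \<chi> n W W" using periodic_module by (auto simp: tau_periodic_def)
  then have "(tr ^^ nat n) (rep W) = rep W" using tau_pow_iff[OF W(1,1), of "nat n"] by simp
  moreover have "nat n \<ge> 1" using W(2) by simp
  moreover have "rep W \<in> verts" using W(1) by (simp add: verts_def)
  ultimately show "\<exists>x\<in>verts. \<exists>p\<ge>1. (tr ^^ p) x = x" by blast
qed

lemma all_periodic: assumes W: "W \<in> \<Gamma>" shows "tau_periodic A \<chi> W"
proof -
  have "rep W \<in> verts" using W by (simp add: verts_def)
  then obtain p where "p \<ge> 1" "(tr ^^ p) (rep W) = rep W" using quiver.periodic by blast
  then show ?thesis unfolding tau_periodic_def using tau_pow_iff[OF W W, of p]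
    by (intro exI[of _ "int p"]) simp
qed

text \<open>Negative powers of the translation lead to no further modules, because all vertices are
  periodic.\<close>

lemma tau_orbit_eq:
  assumes W: "W \<in> \<Gamma>" shows "tau_orbit A \<chi> W = {Y \<in> \<Gamma>. quiver.orb (rep Y) = quiver.orb (rep W)}"
proof
  have v: "rep W \<in> verts" if "W \<in> \<Gamma>" for W using that by (simp add: verts_def)
  show "tau_orbit A \<chi> W \<subseteq> {Y \<in> \<Gamma>. quiver.orb (rep Y) = quiver.orb (rep W)}"
  proof
    fix Y assume "Y \<in> tau_orbit A \<chi> W"
    then obtain n where n: "tau_pow A \<chi> n W Y" by (auto simp: tau_orbit_def)
    then have Y: "Y \<in> \<Gamma>" by (rule tau_pow_\<Gamma>[OF W])
    obtain Z where Z: "if n \<ge> 0 then ((tau A \<chi>) ^^ nat n) W Z else ((tau A \<chi>)\<inverse>\<inverse> ^^ nat (- n)) W Z" "mod_iso A Z Y"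
      using n by (auto simp: tau_pow_def)
    have "Z \<in> \<Gamma> \<and> quiver.orb (rep Z) = quiver.orb (rep W)"
    proof (cases "n \<ge> 0")
      case True
      then show ?thesis using relpow_tau[OF W, of "nat n" Z] Z(1) quiver.orb_tn[OF v[OF W]] by simp
    next
      case False
      then have "Z \<in> \<Gamma>" "rep W = (tr ^^ nat (- n)) (rep Z)" using relpow_tau_inverse[OF W, of "nat (- n)" Z] Z(1) by simp_all
      then show ?thesis using quiver.orb_tn[OF v] by simp
    qed
    then show "Y \<in> {Y \<in> \<Gamma>. quiver.orb (rep Y) = quiver.orb (rep W)}" using Y Z(2) rep_eq_iff[of Z Y] by simp
  qed
  show "{Y \<in> \<Gamma>. quiver.orb (rep Y) = quiver.orb (rep W)} \<subseteq> tau_orbit A \<chi> W"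
  proof
    fix Y assume "Y \<in> {Y \<in> \<Gamma>. quiver.orb (rep Y) = quiver.orb (rep W)}"
    then have Y: "Y \<in> \<Gamma>" "quiver.orb (rep W) = quiver.orb (rep Y)" by auto
    then obtain n where "rep Y = (tr ^^ n) (rep W)" using quiver.orb_eq_iff v W by blast
    then show "Y \<in> tau_orbit A \<chi> W" unfolding tau_orbit_def using tau_pow_iff[OF W Y(1)] by blast
  qed
qed

text \<open>Additivity says that the predecessors of \<open>Y\<close> account for the whole dimension of the middle
  term, so every indecomposable retract of the middle term is isomorphic to one of them.  Thus
  \<open>\<Gamma>\<close> is closed under the lifting of chains, while its dimensions are bounded.\<close>

lemma not_additive_and_bounded:
  assumes add: "\<forall>y\<in>verts. (\<Sum>x | arr x y. mdim x) = mdim y + mdim (tr y)" and bd: "\<forall>x\<in>verts. mdim x \<le> c"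
  shows False
proof (rule no_bounded_closed_family)
  show "\<Gamma> \<noteq> {}" using periodic_module by blast
  show "indecomposable A M \<and> mdim M \<le> c" if "M \<in> \<Gamma>" for M
    using \<Gamma>D(3)[OF that] bd mdim_rep[OF that] that by (metis verts_def imageI)
  fix Y assume Y: "Y \<in> \<Gamma>"
  obtain Z where Z: "tau A \<chi> Y Z" using tau_exists(1)[OF Y] by blast
  then obtain f E g where s: "almost_split_sequence A \<chi> Z f E g Y" by (auto simp: tau_def)
  note sd = almost_split_sequenceD[OF s]
  have "rep Y \<in> verts" using Y by (simp add: verts_def)
  then have eq: "(\<Sum>x | arr x (rep Y). mdim x) = mdim E" using add middle_dim[OF Y Z s] by simp
  have "V \<in> \<Gamma>" if V: "indecomposable A V" "is_retract V E" for V
  proof -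
    have "\<exists>W\<in>{x. arr x (rep Y)}. mod_iso A W V"
      by (rule sum_dim_retracts_eq[OF pred_sum(1)[OF Y s] sd(2) pred_retracts[OF Y s] pred_noniso eq V])
    then obtain W where W: "W \<in> {x. arr x (rep Y)}" "mod_iso A W V" by blast
    then show ?thesis using \<Gamma>_iso[OF _ V(1) W(2)] vertsD(1) by (simp add: arr_def)
  qed
  then show "\<exists>E g. E \<in> fg_mods A \<and> g \<in> mod_hom A E Y \<and> g ` carrier E = carrier Y \<and>
       \<not> (\<exists>s. retract Y E s g) \<and> (\<forall>V. indecomposable A V \<longrightarrow> is_retract V E \<longrightarrow> V \<in> \<Gamma>)"
    using sd(2,5,8,13) by (intro exI[of _ E] exI[of _ g]) simp
qed

text \<open>The lifted path is sectional because its members lie in different orbits, whereas \<open>\<tau>\<close> preserves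
  orbits.\<close>

theorem is_stable_tube: "stable_tube A \<chi> \<Gamma>"
proof -
  have "\<exists>w. (\<forall>i. w i \<in> verts \<and> arr (w (Suc i)) (w i)) \<and> (\<forall>y\<in>verts. \<exists>!i. quiver.orb y = quiver.orb (w i))"
    using quiver.hamiltonian_path_or_additive
  proof
    assume "(\<forall>y\<in>verts. (\<Sum>x | arr x y. mdim x) = mdim y + mdim (tr y)) \<and> (\<exists>c. \<forall>x\<in>verts. mdim x \<le> c)"
    then show ?thesis using not_additive_and_bounded by (elim conjE exE) (rule FalseE)
  qed
  then obtain w where w': "\<forall>i. w i \<in> verts \<and> arr (w (Suc i)) (w i)"
    "\<forall>y\<in>verts. \<exists>!i. quiver.orb y = quiver.orb (w i)" by (elim exE conjE)
  have w: "w i \<in> verts" "arr (w (Suc i)) (w i)" for i using w'(1) by simp_all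
  have wG: "w i \<in> \<Gamma>" "rep (w i) = w i" for i using vertsD[OF w(1)] by auto
  have "\<not> tau A \<chi> (w i) (w (i + 2))" for i
  proof
    assume "tau A \<chi> (w i) (w (i + 2))"
    then have "tr (w i) = w (i + 2)" using tr_rep[OF wG(1)] wG(2) by metis
    then have "quiver.orb (w i) = quiver.orb (w (i + 2))" using quiver.orb_t[OF w(1)] by metis
    then have "i = i + 2" using bspec[OF w'(2) w(1)[of i]] by blast
    then show False by simp
  qed
  then have path: "infinite_sectional_path A \<chi> \<Gamma> w"
    using wG(1) w(2) by (simp add: infinite_sectional_path_def arr_def)
  have "\<exists>!i. tau_orbit A \<chi> Y = tau_orbit A \<chi> (w i)" if Y: "Y \<in> \<Gamma>" for Y
  proof -
    have "tau_orbit A \<chi> Y = tau_orbit A \<chi> (w i) \<longleftrightarrow> quiver.orb (rep Y) = quiver.orb (w i)" for i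
      unfolding tau_orbit_eq[OF Y] tau_orbit_eq[OF wG(1)] wG(2) using Y by blast
    moreover have "rep Y \<in> verts" using Y by (simp add: verts_def)
    ultimately show ?thesis using w'(2) by simp
  qed
  then show ?thesis unfolding stable_tube_def using stable all_periodic path by blast
qed

end

theorem theorem3p2p7:
  fixes k :: "'k ring" and A :: "('k, 'a) module"
    and \<chi> \<Gamma> :: "('a, nat \<Rightarrow> 'k) module set"
  assumes "algebraically_closed k"
    and "artin_algebra k A" and "indecomposable_algebra A"
    and "subcategory A \<chi>" and "functorially_finite A \<chi>" and "extension_closed A \<chi>"
    and "\<exists>T. generalized_cotilting A T \<and> functorially_finite A (left_perp A T) \<and>
           resolving A (left_perp A T) \<and> left_perp A T \<subseteq> \<chi>"
    and "stable_subquiver A \<chi> \<Gamma>" and "connected_subquiver A \<chi> \<Gamma>" and "infinite_subquiver A \<chi> \<Gamma>"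
    and "\<exists>W\<in>\<Gamma>. tau_periodic A \<chi> W"
  shows "stable_tube A \<chi> \<Gamma>"
proof -
  interpret stable_periodic_subquiver k A \<chi> \<Gamma>
    using assms(2,4,8-11) by unfold_locales
  show ?thesis by (rule is_stable_tube)
qed

end
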